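(* Let $N\ge 2$ and let $a,b$ be real numbers such that $\left(\frac N2-a\right)^2\ge N+1$. For all $\mathbf U\in X_{a,b}(\mathbb R^N)$ that are curl-free, the following holds. (1) If $a-b+1>0$, then $$\int_{\mathbb R^N}\frac{|\nabla\mathbf U|^2}{|x|^{2a}}\,dx\int_{\mathbb R^N}\frac{|\mathbf U|^2}{|x|^{2b}}\,dx\ \ge\ C^2(N,a,b)\left(\int_{\mathbb R^N}\frac{|\mathbf U|^2}{|x|^{a+b+1}}\,dx\right)^2,$$ where $$C(N,a,b)=\sqrt{\left(1-\tfrac N2+a\right)^2+N-1}+\frac{a-b+1}{2}.$$ The constant $C^2(N,a,b)$ is sharp and is attained by the curl-free vector fields $$\mathbf U(x)=\gamma\,|x|^{-\frac N2+a+\sqrt{\left(1-\frac N2+a\right)^2+N-1}}\;e^{-\frac{\beta}{a-b+1}|x|^{a-b+1}}\,x,\qquad \gamma\in\mathbb R,\ \beta>0.$$ (2) If $a-b+1<0$, then $$\int_{\mathbb R^N}\frac{|\nabla\mathbf U|^2}{|x|^{2a}}\,dx\int_{\mathbb R^N}\frac{|\mathbf U|^2}{|x|^{2b}}\,dx\ \ge\ C^2(N,a,b)\left(\int_{\mathbb R^N}\frac{|\mathbf U|^2}{|x|^{a+b+1}}\,dx\right)^2,$$ where $$C(N,a,b)=\sqrt{\left(1-\tfrac N2+a\right)^2+N-1}-\frac{a-b+1}{2}.$$ The constant $C^2(N,a,b)$ is sharp and is attained by the curl-free vector fields $$\mathbf U(x)=\gamma\,|x|^{-\frac N2+a-\sqrt{\left(1-\frac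 N2+a\right)^2+N-1}}\;e^{-\frac{\beta}{a-b+1}|x|^{a-b+1}}\,x,\qquad \gamma\in\mathbb R,\ \beta<0.$$
   Context: $X_{a,b}(\mathbb R^N)$ is the set of vector fields $\mathbf U=(U_1,\dots,U_N)\in \left(C^\infty(\mathbb R^N\setminus\{0\})\right)^N$ such that $$\int_{\mathbb R^N}\frac{|\nabla\mathbf U|^2}{|x|^{2a}}dx<\infty,\quad \int_{\mathbb R^N}\frac{|\mathbf U|^2}{|x|^{2b}}dx<\infty,\quad \int_{\mathbb R^N}\frac{|\mathbf U|^2}{|x|^{a+b+1}}dx<\infty,$$ $$\lim_{|x|\to0,\infty}|x|^{-1+\frac N2-a}\,\mathbf U(x)=0\quad\text{and}\quad \lim_{|x|\to0,\infty}|x|^{-b+\frac N2}\,\mathbf U(x)=0,$$ where "$\lim_{|x|\to0,\infty}$" means that the limit holds both as $|x|\to0$ and as $|x|\to\infty$. Here $|\nabla\mathbf U|^2=\sum_{j,k}|\partial_jU_k|^2$. A vector field $\mathbf U$ is curl-free if $\mathbf U=\nabla u$ for some (complex-valued) scalar potential $u$ (smooth on $\mathbb R^N\setminus\{0\}$). "Sharp" means that the constant cannot be replaced by a larger one for the class of fields considered; "attained by" means that equality holds for the listed fields. *)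

theory Defs
  imports "HOL-Analysis.Analysis"
begin

text \<open>
  A function is \<open>C\<^sup>n\<close> on an open set \<open>S\<close> if it is differentiable there and each of its
  directional derivatives is \<open>C\<^sup>n\<^sup>-\<^sup>1\<close> on \<open>S\<close>.  Only used for open \<open>S\<close>.
\<close>

primrec Ck_on ::
    "nat \<Rightarrow> ('a::real_normed_vector \<Rightarrow> 'b::real_normed_vector) \<Rightarrow> 'a set \<Rightarrow> bool" where
  "Ck_on 0 f S \<longleftrightarrow> continuous_on S f"
| "Ck_on (Suc n) f S \<longleftrightarrow>
     (\<forall>x\<in>S. f differentiable (at x)) \<and>
     (\<forall>v. Ck_on n (\<lambda>x. frechet_derivative f (at x) v) S)"

definition smooth_on ::
    "('a::real_normed_vector \<Rightarrow> 'b::real_normed_vector) \<Rightarrow> 'a set \<Rightarrow> bool" where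
  "smooth_on f S \<longleftrightarrow> (\<forall>n. Ck_on n f S)"

definition partial :: "'n \<Rightarrow> (real^'n \<Rightarrow> 'b::real_normed_vector) \<Rightarrow> real^'n \<Rightarrow> 'b" where
  "partial j f x = frechet_derivative f (at x) (axis j 1)"

definition grad_norm_sq :: "(real^'n \<Rightarrow> complex^'n) \<Rightarrow> real^'n \<Rightarrow> real" where
  "grad_norm_sq U x = (\<Sum>j\<in>UNIV. \<Sum>k\<in>UNIV. (cmod (partial j (\<lambda>y. U y $ k) x))\<^sup>2)"

text \<open>
  Vector fields on \<open>\<real>\<^sup>N \<setminus> {0}\<close> are represented by total functions whose value at the origin is
  irrelevant: the origin is a null set and the other conditions do not look at it.
  The weighted integrands below are thus Borel functions as soon as \<open>U\<close> is smooth off the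
  origin, and, being nonnegative, they are integrable iff their integral is finite.
\<close>

definition grad_integrand :: "real \<Rightarrow> (real^'n \<Rightarrow> complex^'n) \<Rightarrow> real^'n \<Rightarrow> real" where
  "grad_integrand a U x = grad_norm_sq U x / norm x powr (2 * a)"

definition field_integrand :: "real \<Rightarrow> (real^'n \<Rightarrow> complex^'n) \<Rightarrow> real^'n \<Rightarrow> real" where
  "field_integrand c U x = (norm (U x))\<^sup>2 / norm x powr c"

definition X_space :: "real \<Rightarrow> real \<Rightarrow> (real^'n \<Rightarrow> complex^'n) set" where
  "X_space a b = {U.
     smooth_on U (- {0}) \<and>
     integrable lborel (grad_integrand a U) \<and>
     integrable lborel (field_integrand (2 * b) U) \<and>
     integrable lborel (field_integrand (a + b + 1) U) \<and>
     (\<forall>F\<in>{at 0, at_infinity}.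
        ((\<lambda>x. norm x powr (- 1 + real CARD('n) / 2 - a) *\<^sub>R U x) \<longlongrightarrow> 0) F \<and>
        ((\<lambda>x. norm x powr (- b + real CARD('n) / 2) *\<^sub>R U x) \<longlongrightarrow> 0) F)}"

definition curl_free :: "(real^'n \<Rightarrow> complex^'n) \<Rightarrow> bool" where
  "curl_free U \<longleftrightarrow>
     (\<exists>u :: real^'n \<Rightarrow> complex. smooth_on u (- {0}) \<and>
        (\<forall>x. x \<noteq> 0 \<longrightarrow> U x = (\<chi> k. partial k u x)))"

text \<open>\<open>\<gamma> |x|\<^sup>p exp (- \<beta> / (a - b + 1) |x|\<^sup>a\<^sup>-\<^sup>b\<^sup>+\<^sup>1) x\<close>, a real field viewed as a complex one.\<close>

definition radial_field ::
    "real \<Rightarrow> real \<Rightarrow> real \<Rightarrow> real \<Rightarrow> real \<Rightarrow> real^'n \<Rightarrow> complex^'n" where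
  "radial_field a b p \<gamma> \<beta> x =
     (\<chi> k. complex_of_real
        (\<gamma> * norm x powr p * exp (- (\<beta> / (a - b + 1)) * norm x powr (a - b + 1)) * x $ k))"

definition grad_energy :: "real \<Rightarrow> (real^'n \<Rightarrow> complex^'n) \<Rightarrow> real" where
  "grad_energy a U = integral\<^sup>L lborel (grad_integrand a U)"

definition field_energy :: "real \<Rightarrow> (real^'n \<Rightarrow> complex^'n) \<Rightarrow> real" where
  "field_energy c U = integral\<^sup>L lborel (field_integrand c U)"

end

theory Submission
  imports Defs
begin

text \<open>
  Write \<open>U = \<nabla>u\<close>, \<open>r = |x|\<close>, \<open>\<kappa> = 1 - N/2 + a\<close>, \<open>\<delta> = a - b + 1\<close>, and \<open>D = x \<cdot> \<nabla>\<close>.  Up to total radial derivatives, which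
  the decay conditions remove in the limit of a radial cutoff, the square
  \<open>|D U - \<kappa> U + (\<beta> r\<^sup>\<delta> - \<sigma>) U|\<^sup>2\<close> with \<open>\<sigma>\<^sup>2 = \<kappa>\<^sup>2 + N - 1\<close> yields the claimed quadratic form in \<open>\<beta>\<close>, provided
  the angular part of \<open>|\<nabla>U|\<^sup>2\<close> dominates \<open>(N - 1) |U|\<^sup>2 / r\<^sup>2\<close> in the mean.  Splitting \<open>U\<close> into its radial part and
  its tangential part \<open>Y\<close>, the difference of the two is, modulo the divergence of a tangential field,
  \<open>|D Y - Y|\<^sup>2 + |H|\<^sup>2 - (N + 2) |Y|\<^sup>2\<close>, where \<open>H\<close> is the spherical Hessian of the potential.  The first term
  contributes \<open>(N/2 - a)\<^sup>2 |Y|\<^sup>2\<close>, so the hypothesis on \<open>a\<close> reduces everything to \<open>\<integral>|H|\<^sup>2 \<ge> \<integral>|Y|\<^sup>2\<close> on spheres: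
  for \<open>N \<ge> 3\<close> this follows from the Bochner identity and the trace inequality \<open>(N - 1) |H|\<^sup>2 \<ge> (tr H)\<^sup>2\<close>, for
  \<open>N = 2\<close> it is Wirtinger's inequality on circles.  Tangential divergences integrate to zero against any
  radial weight, which replaces integration on spheres throughout.
\<close>

section \<open>Integration by parts on the punctured space\<close>

text \<open>The parameter \<open>\<beta>\<close> is free: a form A - \<open>\<beta>\<close> B +
  \<open>\<beta>\<close>^2 C that is nonnegative for every \<open>\<beta>\<close> satisfies B^2 <= 4
  A C, and this is the product inequality. A product of energies is not additive, so real and
  imaginary parts of a complex field are added in the form, before the discriminant is taken. Only
  the value of \<open>\<sigma>\<close>^2 is prescribed; its sign is at disposal, and case (2) is
  case (1) with the negative root. A radial field has Y = 0, and the remaining square vanishes if D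
  U = (\<open>\<kappa>\<close> + \<open>\<sigma>\<close> - \<open>\<beta>\<close>
  r^\<open>\<delta>\<close>) U; solving this equation along rays produces the listed power and
  exponential, and \<open>\<sigma> * \<delta>\<close> > 0 makes them decay at both ends. The
  hypothesis on a has to pay for (N + 2) |Y|^2 after |H|^2 has returned one |Y|^2, hence the bound N
  + 1. In dimension two the curvature factor N - 2 vanishes and the trace inequality is an equality,
  so the argument for N >= 3 is empty there; the potential being single-valued on circles takes
  over.\<close>

lemma DERIV_along_line:
  assumes "GDERIV f (x + s *\<^sub>R e) :> D"
  shows "((\<lambda>s. f (x + s *\<^sub>R e)) has_real_derivative (e \<bullet> D)) (at s)"
proof -
  have "((\<lambda>s. f (x + s *\<^sub>R e)) has_derivative (\<lambda>s'. (s' *\<^sub>R e) \<bullet> D)) (at s)"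
    by (rule has_derivative_compose[of "\<lambda>s. x + s *\<^sub>R e" _ s UNIV f, simplified])
      (use assms in \<open>auto intro!: derivative_eq_intros simp: gderiv_def\<close>)
  then show ?thesis by (simp add: has_field_derivative_def mult.commute[of _ "e \<bullet> D"])
qed

lemma borel_measurable_punctured:
  fixes h :: "'a::euclidean_space \<Rightarrow> real"
  assumes "continuous_on (- {0}) h"
  shows "h \<in> borel_measurable borel"
proof -
  have "(\<lambda>x. indicator (- {0}) x *\<^sub>R h x) \<in> borel_measurable borel"
    by (rule borel_measurable_continuous_on_indicator) (use assms in auto)
  then have "(\<lambda>x. indicator (- {0}) x *\<^sub>R h x + indicator {0} x * h 0) \<in> borel_measurable borel"
    by measurable
  also have "(\<lambda>x. indicator (- {0}) x *\<^sub>R h x + indicator {0} x * h 0) = h"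
    by (auto simp: fun_eq_iff indicator_def)
  finally show ?thesis .
qed

lemma AE_nonzero: "(\<And>x::'a::euclidean_space. x \<noteq> 0 \<Longrightarrow> P x) \<Longrightarrow> AE x in lborel. P x"
  using AE_lborel_singleton[of "0::'a"] by (auto elim: eventually_mono)

text \<open>Translation invariance of Lebesgue measure gives every difference quotient of f integral
  zero. The quotients converge to the directional derivative and are dominated, by the mean value
  theorem, by its supremum on a compact set.\<close>

lemma integral_gradient_eq_0:
  fixes f :: "'a::euclidean_space \<Rightarrow> real" and g :: "'a \<Rightarrow> 'a"
  assumes der: "\<And>x. GDERIV f x :> g x" and cont: "continuous_on UNIV g"
    and supp: "\<And>x. norm x > B \<Longrightarrow> f x = 0"
  shows "integrable lborel (\<lambda>x. g x \<bullet> e)" "(\<integral>x. g x \<bullet> e \<partial>lborel) = 0"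
proof -
  have hder: "(f has_derivative (\<lambda>h. h \<bullet> g x)) (at x)" for x
    using der[of x] by (simp add: gderiv_def)
  have g0: "g x = 0" if "norm x > B" for x
  proof -
    have "open {y::'a. norm y > B}"
      by (intro open_Collect_less continuous_intros)
    then have "((\<lambda>_. 0) has_derivative (\<lambda>h. h \<bullet> g x)) (at x)"
      using has_derivative_transform_within_open[OF hder, of _ _ "\<lambda>_. 0"] supp that by force
    then have "(\<lambda>h. h \<bullet> g x) = (\<lambda>h. 0)"
      using has_derivative_unique has_derivative_const by blast
    then have "g x \<bullet> g x = 0" by meson
    then show ?thesis by simp
  qed
  \<comment> \<open>The extra \<open>norm e\<close> accounts for the translates: the steps 1/(n+1)
    are at most 1, so all quotients below vanish outside \<open>S\<close>.\<close>
  define S where "S = cball (0::'a) (B + norm e)"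
  have cS: "compact S" by (simp add: S_def)
  have cge: "continuous_on UNIV (\<lambda>x. g x \<bullet> e)" by (intro continuous_intros cont)
  have g0S: "g x = 0" if "x \<notin> S" for x
    using that g0[of x] norm_ge_zero[of e] unfolding S_def mem_cball_0 by linarith
  have "bounded ((\<lambda>x. g x \<bullet> e) ` S)"
    by (intro compact_imp_bounded compact_continuous_image cS continuous_on_subset[OF cge]) simp
  then obtain C where "\<And>x. x \<in> S \<Longrightarrow> \<bar>g x \<bullet> e\<bar> \<le> C"
    unfolding bounded_iff by (metis imageI real_norm_def)
  then have C: "\<bar>g x \<bullet> e\<bar> \<le> \<bar>C\<bar>" for x
    using g0S[of x] by (cases "x \<in> S") fastforce+
  have "integrable lborel (\<lambda>x. indicator S x *\<^sub>R (g x \<bullet> e))"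
    by (rule borel_integrable_compact[OF cS continuous_on_subset[OF cge]]) simp
  also have "(\<lambda>x. indicator S x *\<^sub>R (g x \<bullet> e)) = (\<lambda>x. g x \<bullet> e)"
    using g0S by (auto simp: fun_eq_iff indicator_def)
  finally show "integrable lborel (\<lambda>x. g x \<bullet> e)" .
  have cf: "continuous_on UNIV f"
    using hder has_derivative_continuous by (blast intro: continuous_at_imp_continuous_on)
  have "integrable lborel (\<lambda>x. indicator S x *\<^sub>R f x)"
    by (rule borel_integrable_compact[OF cS continuous_on_subset[OF cf]]) simp
  also have "(\<lambda>x. indicator S x *\<^sub>R f x) = f"
  proof
    fix x show "indicator S x *\<^sub>R f x = f x"
    proof (cases "x \<in> S")
      case False
      then have "norm x > B" using norm_ge_zero[of e] unfolding S_def mem_cball_0 by linarith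
      then show ?thesis using supp by simp
    qed simp
  qed
  finally have fint: "integrable lborel f" .
  have bf: "f \<in> borel_measurable borel" using cf by (rule borel_measurable_continuous_onI)
  have shift: "integrable lborel (\<lambda>x. f (v + x))" "(\<integral>x. f (v + x) \<partial>lborel) = integral\<^sup>L lborel f" for v
  proof -
    have eq: "distr lborel borel ((+) v) = lborel" by (rule lborel_distr_plus)
    have "integrable (distr lborel borel ((+) v)) f" using fint by (simp add: eq)
    then show "integrable lborel (\<lambda>x. f (v + x))"
      by (subst (asm) integrable_distr_eq) (use bf in auto)
    have "integral\<^sup>L (distr lborel borel ((+) v)) f = (\<integral>x. f (v + x) \<partial>lborel)"
      by (rule integral_distr) (use bf in auto)
    then show "(\<integral>x. f (v + x) \<partial>lborel) = integral\<^sup>L lborel f" by (simp add: eq)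
  qed
  define q where "q n x = real (Suc n) * (f ((1 / real (Suc n)) *\<^sub>R e + x) - f x)" for n x
  have qint: "(\<integral>x. q n x \<partial>lborel) = 0" for n
    unfolding q_def by (simp add: shift fint)
  have lim: "(\<lambda>n. q n x) \<longlonglongrightarrow> g x \<bullet> e" for x
  proof -
    have "((\<lambda>s. f (x + s *\<^sub>R e)) has_real_derivative (e \<bullet> g x)) (at 0)"
      using DERIV_along_line[of f x 0 e] der by simp
    then have "((\<lambda>s. (f (x + s *\<^sub>R e) - f x) / s) \<longlongrightarrow> e \<bullet> g x) (at 0)"
      by (simp add: DERIV_def)
    moreover have "filterlim (\<lambda>n. 1 / real (Suc n)) (at 0) sequentially"
      unfolding filterlim_at using LIMSEQ_Suc[OF lim_1_over_n] by (auto intro!: always_eventually)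
    ultimately have "(\<lambda>n. (f (x + (1 / real (Suc n)) *\<^sub>R e) - f x) / (1 / real (Suc n))) \<longlonglongrightarrow> e \<bullet> g x"
      by (rule filterlim_compose)
    then show ?thesis by (simp add: q_def inner_commute add.commute mult.commute)
  qed
  have bnd: "\<bar>q n x\<bar> \<le> \<bar>C\<bar> * indicator S x" for n x
  proof (cases "x \<in> S")
    case True
    define h where "h = 1 / real (Suc n)"
    have h: "h > 0" by (simp add: h_def)
    have d: "((\<lambda>s. f (x + s *\<^sub>R e)) has_real_derivative (e \<bullet> g (x + s *\<^sub>R e))) (at s)" for s
      by (rule DERIV_along_line[OF der])
    obtain z where "f (x + h *\<^sub>R e) - f (x + 0 *\<^sub>R e) = (h - 0) * (e \<bullet> g (x + z *\<^sub>R e))"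
      using MVT2[OF h, of "\<lambda>s. f (x + s *\<^sub>R e)" "\<lambda>s. e \<bullet> g (x + s *\<^sub>R e)"] d by blast
    then have "q n x = g (x + z *\<^sub>R e) \<bullet> e"
      by (simp add: q_def h_def[symmetric] add.commute inner_commute) (simp add: h_def)
    then show ?thesis using C True by simp
  next
    case False
    have "norm x > B" "norm ((1 / real (Suc n)) *\<^sub>R e + x) > B"
    proof -
      have 1: "norm x > B + norm e" using False by (simp add: S_def)
      then show "norm x > B" using norm_ge_zero[of e] by linarith
      have "norm ((1 / real (Suc n)) *\<^sub>R e) \<le> norm e"
        by (simp add: divide_le_eq mult_left_le field_simps)
      then show "norm ((1 / real (Suc n)) *\<^sub>R e + x) > B"
        using 1 norm_diff_ineq[of x "(1 / real (Suc n)) *\<^sub>R e"] by (simp add: add.commute)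
    qed
    then show ?thesis using False supp by (simp add: q_def)
  qed
  have "(\<lambda>n. \<integral>x. q n x \<partial>lborel) \<longlonglongrightarrow> (\<integral>x. g x \<bullet> e \<partial>lborel)"
  proof (rule integral_dominated_convergence[where w="\<lambda>x. \<bar>C\<bar> * indicator S x"])
    show "(\<lambda>x. g x \<bullet> e) \<in> borel_measurable lborel"
      using borel_measurable_continuous_onI[OF cge] by simp
    show "q n \<in> borel_measurable lborel" for n
      unfolding q_def using bf by measurable
    have "S \<in> sets borel" using cS by (simp add: borel_compact)
    moreover have "emeasure lborel S < \<infinity>" using cS by (rule emeasure_compact_finite)
    ultimately show "integrable lborel (\<lambda>x. \<bar>C\<bar> * indicator S x)"
      by (intro integrable_mult_right integrable_real_indicator) auto
  qed (use lim bnd in auto)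
  then show "(\<integral>x. g x \<bullet> e \<partial>lborel) = 0" by (simp add: qint LIMSEQ_const_iff)
qed

section \<open>Calculus of gradients and divergences off the origin\<close>

lemma eventually_nonzero:
  assumes "F \<in> {at 0, at_infinity}"
  shows "\<forall>\<^sub>F x::'a::real_normed_vector in F. x \<noteq> 0"
  using assms by (auto simp: eventually_at_filter eventually_at_infinity intro!: exI[of _ 1])

lemma norm_powr_mult_inner_self:
  fixes x :: "'a::real_inner"
  assumes "x \<noteq> 0"
  shows "norm x powr (q - 2) * (x \<bullet> x) = norm x powr q"
  using powr_add[of "norm x" "q - 2" 2] assms by (simp add: powr_numeral power2_norm_eq_inner)

text \<open>C^1 on the punctured space, with the gradient as an explicit argument so that it can be
  assembled by rules; nothing is asked at the origin.\<close>

definition has_grad :: "(real^'n \<Rightarrow> real) \<Rightarrow> (real^'n \<Rightarrow> real^'n) \<Rightarrow> bool" where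
  "has_grad f g \<longleftrightarrow> (\<forall>x. x \<noteq> 0 \<longrightarrow> GDERIV f x :> g x) \<and> continuous_on (- {0}) g"

text \<open>The rows of the Jacobian are hidden by the quantifier, so that only the divergence has
  to be tracked through sums and products.\<close>

definition has_div :: "(real^'n \<Rightarrow> real^'n) \<Rightarrow> (real^'n \<Rightarrow> real) \<Rightarrow> bool" where
  "has_div F d \<longleftrightarrow> (\<exists>D. (\<forall>j. has_grad (\<lambda>x. F x $ j) (D j)) \<and>
     (\<forall>x. x \<noteq> 0 \<longrightarrow> d x = (\<Sum>j\<in>UNIV. D j x $ j)))"

lemma has_gradD:
  assumes "has_grad f g"
  shows "x \<noteq> 0 \<Longrightarrow> GDERIV f x :> g x" "continuous_on (- {0}) g"
  using assms by (auto simp: has_grad_def)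

lemma has_grad_continuous: "has_grad f g \<Longrightarrow> continuous_on (- {0}) f"
  by (auto simp: has_grad_def gderiv_def
      intro!: continuous_at_imp_continuous_on has_derivative_continuous)

lemma has_grad_cong:
  assumes "has_grad f g" "\<And>x. x \<noteq> 0 \<Longrightarrow> f x = f' x" "\<And>x. x \<noteq> 0 \<Longrightarrow> g x = g' x"
  shows "has_grad f' g'"
  unfolding has_grad_def
proof (intro conjI allI impI)
  fix x :: "real^'a" assume x: "x \<noteq> 0"
  have "(f has_derivative (\<lambda>h. h \<bullet> g x)) (at x)"
    using assms(1) x by (simp add: has_grad_def gderiv_def)
  then have "(f' has_derivative (\<lambda>h. h \<bullet> g x)) (at x)"
    by (rule has_derivative_transform_within_open[of _ _ _ _ "- {0}"]) (use x assms in auto)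
  then show "GDERIV f' x :> g' x" using assms(3)[OF x] by (simp add: gderiv_def)
next
  show "continuous_on (- {0}) g'"
    using continuous_on_cong[of "-{0}" "-{0}" g g'] assms(1,3) by (auto simp: has_grad_def)
qed

lemma has_grad_const: "has_grad (\<lambda>x. c) (\<lambda>x. 0)"
  by (simp add: has_grad_def GDERIV_const)

lemma has_grad_add: "has_grad f f' \<Longrightarrow> has_grad g g' \<Longrightarrow> has_grad (\<lambda>x. f x + g x) (\<lambda>x. f' x + g' x)"
  by (auto simp: has_grad_def intro!: GDERIV_add continuous_intros)

lemma has_grad_diff: "has_grad f f' \<Longrightarrow> has_grad g g' \<Longrightarrow> has_grad (\<lambda>x. f x - g x) (\<lambda>x. f' x - g' x)"
  by (auto simp: has_grad_def intro!: GDERIV_diff continuous_intros)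

lemma has_grad_mult:
  assumes "has_grad f f'" "has_grad g g'"
  shows "has_grad (\<lambda>x. f x * g x) (\<lambda>x. f x *\<^sub>R g' x + g x *\<^sub>R f' x)"
  using assms has_grad_continuous[OF assms(1)] has_grad_continuous[OF assms(2)]
  by (auto simp: has_grad_def intro!: GDERIV_mult continuous_intros)

lemma has_grad_sum:
  assumes "\<And>i. i \<in> I \<Longrightarrow> has_grad (f i) (f' i)"
  shows "has_grad (\<lambda>x. \<Sum>i\<in>I. f i x) (\<lambda>x. \<Sum>i\<in>I. f' i x)"
  using assms
  by (induction I rule: infinite_finite_induct) (auto intro!: has_grad_const has_grad_add)

lemma has_grad_compose:
  assumes "has_grad f f'" "\<And>x. x \<noteq> 0 \<Longrightarrow> DERIV h (f x) :> h' x" "continuous_on (- {0}) h'"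
  shows "has_grad (\<lambda>x. h (f x)) (\<lambda>x. h' x *\<^sub>R f' x)"
  using assms by (auto simp: has_grad_def intro!: GDERIV_DERIV_compose[of f] continuous_intros)

lemma has_grad_component: "has_grad (\<lambda>x. x $ k) (\<lambda>x. axis k 1)"
  by (auto simp: has_grad_def gderiv_def inner_axis
      intro!: bounded_linear_imp_has_derivative bounded_linear_vec_nth)

lemma has_grad_inner_self: "has_grad (\<lambda>x. x \<bullet> x) (\<lambda>x. 2 *\<^sub>R x)"
  by (auto simp: has_grad_def gderiv_def inner_commute intro!: derivative_eq_intros continuous_intros)

lemma has_grad_norm_powr: "has_grad (\<lambda>x. norm x powr p) (\<lambda>x. (p * norm x powr (p - 2)) *\<^sub>R x)"
  unfolding has_grad_def
proof (intro conjI allI impI)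
  fix x :: "real^'a" assume x: "x \<noteq> 0"
  have "GDERIV (\<lambda>x. norm x powr p) x :> (p * norm x powr (p - 1)) *\<^sub>R sgn x"
    using x by (intro GDERIV_DERIV_compose[of norm] GDERIV_norm has_real_derivative_powr) auto
  moreover have "norm x powr (p - 1) * inverse (norm x) = norm x powr (p - 2)"
    using x by (simp add: powr_diff powr_numeral field_simps power2_eq_square)
  ultimately show "GDERIV (\<lambda>x. norm x powr p) x :> (p * norm x powr (p - 2)) *\<^sub>R x"
    by (simp add: sgn_div_norm mult.assoc)
qed (auto intro!: continuous_intros)

lemma has_div_cong:
  assumes "has_div F d" "\<And>x. x \<noteq> 0 \<Longrightarrow> F x = F' x" "\<And>x. x \<noteq> 0 \<Longrightarrow> d x = d' x"
  shows "has_div F' d'"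
proof -
  obtain D where D: "\<And>j. has_grad (\<lambda>x. F x $ j) (D j)"
    and "\<And>x. x \<noteq> 0 \<Longrightarrow> d x = (\<Sum>j\<in>UNIV. D j x $ j)"
    using assms(1) by (auto simp: has_div_def)
  then show ?thesis unfolding has_div_def
    using has_grad_cong[OF D, of _ "\<lambda>x. F' x $ _"] assms(2,3) by (intro exI[of _ D]) auto
qed

lemma has_div_add:
  assumes "has_div F d" "has_div F' d'"
  shows "has_div (\<lambda>x. F x + F' x) (\<lambda>x. d x + d' x)"
proof -
  obtain D D' where "\<And>j. has_grad (\<lambda>x. F x $ j) (D j)" "\<And>j. has_grad (\<lambda>x. F' x $ j) (D' j)"
    and "\<And>x. x \<noteq> 0 \<Longrightarrow> d x = (\<Sum>j\<in>UNIV. D j x $ j)" "\<And>x. x \<noteq> 0 \<Longrightarrow> d' x = (\<Sum>j\<in>UNIV. D' j x $ j)"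
    using assms by (auto simp: has_div_def)
  then show ?thesis unfolding has_div_def
    by (intro exI[of _ "\<lambda>j x. D j x + D' j x"]) (auto simp: sum.distrib intro!: has_grad_add)
qed

lemma has_div_scale:
  assumes "has_grad f g" "has_div F d"
  shows "has_div (\<lambda>x. f x *\<^sub>R F x) (\<lambda>x. g x \<bullet> F x + f x * d x)"
proof -
  obtain D where D: "\<And>j. has_grad (\<lambda>x. F x $ j) (D j)"
    and d: "\<And>x. x \<noteq> 0 \<Longrightarrow> d x = (\<Sum>j\<in>UNIV. D j x $ j)"
    using assms by (auto simp: has_div_def)
  then show ?thesis unfolding has_div_def
    using has_grad_mult[OF assms(1) D]
    by (intro exI[of _ "\<lambda>j x. f x *\<^sub>R D j x + (F x $ j) *\<^sub>R g x"])
      (auto simp: sum.distrib sum_distrib_left inner_vec_def mult.commute)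
qed

lemma has_div_diff:
  assumes "has_div F d" "has_div F' d'"
  shows "has_div (\<lambda>x. F x - F' x) (\<lambda>x. d x - d' x)"
  using has_div_add[OF assms(1) has_div_scale[OF has_grad_const[of "-1"] assms(2)]] by simp

lemma has_div_id: "has_div (\<lambda>x. x :: real^'n) (\<lambda>x. real CARD('n))"
  unfolding has_div_def
  by (intro exI[of _ "\<lambda>j x. axis j 1"]) (auto simp: has_grad_component)

lemma has_div_continuous: "has_div F d \<Longrightarrow> continuous_on (- {0}) d"
proof -
  assume "has_div F d"
  then obtain D where D: "\<And>j. has_grad (\<lambda>x. F x $ j) (D j)"
    and d: "\<And>x. x \<noteq> 0 \<Longrightarrow> d x = (\<Sum>j\<in>UNIV. D j x $ j)"
    by (auto simp: has_div_def)
  have "continuous_on (- {0}) (\<lambda>x. \<Sum>j\<in>UNIV. D j x $ j)"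
    using D by (auto intro!: continuous_intros has_gradD)
  then show ?thesis using continuous_on_cong[of "-{0}" "-{0}" d] d by auto
qed

text \<open>A field that vanishes near the origin has components that are C^1 on the whole space, so
  each diagonal partial derivative integrates to zero separately.\<close>

theorem divergence_theorem_shell:
  fixes F :: "real^'n \<Rightarrow> real^'n"
  assumes "has_div F d" and r: "0 < r" and supp: "\<And>x. norm x < r \<or> norm x > B \<Longrightarrow> F x = 0"
  shows "integrable lborel d" "integral\<^sup>L lborel d = 0"
proof -
  obtain D where D: "\<And>j. has_grad (\<lambda>x. F x $ j) (D j)"
    and d: "\<And>x. x \<noteq> 0 \<Longrightarrow> d x = (\<Sum>j\<in>UNIV. D j x $ j)"
    using assms(1) by (auto simp: has_div_def)
  \<comment> \<open>\<open>D j\<close> is arbitrary at the origin. Overriding it by 0 there makes it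
    the true gradient everywhere, since F vanishes on a ball around 0.\<close>
  define G where "G j x = (if x = 0 then 0 else D j x)" for j x
  have near0: "GDERIV (\<lambda>x. F x $ j) x :> 0" if "norm x < r" for j x
    unfolding gderiv_def
    by (rule has_derivative_transform_within_open[of "\<lambda>_. 0" _ _ _ "ball 0 r"])
      (use that supp in auto)
  have GD: "GDERIV (\<lambda>x. F x $ j) x :> G j x" for j x
    using near0[of 0 j] r has_gradD(1)[OF D[of j]] by (cases "x = 0") (auto simp: G_def)
  have G0: "G j x = 0" if "norm x < r" for j x
  proof -
    have "(\<lambda>h. h \<bullet> G j x) = (\<lambda>h. h \<bullet> 0)"
      using GD[of j x] near0[OF that, of j] unfolding gderiv_def by (rule has_derivative_unique)
    then have "G j x \<bullet> G j x = 0" by (metis inner_zero_right)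
    then show ?thesis by simp
  qed
  have "continuous_on (- {0} \<union> ball 0 r) (G j)" for j
  proof (rule continuous_on_open_Un)
    show "continuous_on (- {0}) (G j)"
      using continuous_on_cong[of "-{0}" "-{0}" "G j" "D j"] D by (auto simp: G_def has_grad_def)
    show "continuous_on (ball 0 r) (G j)"
      using continuous_on_cong[of "ball 0 r" "ball 0 r" "G j" "\<lambda>_. 0"] G0 by auto
  qed auto
  moreover have "- {0} \<union> ball (0::real^'n) r = UNIV" using r by auto
  ultimately have cG: "continuous_on UNIV (G j)" for j by simp
  have int: "integrable lborel (\<lambda>x. G j x \<bullet> axis j 1)" "(\<integral>x. G j x \<bullet> axis j 1 \<partial>lborel) = 0" for j
    by (rule integral_gradient_eq_0[OF GD cG, where B=B]; use supp in simp)+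
  have I: "has_bochner_integral lborel (\<lambda>x. \<Sum>j\<in>UNIV. G j x $ j) 0"
    using int by (auto simp: has_bochner_integral_iff inner_axis)
  have ae: "AE x in lborel. d x = (\<Sum>j\<in>UNIV. G j x $ j)"
    using AE_lborel_singleton[of "0::real^'n"] by eventually_elim (simp add: d G_def)
  have "d \<in> borel_measurable lborel"
    unfolding measurable_lborel2 by (rule borel_measurable_punctured[OF has_div_continuous[OF assms(1)]])
  with has_bochner_integralI_AE[OF I this] ae have "has_bochner_integral lborel d 0"
    by (metis (mono_tags, lifting) AE_cong)
  then show "integrable lborel d" "integral\<^sup>L lborel d = 0"
    by (auto simp: has_bochner_integral_iff)
qed

section \<open>Radial cutoffs\<close>

definition pos_sq :: "real \<Rightarrow> real" where "pos_sq y = (max 0 y)\<^sup>2"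

lemma DERIV_pos_sq: "DERIV pos_sq y :> 2 * max 0 y"
proof -
  consider "y < 0" | "y > 0" | "y = 0" by linarith
  then show ?thesis
  proof cases
    case 1
    have "((\<lambda>_. 0) has_real_derivative 0) (at y)" by simp
    then have "(pos_sq has_real_derivative 0) (at y)"
      by (rule has_field_derivative_transform_within_open[of _ _ _ "{..<0}"]) (use 1 in \<open>auto simp: pos_sq_def\<close>)
    then show ?thesis using 1 by simp
  next
    case 2
    have "((\<lambda>y. y\<^sup>2) has_real_derivative 2 * y) (at y)" by (auto intro!: derivative_eq_intros)
    then have "(pos_sq has_real_derivative 2 * y) (at y)"
      by (rule has_field_derivative_transform_within_open[of _ _ _ "{0<..}"]) (use 2 in \<open>auto simp: pos_sq_def\<close>)
    then show ?thesis using 2 by simp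
  next
    case 3
    have "((\<lambda>h::real. max 0 h) \<longlongrightarrow> max 0 0) (at 0)" by (intro tendsto_intros)
    moreover have "\<forall>\<^sub>F h::real in at 0. max 0 h = (pos_sq (0 + h) - pos_sq 0) / h"
      by (auto simp: eventually_at_filter pos_sq_def max_def power2_eq_square)
    ultimately show ?thesis using 3 by (simp add: DERIV_def tendsto_cong)
  qed
qed

text \<open>A quadratic spline from 0 to 1 with knots 0, 1/2, 1: just smooth enough for
  \<open>has_grad\<close>, with slope at most 2.\<close>

definition ramp :: "real \<Rightarrow> real" where
  "ramp y = 2 * (pos_sq y - 2 * pos_sq (y - 1/2) + pos_sq (y - 1))"

definition ramp' :: "real \<Rightarrow> real" where
  "ramp' y = 4 * (max 0 y - 2 * max 0 (y - 1/2) + max 0 (y - 1))"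

lemma DERIV_ramp: "DERIV ramp y :> ramp' y"
  unfolding ramp_def ramp'_def
  by (auto intro!: derivative_eq_intros DERIV_chain2[of pos_sq, OF DERIV_pos_sq])

lemma ramp_le_0: "y \<le> 0 \<Longrightarrow> ramp y = 0" "y \<le> 0 \<Longrightarrow> ramp' y = 0"
  by (auto simp: ramp_def ramp'_def pos_sq_def)

lemma ramp_ge_1: "y \<ge> 1 \<Longrightarrow> ramp y = 1" "y \<ge> 1 \<Longrightarrow> ramp' y = 0"
  by (auto simp: ramp_def ramp'_def pos_sq_def power2_eq_square algebra_simps)

lemma ramp'_bounds: "0 \<le> ramp' y" "ramp' y \<le> 2"
  by (auto simp: ramp'_def max_def)

lemma ramp_bounds: "0 \<le> ramp y" "ramp y \<le> 1"
proof -
  have "\<exists>D. DERIV ramp x :> D \<and> 0 \<le> D" for x using DERIV_ramp ramp'_bounds by blast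
  then have mono: "ramp x \<le> ramp z" if "x \<le> z" for x z
    using DERIV_nonneg_imp_nondecreasing[OF that] by blast
  show "0 \<le> ramp y" using mono[of "min 0 y" y] by (simp add: ramp_le_0)
  show "ramp y \<le> 1" using mono[of y "max 1 y"] by (simp add: ramp_ge_1)
qed

lemma continuous_ramp: "continuous_on S ramp" "continuous_on S ramp'"
  using DERIV_ramp DERIV_isCont continuous_at_imp_continuous_on
  by (blast, auto simp: ramp'_def intro!: continuous_intros)

text \<open>Equal to 1 for 2/R <= |x|^2 <= R and supported in 1/R <= |x|^2 <= 2R. Using the squared
  norm keeps it differentiable at the origin as well.\<close>

definition cutoff :: "real \<Rightarrow> 'a::real_inner \<Rightarrow> real" where
  "cutoff R x = ramp (2 - (x \<bullet> x) / R) * ramp (R * (x \<bullet> x) - 1)"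

text \<open>The coefficient of x in the gradient of the cutoff; multiplied by
  \<open>x \<bullet> x\<close> it is the Euler derivative D of the cutoff.\<close>

definition cutoff' :: "real \<Rightarrow> 'a::real_inner \<Rightarrow> real" where
  "cutoff' R x = 2 * R * ramp (2 - (x \<bullet> x) / R) * ramp' (R * (x \<bullet> x) - 1) -
     2 / R * ramp' (2 - (x \<bullet> x) / R) * ramp (R * (x \<bullet> x) - 1)"

lemma has_grad_cutoff: "has_grad (cutoff R) (\<lambda>x. cutoff' R x *\<^sub>R x)"
proof -
  have "has_grad (\<lambda>x::real^'n. (\<lambda>t. ramp (2 - t / R) * ramp (R * t - 1)) (x \<bullet> x))
     (\<lambda>x. (cutoff' R x / 2) *\<^sub>R (2 *\<^sub>R x))"
  proof (rule has_grad_compose[OF has_grad_inner_self])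
    show "((\<lambda>t. ramp (2 - t / R) * ramp (R * t - 1)) has_real_derivative cutoff' R x / 2) (at (x \<bullet> x))" for x :: "real^'n"
    proof -
      have "((\<lambda>t. ramp (2 - t / R)) has_real_derivative ramp' (2 - x \<bullet> x / R) * (0 - 1 / R)) (at (x \<bullet> x))"
        by (rule DERIV_chain2[OF DERIV_ramp DERIV_diff[OF DERIV_const DERIV_cdivide[OF DERIV_ident]]])
      moreover have "((\<lambda>t. ramp (R * t - 1)) has_real_derivative ramp' (R * (x \<bullet> x) - 1) * (R * 1 - 0)) (at (x \<bullet> x))"
        by (rule DERIV_chain2[OF DERIV_ramp DERIV_diff[OF DERIV_cmult[OF DERIV_ident] DERIV_const]])
      ultimately show ?thesis
        by (rule DERIV_mult[THEN DERIV_cong]) (simp add: cutoff'_def field_simps)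
    qed
    show "continuous_on (- {0}) (\<lambda>x::real^'n. cutoff' R x / 2)"
      unfolding cutoff'_def divide_inverse
      by (intro continuous_intros continuous_on_compose2[OF continuous_ramp(1)[of UNIV]]
          continuous_on_compose2[OF continuous_ramp(2)[of UNIV]]) auto
  qed
  then show ?thesis by (simp add: cutoff_def[abs_def])
qed

lemma cutoff_bounds: "0 \<le> cutoff R x" "cutoff R x \<le> 1"
  using ramp_bounds by (auto simp: cutoff_def intro: mult_le_one)

lemma cutoff_eq_0: "R > 0 \<Longrightarrow> R * (x \<bullet> x) \<le> 1 \<or> x \<bullet> x \<ge> 2 * R \<Longrightarrow> cutoff R x = 0"
  by (auto simp: cutoff_def ramp_le_0 field_simps)

lemma cutoff_tendsto:
  assumes "x \<noteq> 0" shows "((\<lambda>R. cutoff R x) \<longlongrightarrow> 1) at_top"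
proof -
  have "\<forall>\<^sub>F R in at_top. R \<ge> max (x \<bullet> x) (2 / (x \<bullet> x))" by (rule eventually_ge_at_top)
  then have "\<forall>\<^sub>F R in at_top. cutoff R x = 1"
  proof eventually_elim
    case (elim R)
    then have "R > 0" using assms by (simp add: less_le_trans[of 0 "x \<bullet> x"])
    then show ?case using elim assms by (simp add: cutoff_def ramp_ge_1 field_simps)
  qed
  then show ?thesis by (simp add: tendsto_eventually)
qed

text \<open>\<open>shell R\<close> and \<open>shell (1/R)\<close> are the two transition zones of
  \<open>cutoff R\<close>.\<close>

definition shell :: "real \<Rightarrow> 'a::real_inner set" where
  "shell s = {x. s \<le> x \<bullet> x \<and> x \<bullet> x \<le> 2 * s}"

text \<open>On each transition zone |x|^2 is at most twice the scale by which the ramp is stretched,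
  so the scale cancels and the bound is uniform in R. The 8 is 2 from the chain rule, 2 from this
  ratio and 2 from the slope of the ramp.\<close>

lemma cutoff'_bound:
  fixes x :: "'a::real_inner"
  assumes "R > 0"
  shows "\<bar>cutoff' R x\<bar> * (x \<bullet> x) \<le> 8 * (indicator (shell R) x + indicator (shell (1/R)) x)"
proof -
  define t where "t = x \<bullet> x"
  have t: "t \<ge> 0" by (simp add: t_def)
  have A: "2 * R * ramp (2 - t / R) * ramp' (R * t - 1) * t \<le> 8 * indicator (shell (1/R)) x"
  proof (cases "x \<in> shell (1/R)")
    case True
    then have Rt: "R * t \<le> 2" using assms by (simp add: shell_def t_def field_simps)
    have "ramp (2 - t / R) * ramp' (R * t - 1) \<le> 1 * 2"
      by (intro mult_mono ramp_bounds ramp'_bounds) auto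
    then have "(R * t) * (ramp (2 - t / R) * ramp' (R * t - 1)) \<le> 2 * (1 * 2)"
      using assms t Rt by (intro mult_mono) (auto simp: ramp_bounds ramp'_bounds)
    then show ?thesis using True by (simp add: mult_ac)
  next
    case False
    then have "R * t - 1 \<le> 0 \<or> R * t - 1 \<ge> 1"
      using assms by (auto simp: shell_def t_def field_simps)
    then show ?thesis using False by (auto simp: ramp_le_0 ramp_ge_1)
  qed
  have B: "2 / R * ramp' (2 - t / R) * ramp (R * t - 1) * t \<le> 8 * indicator (shell R) x"
  proof (cases "x \<in> shell R")
    case True
    then have Rt: "t / R \<le> 2" using assms by (simp add: shell_def t_def field_simps)
    have "ramp (R * t - 1) * ramp' (2 - t / R) \<le> 1 * 2"
      by (intro mult_mono ramp_bounds ramp'_bounds) auto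
    then have X: "(t / R) * (ramp (R * t - 1) * ramp' (2 - t / R)) \<le> 2 * (1 * 2)" (is "?X \<le> _")
      using assms t Rt by (intro mult_mono) (auto simp: ramp_bounds ramp'_bounds)
    have "2 / R * ramp' (2 - t / R) * ramp (R * t - 1) * t = 2 * ?X" by simp
    also have "\<dots> \<le> 8" using X by linarith
    also have "\<dots> = 8 * indicator (shell R) x" using True by simp
    finally show ?thesis .
  next
    case False
    then have "2 - t / R \<le> 0 \<or> 2 - t / R \<ge> 1"
      using assms by (auto simp: shell_def t_def field_simps)
    then show ?thesis using False by (auto simp: ramp_le_0 ramp_ge_1)
  qed
  have nn: "0 \<le> 2 * R * ramp (2 - t / R) * ramp' (R * t - 1) * t"
    "0 \<le> 2 / R * ramp' (2 - t / R) * ramp (R * t - 1) * t"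
    using assms t by (auto simp: ramp_bounds ramp'_bounds)
  have "\<bar>cutoff' R x\<bar> * t = \<bar>cutoff' R x * t\<bar>" using t by (simp add: abs_mult)
  also have "cutoff' R x * t = 2 * R * ramp (2 - t / R) * ramp' (R * t - 1) * t -
      2 / R * ramp' (2 - t / R) * ramp (R * t - 1) * t"
    by (simp add: cutoff'_def t_def left_diff_distrib)
  finally have eq: "\<bar>cutoff' R x\<bar> * t = \<bar>2 * R * ramp (2 - t / R) * ramp' (R * t - 1) * t -
      2 / R * ramp' (2 - t / R) * ramp (R * t - 1) * t\<bar>" .
  have "\<bar>P - Q\<bar> \<le> 8 * (v + u)" if "0 \<le> P" "0 \<le> Q" "P \<le> 8 * u" "Q \<le> 8 * v" for P Q u v :: real
    using that unfolding abs_le_iff distrib_left by (intro conjI) linarith+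
  from this[OF nn A B] show ?thesis unfolding eq t_def[symmetric] .
qed

lemma cutoff_support:
  fixes x :: "'a::real_inner"
  assumes "R > 0" "norm x < sqrt (1/R) \<or> norm x > sqrt (2 * R)"
  shows "cutoff R x = 0"
proof (rule cutoff_eq_0[OF assms(1)])
  have "x \<bullet> x < 1 / R \<or> x \<bullet> x > 2 * R"
    using assms by (auto simp: norm_eq_sqrt_inner)
  then show "R * (x \<bullet> x) \<le> 1 \<or> 2 * R \<le> x \<bullet> x"
    using assms(1) by (auto simp: field_simps)
qed

lemma integrable_shell:
  fixes h :: "'a::euclidean_space \<Rightarrow> real"
  assumes "continuous_on (- {0}) h" "r > 0" "\<And>x. norm x < r \<or> norm x > B \<Longrightarrow> h x = 0"
  shows "integrable lborel h"
proof -
  define S :: "'a set" where "S = cball 0 B - ball 0 r"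
  have "compact S" unfolding S_def by (intro compact_diff) auto
  moreover have "continuous_on S h"
    by (rule continuous_on_subset[OF assms(1)]) (use assms(2) in \<open>auto simp: S_def\<close>)
  ultimately have "integrable lborel (\<lambda>x. indicator S x *\<^sub>R h x)"
    by (rule borel_integrable_compact)
  also have "(\<lambda>x. indicator S x *\<^sub>R h x) = h"
  proof
    fix x show "indicator S x *\<^sub>R h x = h x"
      using assms(3)[of x] by (cases "x \<in> S") (auto simp: S_def not_le)
  qed
  finally show ?thesis .
qed

lemma integrable_cutoff:
  fixes h :: "real^'n \<Rightarrow> real"
  assumes "continuous_on (- {0}) h" "R > 0"
  shows "integrable lborel (\<lambda>x. cutoff R x * h x)"
  by (rule integrable_shell[of _ "sqrt (1/R)" "sqrt (2*R)"])
    (use assms has_grad_continuous[OF has_grad_cutoff] cutoff_support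
      in \<open>auto intro!: continuous_intros\<close>)

abbreviation cutoff_integral :: "real \<Rightarrow> real \<Rightarrow> ('a::euclidean_space \<Rightarrow> real) \<Rightarrow> real" where
  "cutoff_integral R p f \<equiv> (\<integral>x. cutoff R x * (norm x powr p * f x) \<partial>lborel)"

text \<open>The gradients of the cutoff and of the radial weight are multiples of x, hence
  orthogonal to a tangential field; both factors pass through the divergence untouched.\<close>

lemma integral_tangential_div:
  fixes \<Phi> :: "real^'n \<Rightarrow> real^'n"
  assumes div: "has_div \<Phi> d" and tang: "\<And>x. x \<noteq> 0 \<Longrightarrow> x \<bullet> \<Phi> x = 0"
    and rad: "has_grad \<rho> (\<lambda>x. c x *\<^sub>R x)" and R: "R > 0"
  shows "(\<integral>x. cutoff R x * (\<rho> x * d x) \<partial>lborel) = 0"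
proof -
  have "has_div (\<lambda>x. (cutoff R x * \<rho> x) *\<^sub>R \<Phi> x) (\<lambda>x. cutoff R x * (\<rho> x * d x))"
    by (rule has_div_cong[OF has_div_scale[OF has_grad_mult[OF has_grad_cutoff rad] div]])
      (auto simp: inner_add_left tang)
  then show ?thesis
    by (rule divergence_theorem_shell[where r="sqrt (1/R)" and B="sqrt (2*R)"])
      (use R cutoff_support in auto)
qed

section \<open>Boundary terms of the radial cutoff\<close>

lemma measure_shell:
  assumes s: "s > 0"
  shows "shell s \<in> sets (lborel :: 'a::euclidean_space measure)"
    "emeasure lborel (shell s :: 'a set) < \<infinity>"
    "s powr (- real DIM('a) / 2) * measure lborel (shell s :: 'a set) \<le> unit_ball_vol (real DIM('a)) * 2 powr (real DIM('a) / 2)"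
proof -
  have "closed (shell s :: 'a set)"
    unfolding shell_def by (intro closed_Collect_conj closed_Collect_le continuous_intros)
  then show meas: "shell s \<in> sets (lborel :: 'a measure)" by simp
  have sub: "(shell s :: 'a set) \<subseteq> cball 0 (sqrt (2 * s))"
    by (auto simp: shell_def norm_eq_sqrt_inner)
  have fin: "emeasure lborel (cball (0::'a) (sqrt (2 * s))) < (\<infinity>::ennreal)" by (rule emeasure_lborel_cball_finite)
  show "emeasure lborel (shell s :: 'a set) < \<infinity>"
    using emeasure_mono[OF sub, of lborel] fin by (simp add: le_less_trans)
  have "measure lborel (shell s :: 'a set) \<le> measure lborel (cball (0::'a) (sqrt (2 * s)))"
    using fin by (intro measure_mono_fmeasurable[OF sub meas]) (auto simp: fmeasurable_def)
  also have "\<dots> = unit_ball_vol (real DIM('a)) * sqrt (2 * s) ^ DIM('a)"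
    using content_cball[of "sqrt (2 * s)" "0::'a"] s by simp
  also have "sqrt (2 * s) ^ DIM('a) = 2 powr (real DIM('a) / 2) * s powr (real DIM('a) / 2)"
    using s by (simp add: powr_half_sqrt[symmetric] powr_realpow[symmetric] powr_powr powr_mult)
  finally have "s powr (- real DIM('a) / 2) * measure lborel (shell s :: 'a set)
     \<le> s powr (- real DIM('a) / 2) * (unit_ball_vol (real DIM('a)) * (2 powr (real DIM('a) / 2) * s powr (real DIM('a) / 2)))"
    by (intro mult_left_mono) auto
  also have "\<dots> = unit_ball_vol (real DIM('a)) * 2 powr (real DIM('a) / 2)"
    using s by (simp add: powr_minus field_simps)
  finally show "s powr (- real DIM('a) / 2) * measure lborel (shell s :: 'a set) \<le> unit_ball_vol (real DIM('a)) * 2 powr (real DIM('a) / 2)" .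
qed

lemma norm_powr_shell:
  fixes x :: "'a::real_inner"
  assumes "x \<in> shell s" "s > 0" "p \<ge> 0"
  shows "norm x powr (- p) \<le> s powr (- p / 2)"
proof -
  have "norm x powr (- p) = (x \<bullet> x) powr (- p / 2)"
    using powr_powr[of "x \<bullet> x" "1/2" "- p"] by (simp add: norm_eq_sqrt_inner powr_half_sqrt)
  also have "\<dots> \<le> s powr (- p / 2)"
    using assms by (intro powr_mono2') (auto simp: shell_def)
  finally show ?thesis .
qed

text \<open>The boundary contribution is scale invariant, since \<open>|x|\<^sup>-\<^sup>N dx\<close> gives all shells comparable mass.\<close>

lemma cutoff_boundary_bound:
  fixes f :: "real^'n \<Rightarrow> real"
  assumes cf: "continuous_on (- {0}) f" and R: "R > 0"
    and bd: "\<And>x. x \<in> shell R \<or> x \<in> shell (1/R) \<Longrightarrow> \<bar>f x\<bar> \<le> \<epsilon>"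
  defines "K \<equiv> 16 * (unit_ball_vol (real CARD('n)) * 2 powr (real CARD('n) / 2))"
  shows "\<bar>\<integral>x. cutoff' R x * (x \<bullet> x) * (norm x powr (- real CARD('n)) * f x) \<partial>lborel\<bar> \<le> K * \<epsilon>"
proof -
  let ?N = "real CARD('n)"
  let ?g = "\<lambda>x::real^'n. cutoff' R x * (x \<bullet> x) * (norm x powr (- ?N) * f x)"
  let ?b = "\<lambda>x::real^'n. 8 * \<epsilon> * (R powr (- ?N / 2) * indicator (shell R) x + (1/R) powr (- ?N / 2) * indicator (shell (1/R)) x)"
  have R': "1 / R > 0" using R by simp
  \<comment> \<open>A point of the shell is needed only to see that the bound
    \<open>\<epsilon>\<close> is nonnegative.\<close>
  have vec: "sqrt R *\<^sub>R axis undefined 1 \<in> (shell R :: (real^'n) set)"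
    using R by (simp add: shell_def inner_axis_axis)
  have eps: "\<epsilon> \<ge> 0" using bd[of "sqrt R *\<^sub>R axis undefined 1"] vec abs_ge_zero order_trans by blast
  have bound: "norm (?g x) \<le> ?b x" for x
  proof -
    have "norm (?g x) = \<bar>cutoff' R x\<bar> * (x \<bullet> x) * (norm x powr (- ?N) * \<bar>f x\<bar>)"
      by (simp add: abs_mult)
    also have "\<dots> \<le> 8 * (indicator (shell R) x + indicator (shell (1/R)) x) * (norm x powr (- ?N) * \<bar>f x\<bar>)"
      by (intro mult_right_mono cutoff'_bound R) auto
    also have "\<dots> = 8 * (indicator (shell R) x * (norm x powr (- ?N) * \<bar>f x\<bar>)) + 8 * (indicator (shell (1/R)) x * (norm x powr (- ?N) * \<bar>f x\<bar>))"
      by (simp add: algebra_simps)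
    also have "\<dots> \<le> 8 * (indicator (shell R) x * (R powr (- ?N / 2) * \<epsilon>)) + 8 * (indicator (shell (1/R)) x * ((1/R) powr (- ?N / 2) * \<epsilon>))"
    proof -
      have "indicator (shell s) x * (norm x powr (- ?N) * \<bar>f x\<bar>) \<le> indicator (shell s) x * (s powr (- ?N / 2) * \<epsilon>)"
        if "s = R \<or> s = 1 / R" for s
      proof (cases "x \<in> shell s")
        case True
        then have "norm x powr (- ?N) * \<bar>f x\<bar> \<le> s powr (- ?N / 2) * \<epsilon>"
          using that R R' bd[of x] by (intro mult_mono norm_powr_shell) auto
        then show ?thesis using True by simp
      qed simp
      from this[of R] this[of "1 / R"] show ?thesis by linarith
    qed
    finally show ?thesis by (simp add: algebra_simps)
  qed
  have I: "integrable lborel (indicator (shell s) :: real^'n \<Rightarrow> real)" if "s > 0" for s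
    using measure_shell[OF that, where 'a="real^'n"] by (intro integrable_real_indicator) auto
  have "\<bar>integral\<^sup>L lborel ?g\<bar> \<le> (\<integral>x. norm (?g x) \<partial>lborel)"
    using integral_norm_bound[of lborel ?g] by simp
  also have "\<dots> \<le> integral\<^sup>L lborel ?b"
    by (intro integral_mono') (use bound I R R' eps in auto)
  also have "\<dots> = 8 * \<epsilon> * (R powr (- ?N / 2) * measure lborel (shell R :: (real^'n) set) + (1/R) powr (- ?N / 2) * measure lborel (shell (1/R) :: (real^'n) set))"
    using I[OF R] I[OF R'] measure_shell(1)[OF R, where 'a="real^'n"] measure_shell(1)[OF R', where 'a="real^'n"]
    by simp
  \<comment> \<open>Two shells, each with the factor 8 of the cutoff bound, give the 16 in
    \<open>K\<close>.\<close>
  also have "\<dots> \<le> 8 * \<epsilon> * (unit_ball_vol ?N * 2 powr (?N / 2) + unit_ball_vol ?N * 2 powr (?N / 2))"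
    using measure_shell(3)[OF R, where 'a="real^'n"] measure_shell(3)[OF R', where 'a="real^'n"] eps
    by (intro mult_left_mono add_mono) auto
  also have "\<dots> = K * \<epsilon>" by (simp add: K_def)
  finally show ?thesis .
qed

text \<open>The field |x|^(-N) x is divergence free off the origin. Multiplied by f and the cutoff,
  its divergence therefore consists of the Euler derivatives of these two factors alone.\<close>

lemma integral_radial_derivative:
  fixes f :: "real^'n \<Rightarrow> real"
  assumes f: "has_grad f g" and R: "R > 0"
  shows "cutoff_integral R (- real CARD('n)) (\<lambda>x. x \<bullet> g x) =
    - (\<integral>x. cutoff' R x * (x \<bullet> x) * (norm x powr (- real CARD('n)) * f x) \<partial>lborel)"
proof -
  let ?N = "real CARD('n)"
  let ?A = "\<lambda>x::real^'n. cutoff R x * (norm x powr (- ?N) * (x \<bullet> g x))"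
  let ?B = "\<lambda>x::real^'n. cutoff' R x * (x \<bullet> x) * (norm x powr (- ?N) * f x)"
  have pw: "norm x powr (- ?N - 2) * (x \<bullet> x) = norm x powr (- ?N)" for x :: "real^'n"
    using norm_powr_mult_inner_self[of x "- ?N"] by (cases "x = 0") auto
  have "has_div (\<lambda>x. (cutoff R x * (norm x powr (- ?N) * f x)) *\<^sub>R x) (\<lambda>x. ?A x + ?B x)"
    by (rule has_div_cong[OF has_div_scale[OF has_grad_mult[OF has_grad_cutoff[of R] has_grad_mult[OF has_grad_norm_powr[of "- ?N"] f]] has_div_id]])
      (auto simp: inner_add_left inner_add_right inner_commute algebra_simps pw[symmetric])
  note D = divergence_theorem_shell[OF this, where r="sqrt (1/R)" and B="sqrt (2*R)"]
  have "integral\<^sup>L lborel (\<lambda>x. ?A x + ?B x) = 0" "integrable lborel (\<lambda>x. ?A x + ?B x)"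
    by (rule D; simp add: R cutoff_support[OF R])+
  moreover have "integrable lborel ?A"
    using f R has_gradD(2)[OF f] by (intro integrable_cutoff) (auto intro!: continuous_intros)
  ultimately show ?thesis
    using Bochner_Integration.integrable_diff[of lborel "\<lambda>x. ?A x + ?B x" ?A] by simp
qed

text \<open>As R grows, one shell escapes to infinity and the other shrinks to the origin. f is
  small on both, and the boundary bound does not depend on the scale.\<close>

lemma radial_derivative_tendsto_0:
  fixes f :: "real^'n \<Rightarrow> real"
  assumes f: "has_grad f g" and lim: "(f \<longlongrightarrow> 0) (at 0)" "(f \<longlongrightarrow> 0) at_infinity"
  shows "((\<lambda>R. cutoff_integral R (- real CARD('n)) (\<lambda>x. x \<bullet> g x)) \<longlongrightarrow> 0) at_top"
proof (rule tendstoI)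
  fix e :: real assume e: "e > 0"
  define K where "K = 16 * (unit_ball_vol (real CARD('n)) * 2 powr (real CARD('n) / 2))"
  have K: "K > 0" by (simp add: K_def)
  define \<epsilon> where "\<epsilon> = e / (2 * K)"
  have eps: "\<epsilon> > 0" using e K by (simp add: \<epsilon>_def)
  obtain d where d: "d > 0" "\<And>x. x \<noteq> 0 \<Longrightarrow> norm x < d \<Longrightarrow> \<bar>f x\<bar> < \<epsilon>"
    using tendstoD[OF lim(1) eps] by (auto simp: eventually_at dist_norm)
  obtain b where b: "\<And>x. b \<le> norm x \<Longrightarrow> \<bar>f x\<bar> < \<epsilon>"
    using tendstoD[OF lim(2) eps] by (auto simp: eventually_at_infinity)
  \<comment> \<open>R >= b^2 puts \<open>shell R\<close> outside the ball of radius b; R >= 4/d^2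
    gives |x|^2 <= 2/R < d^2 on \<open>shell (1/R)\<close>.\<close>
  have "\<forall>\<^sub>F R in at_top. R \<ge> max 1 (max (b\<^sup>2) (4 / d\<^sup>2))" by (rule eventually_ge_at_top)
  then show "\<forall>\<^sub>F R in at_top. dist (cutoff_integral R (- real CARD('n)) (\<lambda>x. x \<bullet> g x)) 0 < e"
  proof eventually_elim
    case (elim R)
    have R: "R > 0" using elim by simp
    have "\<bar>f x\<bar> \<le> \<epsilon>" if "x \<in> shell R \<or> x \<in> shell (1/R)" for x
      using that
    proof
      assume "x \<in> shell R"
      then have "b\<^sup>2 \<le> (norm x)\<^sup>2" using elim by (simp add: shell_def power2_norm_eq_inner)
      then have "b \<le> norm x" using power2_le_imp_le norm_ge_zero by blast
      then show ?thesis using b less_imp_le by blast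
    next
      assume x: "x \<in> shell (1/R)"
      then have "(norm x)\<^sup>2 \<le> 2 / R" "x \<noteq> 0" using R by (auto simp: shell_def power2_norm_eq_inner)
      moreover have "2 / R < d\<^sup>2"
      proof -
        have "4 \<le> R * d\<^sup>2" using elim d(1) by (simp add: field_simps)
        then show ?thesis using R by (simp add: field_simps)
      qed
      ultimately have "(norm x)\<^sup>2 < d\<^sup>2" by simp
      then have "norm x < d" using d(1) power2_less_imp_less by fastforce
      then show ?thesis using d(2)[OF \<open>x \<noteq> 0\<close>] by simp
    qed
    from cutoff_boundary_bound[OF has_grad_continuous[OF f] R this]
    have "\<bar>cutoff_integral R (- real CARD('n)) (\<lambda>x. x \<bullet> g x)\<bar> \<le> K * \<epsilon>"
      by (simp add: integral_radial_derivative[OF f R] K_def)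
    also have "\<dots> < e" using e K by (simp add: \<epsilon>_def)
    finally show ?case by simp
  qed
qed

lemma borel_measurable_cutoff [measurable]:
  "(cutoff R :: 'a::euclidean_space \<Rightarrow> real) \<in> borel_measurable borel"
  unfolding cutoff_def[abs_def] ramp_def pos_sq_def by measurable

lemma integrable_cutoff_mult:
  fixes h :: "'a::euclidean_space \<Rightarrow> real"
  assumes "integrable lborel h"
  shows "integrable lborel (\<lambda>x. cutoff R x * h x)"
proof (rule Bochner_Integration.integrable_bound[OF assms])
  show "(\<lambda>x. cutoff R x * h x) \<in> borel_measurable lborel" using assms by measurable
  show "AE x in lborel. norm (cutoff R x * h x) \<le> norm (h x)"
    by (auto simp: abs_mult cutoff_bounds intro!: mult_left_le_one_le)
qed

lemma cutoff_integral_tendsto: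
  fixes h :: "real^'n \<Rightarrow> real"
  assumes "integrable lborel h"
  shows "((\<lambda>R. \<integral>x. cutoff R x * h x \<partial>lborel) \<longlongrightarrow> integral\<^sup>L lborel h) at_top"
proof (rule integral_dominated_convergence_at_top[where w="\<lambda>x. \<bar>h x\<bar>"])
  show "(\<lambda>x. cutoff R x * h x) \<in> borel_measurable lborel" for R
    using assms by measurable
  show "\<forall>\<^sub>F R in at_top. AE x in lborel. norm (cutoff R x * h x) \<le> \<bar>h x\<bar>"
    by (auto simp: abs_mult cutoff_bounds intro!: always_eventually mult_left_le_one_le)
  show "AE x in lborel. ((\<lambda>R. cutoff R x * h x) \<longlongrightarrow> h x) at_top"
    using AE_lborel_singleton[of "0::real^'n"]
    by eventually_elim (auto intro!: tendsto_eq_intros cutoff_tendsto)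
qed (use assms in auto)

section \<open>Potential fields and the Bochner identity\<close>

text \<open>Applying the mean value theorem in direction i and again in direction j turns the second
  difference into a mixed derivative at a nearby point. The condition on h keeps the whole
  parallelogram away from the origin.\<close>

lemma mixed_difference:
  fixes f :: "real^'n \<Rightarrow> real"
  assumes f: "has_grad f F" and F: "has_grad (\<lambda>x. F x $ i) G"
    and h: "h > 0" "2 * h < norm x"
  obtains p where "dist p x < 2 * h"
    "f (x + h *\<^sub>R axis i 1 + h *\<^sub>R axis j 1) - f (x + h *\<^sub>R axis i 1) - f (x + h *\<^sub>R axis j 1) + f x = h\<^sup>2 * (G p $ j)"
proof -
  let ?i = "axis i (1::real)" and ?j = "axis j (1::real)"
  have near: "dist (x + s *\<^sub>R ?i + t *\<^sub>R ?j) x \<le> \<bar>s\<bar> + \<bar>t\<bar>" for s t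
    using norm_triangle_ineq[of "s *\<^sub>R ?i" "t *\<^sub>R ?j"] by (simp add: dist_norm)
  have nz: "x + s *\<^sub>R ?i + t *\<^sub>R ?j \<noteq> 0" if "\<bar>s\<bar> \<le> h" "\<bar>t\<bar> \<le> h" for s t
  proof
    assume eq: "x + s *\<^sub>R ?i + t *\<^sub>R ?j = 0"
    have "norm x \<le> \<bar>s\<bar> + \<bar>t\<bar>" using near[of s t] unfolding eq by simp
    then show False using that h by linarith
  qed
  have d1: "((\<lambda>s. f (x + s *\<^sub>R ?i + t *\<^sub>R ?j)) has_real_derivative (F (x + s *\<^sub>R ?i + t *\<^sub>R ?j) $ i)) (at s)"
    if "\<bar>s\<bar> \<le> h" "\<bar>t\<bar> \<le> h" for s t
  proof -
    have "GDERIV f (x + t *\<^sub>R ?j + s *\<^sub>R ?i) :> F (x + t *\<^sub>R ?j + s *\<^sub>R ?i)"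
      using nz[OF that] by (intro has_gradD(1)[OF f]) (simp add: algebra_simps)
    from DERIV_along_line[OF this] show ?thesis by (simp add: algebra_simps inner_axis')
  qed
  have d2: "((\<lambda>t. F (x + s *\<^sub>R ?i + t *\<^sub>R ?j) $ i) has_real_derivative (G (x + s *\<^sub>R ?i + t *\<^sub>R ?j) $ j)) (at t)"
    if "\<bar>s\<bar> \<le> h" "\<bar>t\<bar> \<le> h" for s t
    using DERIV_along_line[of "\<lambda>x. F x $ i" "x + s *\<^sub>R ?i" t ?j] has_gradD(1)[OF F nz[OF that]]
    by (simp add: inner_axis')
  have d1': "((\<lambda>s. f (x + s *\<^sub>R ?i + h *\<^sub>R ?j) - f (x + s *\<^sub>R ?i)) has_real_derivative
      (F (x + s *\<^sub>R ?i + h *\<^sub>R ?j) $ i - F (x + s *\<^sub>R ?i) $ i)) (at s)" if "0 \<le> s" "s \<le> h" for s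
    using DERIV_diff[OF d1[of s h] d1[of s 0]] that by simp
  obtain s where s: "0 < s" "s < h"
    "f (x + h *\<^sub>R ?i + h *\<^sub>R ?j) - f (x + h *\<^sub>R ?i) - (f (x + h *\<^sub>R ?j) - f x) =
      h * (F (x + s *\<^sub>R ?i + h *\<^sub>R ?j) $ i - F (x + s *\<^sub>R ?i) $ i)"
    using MVT2[OF h(1) d1'] by auto
  obtain t where t: "0 < t" "t < h"
    "F (x + s *\<^sub>R ?i + h *\<^sub>R ?j) $ i - F (x + s *\<^sub>R ?i) $ i = h * (G (x + s *\<^sub>R ?i + t *\<^sub>R ?j) $ j)"
    using MVT2[OF h(1), of "\<lambda>t. F (x + s *\<^sub>R ?i + t *\<^sub>R ?j) $ i" "\<lambda>t. G (x + s *\<^sub>R ?i + t *\<^sub>R ?j) $ j"]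
      d2 s h(1) by auto
  show thesis
  proof (rule that)
    show "dist (x + s *\<^sub>R ?i + t *\<^sub>R ?j) x < 2 * h" using near[of s t] s t by simp
  qed (use s(3) t(3) in \<open>simp add: power2_eq_square\<close>)
qed

text \<open>Schwarz's theorem: the second difference does not change when i and j are exchanged, so
  both mixed derivatives are limits of the same quotient.\<close>

lemma has_grad_symmetric:
  fixes f :: "real^'n \<Rightarrow> real"
  assumes f: "has_grad f F" and F: "\<And>i. has_grad (\<lambda>x. F x $ i) (G i)" and x: "x \<noteq> 0"
  shows "G i x $ j = G j x $ i"
proof (rule ccontr)
  assume "G i x $ j \<noteq> G j x $ i"
  then have e: "\<bar>G i x $ j - G j x $ i\<bar> / 2 > 0" (is "?e > 0") by simp
  have c: "isCont (\<lambda>x. G i x $ j) x" for i j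
  proof -
    have "continuous_on (- {0}) (\<lambda>x. G i x $ j)"
      using has_gradD(2)[OF F] by (intro continuous_intros)
    then show ?thesis using x by (auto simp: continuous_on_eq_continuous_at open_Compl)
  qed
  obtain d1 where d1: "d1 > 0" "\<And>y. dist y x < d1 \<Longrightarrow> dist (G i y $ j) (G i x $ j) < ?e"
    using c[of i j] e unfolding continuous_at_eps_delta by blast
  obtain d2 where d2: "d2 > 0" "\<And>y. dist y x < d2 \<Longrightarrow> dist (G j y $ i) (G j x $ i) < ?e"
    using c[of j i] e unfolding continuous_at_eps_delta by blast
  define h where "h = min (norm x) (min d1 d2) / 3"
  have h: "h > 0" "2 * h < norm x" "2 * h < d1" "2 * h < d2"
    using x d1(1) d2(1) by (auto simp: h_def min_def)
  obtain p where p: "dist p x < 2 * h"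
    "f (x + h *\<^sub>R axis i 1 + h *\<^sub>R axis j 1) - f (x + h *\<^sub>R axis i 1) - f (x + h *\<^sub>R axis j 1) + f x = h\<^sup>2 * (G i p $ j)"
    using mixed_difference[OF f F h(1,2)] by metis
  obtain q where q: "dist q x < 2 * h"
    "f (x + h *\<^sub>R axis j 1 + h *\<^sub>R axis i 1) - f (x + h *\<^sub>R axis j 1) - f (x + h *\<^sub>R axis i 1) + f x = h\<^sup>2 * (G j q $ i)"
    using mixed_difference[OF f F h(1,2)] by metis
  have "h\<^sup>2 * (G i p $ j) = h\<^sup>2 * (G j q $ i)"
    using p(2) q(2) by (simp add: algebra_simps)
  then have "G i p $ j = G j q $ i" using h(1) by simp
  moreover have "dist (G i p $ j) (G i x $ j) < ?e" "dist (G j q $ i) (G j x $ i) < ?e"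
    using p(1) q(1) h d1(2) d2(2) by auto
  ultimately show False unfolding dist_real_def by argo
qed

section \<open>Trace inequality for compressions of symmetric matrices\<close>

definition outer :: "real^'n \<Rightarrow> real^'n \<Rightarrow> real^'n^'n" where
  "outer a b = (\<chi> j k. a $ j * b $ k)"

lemma outer_inner: "outer a b \<bullet> M = a \<bullet> (M *v b)"
  by (simp add: outer_def inner_vec_def matrix_vector_mult_def sum_distrib_left mult_ac)

lemma outer_mult_vec: "outer a b *v c = (b \<bullet> c) *\<^sub>R a"
  by (simp add: outer_def vec_eq_iff inner_vec_def matrix_vector_mult_def sum_distrib_left mult_ac)

lemma mat_inner: "mat 1 \<bullet> M = trace M"
  by (simp add: mat_def inner_vec_def trace_def if_distrib[of "\<lambda>x. x * _"] cong: if_cong)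

lemma trace_outer: "trace (outer a b) = a \<bullet> b"
  by (simp add: outer_def trace_def inner_vec_def)

lemma symmetric_matrix_inner:
  fixes M :: "real^'n^'n"
  assumes "transpose M = M"
  shows "a \<bullet> (M *v b) = b \<bullet> (M *v a)"
  by (metis assms dot_lmul_matrix inner_commute transpose_matrix_vector)

text \<open>Trace inequality for the compression of \<open>M\<close> to \<open>x\<^sup>\<bottom>\<close>, an \<open>(N-1)\<close>-dimensional space.\<close>

lemma compression_trace_bound:
  fixes M :: "real^'n^'n" and x :: "real^'n"
  assumes sym: "transpose M = M" and x: "x \<noteq> 0" and N: "CARD('n) \<ge> 2"
  defines "t \<equiv> x \<bullet> x" and "v \<equiv> M *v x"
  defines "q \<equiv> x \<bullet> v" and "n \<equiv> real CARD('n) - 1"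
  shows "(t * trace M - q)\<^sup>2 \<le> n * (t\<^sup>2 * (M \<bullet> M) - 2 * t * (v \<bullet> v) + q\<^sup>2)"
proof -
  have t: "t > 0" using x by (simp add: t_def)
  have n: "n > 0" using N by (simp add: n_def)
  \<comment> \<open>\<open>z\<close> is the entry of M in the direction of x, and \<open>c\<close>
    is the mean eigenvalue of the compression of M to the complement of x. The vector
    \<open>a\<close> is chosen so that the matrix \<open>S\<close> below annihilates x; then
    \<open>S\<close> is the trace-free part of this compression, and |S|^2 >= 0 is the
    claim.\<close>
  define z where "z = q / t"
  define c where "c = (trace M - z) / n"
  define a where "a = (- (z + c) / (2 * t)) *\<^sub>R x + (1 / t) *\<^sub>R v"
  have xv: "x \<bullet> v = z * t" "v \<bullet> x = z * t" using t by (simp_all add: z_def q_def inner_commute)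
  have ax: "a \<bullet> x = (z - c) / 2" "x \<bullet> a = (z - c) / 2"
    using t by (auto simp: a_def inner_simps xv t_def[symmetric] field_simps)
  have av: "a \<bullet> v = - (z + c) * z / 2 + v \<bullet> v / t"
    using t by (auto simp: a_def inner_simps xv field_simps)
  have aa: "t * (a \<bullet> a) = (z + c)\<^sup>2 / 4 - (z + c) * z + v \<bullet> v / t"
    using t by (auto simp: a_def inner_simps xv t_def[symmetric] power2_eq_square) (simp add: field_simps)
  define S where "S = M - outer a x - outer x a - c *\<^sub>R mat 1"
  have xa: "x \<bullet> (M *v a) = a \<bullet> v" using symmetric_matrix_inner[OF sym, of x a] by (simp add: v_def)
  have "0 \<le> S \<bullet> S" by simp
  also have "S \<bullet> S = M \<bullet> M + 2 * (t * (a \<bullet> a)) + 2 * (a \<bullet> x)\<^sup>2 + c\<^sup>2 * (n + 1) - 4 * (a \<bullet> v) - 2 * c * trace M + 4 * c * (a \<bullet> x)"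
    by (simp add: S_def inner_simps outer_inner outer_mult_vec mat_inner trace_outer xa
        inner_commute[of M "outer _ _"] inner_commute[of M "mat 1"] inner_commute[of "outer _ _" "mat 1"]
        trace_I v_def[symmetric] t_def[symmetric] n_def inner_commute[of x a] power2_eq_square algebra_simps)
  also have "\<dots> = M \<bullet> M - 2 * (v \<bullet> v) / t + z\<^sup>2 - 2 * c * (trace M - z) + n * c\<^sup>2"
    unfolding aa av ax by (simp add: power2_eq_square field_simps)
  also have "\<dots> = M \<bullet> M - 2 * (v \<bullet> v) / t + z\<^sup>2 - (trace M - z)\<^sup>2 / n"
    using n by (simp add: c_def power2_eq_square field_simps)
  finally have "(trace M - z)\<^sup>2 \<le> n * (M \<bullet> M - 2 * (v \<bullet> v) / t + z\<^sup>2)"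
    using n by (simp add: field_simps)
  then have "t\<^sup>2 * (trace M - z)\<^sup>2 \<le> t\<^sup>2 * (n * (M \<bullet> M - 2 * (v \<bullet> v) / t + z\<^sup>2))"
    by (intro mult_left_mono) auto
  moreover have "t * trace M - q = t * (trace M - z)"
    "t\<^sup>2 * (M \<bullet> M) - 2 * t * (v \<bullet> v) + q\<^sup>2 = t\<^sup>2 * (M \<bullet> M - 2 * (v \<bullet> v) / t + z\<^sup>2)"
    using t by (simp_all add: z_def power2_eq_square field_simps)
  ultimately show ?thesis by (simp add: power_mult_distrib mult.left_commute)
qed

text \<open>A real C^3 potential with its gradient, Hessian and third derivatives as explicit data.
  Real and imaginary parts of a complex potential will be its instances.\<close>

locale potential_field =
  fixes u :: "real^'n \<Rightarrow> real" and U :: "real^'n \<Rightarrow> real^'n"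
    and M :: "real^'n \<Rightarrow> real^'n^'n" and T :: "'n \<Rightarrow> 'n \<Rightarrow> real^'n \<Rightarrow> real^'n"
  assumes grad_u: "has_grad u U"
    and grad_U: "\<And>j. has_grad (\<lambda>x. U x $ j) (\<lambda>x. M x $ j)"
    and grad_M: "\<And>j k. has_grad (\<lambda>x. M x $ j $ k) (T j k)"
begin

lemma M_sym: "x \<noteq> 0 \<Longrightarrow> M x $ j $ k = M x $ k $ j"
  by (rule has_grad_symmetric[OF grad_u grad_U])

lemma M_transpose: "x \<noteq> 0 \<Longrightarrow> transpose (M x) = M x"
  by (simp add: vec_eq_iff transpose_def M_sym)

lemma T_sym: assumes x: "x \<noteq> 0" shows "T j k x $ l = T j l x $ k" "T j k x $ l = T k j x $ l"
proof -
  show "T j k x $ l = T j l x $ k"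
    by (rule has_grad_symmetric[OF grad_U grad_M x])
  have "has_grad (\<lambda>x. M x $ k $ j) (T j k)"
    by (rule has_grad_cong[OF grad_M]) (auto simp: M_sym)
  from has_gradD(1)[OF this x] has_gradD(1)[OF grad_M x, of k j]
  have "(\<lambda>h. h \<bullet> T j k x) = (\<lambda>h. h \<bullet> T k j x)"
    unfolding gderiv_def by (rule has_derivative_unique)
  then have "axis l 1 \<bullet> T j k x = axis l 1 \<bullet> T k j x" by meson
  then show "T j k x $ l = T k j x $ l" by (simp add: inner_axis')
qed

text \<open>The j-th row of M is the gradient of the j-th component of U, so \<open>Mx\<close> is
  the Euler derivative D U, \<open>rad\<close> is D u, and \<open>mixed\<close> is half of D
  |U|^2.\<close>

definition "rad x = x \<bullet> U x"
definition "Mx x = M x *v x"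
definition "quad x = x \<bullet> (M x *v x)"
definition "mixed x = U x \<bullet> (M x *v x)"
definition "lap x = trace (M x)"
definition "grad_lap x = (\<Sum>j\<in>UNIV. T j j x)"

lemma grad_rad: "has_grad rad (\<lambda>x. U x + Mx x)"
proof -
  have "has_grad (\<lambda>x. \<Sum>j\<in>UNIV. x $ j * U x $ j) (\<lambda>x. \<Sum>j\<in>UNIV. x $ j *\<^sub>R M x $ j + U x $ j *\<^sub>R axis j 1)"
    by (intro has_grad_sum has_grad_mult has_grad_component grad_U)
  then show ?thesis
    by (rule has_grad_cong)
      (auto simp: rad_def inner_vec_def vec_eq_iff Mx_def matrix_vector_mult_def sum.distrib axis_def
        M_sym mult.commute if_distrib cong: if_cong)
qed

lemma grad_lap: "has_grad lap grad_lap"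
proof -
  have "has_grad (\<lambda>x. \<Sum>j\<in>UNIV. M x $ j $ j) (\<lambda>x. \<Sum>j\<in>UNIV. T j j x)"
    by (intro has_grad_sum grad_M)
  then show ?thesis by (simp add: lap_def[abs_def] grad_lap_def[abs_def] trace_def)
qed

lemma div_U: "has_div U lap"
  unfolding has_div_def using grad_U
  by (intro exI[of _ "\<lambda>j x. M x $ j"]) (auto simp: lap_def trace_def)

text \<open>Symmetry of the third derivatives turns the divergence of the Hessian into the gradient
  of the Laplacian.\<close>

lemma sum_T: "x \<noteq> 0 \<Longrightarrow> (\<Sum>j\<in>UNIV. \<Sum>k\<in>UNIV. a $ k * T j k x $ j) = grad_lap x \<bullet> a"
  unfolding grad_lap_def inner_sum_left
  by (intro sum.cong refl) (simp add: inner_vec_def T_sym(1)[of x _ _] mult.commute)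

lemma grad_M_mult:
  assumes "\<And>k. has_grad (\<lambda>x. A x $ k) (B k)"
  shows "has_grad (\<lambda>x. (M x *v A x) $ j) (\<lambda>x. \<Sum>k\<in>UNIV. M x $ j $ k *\<^sub>R B k x + A x $ k *\<^sub>R T j k x)"
  unfolding matrix_vector_mult_def by (simp, intro has_grad_sum has_grad_mult grad_M assms)

lemma div_Mx: "has_div Mx (\<lambda>x. lap x + grad_lap x \<bullet> x)"
  unfolding has_div_def
proof (intro exI conjI allI impI)
  show "has_grad (\<lambda>x. Mx x $ j) (\<lambda>x. \<Sum>k\<in>UNIV. M x $ j $ k *\<^sub>R axis k 1 + x $ k *\<^sub>R T j k x)" for j
    unfolding Mx_def by (intro grad_M_mult has_grad_component)
  fix x :: "real^'n" assume x: "x \<noteq> 0"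
  show "lap x + grad_lap x \<bullet> x =
      (\<Sum>j\<in>UNIV. (\<Sum>k\<in>UNIV. M x $ j $ k *\<^sub>R axis k 1 + x $ k *\<^sub>R T j k x) $ j)"
    by (simp add: sum.distrib sum_T[OF x] lap_def trace_def axis_def if_distrib cong: if_cong)
qed

lemma div_MU: "has_div (\<lambda>x. M x *v U x) (\<lambda>x. M x \<bullet> M x + grad_lap x \<bullet> U x)"
  unfolding has_div_def
proof (intro exI conjI allI impI)
  show "has_grad (\<lambda>x. (M x *v U x) $ j) (\<lambda>x. \<Sum>k\<in>UNIV. M x $ j $ k *\<^sub>R M x $ k + U x $ k *\<^sub>R T j k x)" for j
    by (intro grad_M_mult grad_U)
  fix x :: "real^'n" assume x: "x \<noteq> 0"
  show "M x \<bullet> M x + grad_lap x \<bullet> U x =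
      (\<Sum>j\<in>UNIV. (\<Sum>k\<in>UNIV. M x $ j $ k *\<^sub>R M x $ k + U x $ k *\<^sub>R T j k x) $ j)"
    by (simp add: sum.distrib sum_T[OF x] inner_vec_def M_sym[OF x, of _ _])
qed

lemma grad_inner_Mx:
  assumes "\<And>k. has_grad (\<lambda>x. A x $ k) (B k)"
  shows "has_grad (\<lambda>x. A x \<bullet> (M x *v x))
    (\<lambda>x. \<Sum>j\<in>UNIV. A x $ j *\<^sub>R (\<Sum>k\<in>UNIV. M x $ j $ k *\<^sub>R axis k 1 + x $ k *\<^sub>R T j k x) + (M x *v x) $ j *\<^sub>R B j x)"
  unfolding inner_vec_def inner_real_def
  by (intro has_grad_sum has_grad_mult grad_M_mult has_grad_component assms)

text \<open>Both derivatives contain the third derivative of the potential contracted with U, x and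
  x. By symmetry these terms agree, and the difference is of second order.\<close>

lemma grad_quad_mixed:
  obtains gq gm where "has_grad quad gq" "has_grad mixed gm"
    "\<And>x. x \<noteq> 0 \<Longrightarrow> x \<bullet> gm x - U x \<bullet> gq x = Mx x \<bullet> Mx x - mixed x"
proof (rule that)
  let ?S = "\<lambda>x j. \<Sum>k\<in>UNIV. M x $ j $ k *\<^sub>R axis k 1 + x $ k *\<^sub>R T j k x"
  let ?gq = "\<lambda>x. \<Sum>j\<in>UNIV. x $ j *\<^sub>R ?S x j + (M x *v x) $ j *\<^sub>R axis j 1"
  let ?gm = "\<lambda>x. \<Sum>j\<in>UNIV. U x $ j *\<^sub>R ?S x j + (M x *v x) $ j *\<^sub>R M x $ j"
  show "has_grad quad ?gq" unfolding quad_def[abs_def] by (intro grad_inner_Mx has_grad_component)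
  show "has_grad mixed ?gm" unfolding mixed_def[abs_def] by (intro grad_inner_Mx grad_U)
  fix x :: "real^'n" assume x: "x \<noteq> 0"
  define S where "S j = ?S x j" for j
  have "a \<bullet> S j = (\<Sum>k\<in>UNIV. a $ k * M x $ j $ k) + (\<Sum>k\<in>UNIV. x $ k * (T j k x \<bullet> a))" for a j
    by (simp add: S_def inner_sum_right inner_add_right sum.distrib inner_axis inner_commute mult.commute)
  then have S: "a \<bullet> S j = (M x *v a) $ j + (\<Sum>k\<in>UNIV. x $ k * (T j k x \<bullet> a))" for a j
    by (simp add: matrix_vector_mult_def mult.commute)
  have TT: "(\<Sum>j\<in>UNIV. U x $ j * (\<Sum>k\<in>UNIV. x $ k * (T j k x \<bullet> x))) = (\<Sum>j\<in>UNIV. x $ j * (\<Sum>k\<in>UNIV. x $ k * (T j k x \<bullet> U x)))"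
  proof -
    have "(\<Sum>j\<in>UNIV. U x $ j * (\<Sum>k\<in>UNIV. x $ k * (T j k x \<bullet> x))) = (\<Sum>j\<in>UNIV. \<Sum>k\<in>UNIV. \<Sum>l\<in>UNIV. U x $ j * x $ k * x $ l * T j k x $ l)"
      by (simp add: inner_vec_def sum_distrib_left mult_ac)
    also have "\<dots> = (\<Sum>j\<in>UNIV. \<Sum>l\<in>UNIV. \<Sum>k\<in>UNIV. U x $ j * x $ k * x $ l * T j k x $ l)"
      by (intro sum.cong refl sum.swap)
    also have "\<dots> = (\<Sum>l\<in>UNIV. \<Sum>j\<in>UNIV. \<Sum>k\<in>UNIV. U x $ j * x $ k * x $ l * T j k x $ l)"
      by (rule sum.swap)
    also have "\<dots> = (\<Sum>l\<in>UNIV. \<Sum>k\<in>UNIV. \<Sum>j\<in>UNIV. U x $ j * x $ k * x $ l * T j k x $ l)"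
      by (intro sum.cong refl sum.swap)
    also have "\<dots> = (\<Sum>l\<in>UNIV. \<Sum>k\<in>UNIV. \<Sum>j\<in>UNIV. U x $ j * x $ k * x $ l * T l k x $ j)"
      using T_sym[OF x] by (intro sum.cong refl) metis
    also have "\<dots> = (\<Sum>j\<in>UNIV. x $ j * (\<Sum>k\<in>UNIV. x $ k * (T j k x \<bullet> U x)))"
      by (simp add: inner_vec_def sum_distrib_left mult_ac)
    finally show ?thesis .
  qed
  have Mj: "x \<bullet> M x $ j = (M x *v x) $ j" for j
    by (simp add: inner_vec_def matrix_vector_mult_def mult.commute)
  have A: "x \<bullet> ?gm x = (\<Sum>j\<in>UNIV. U x $ j * (\<Sum>k\<in>UNIV. x $ k * (T j k x \<bullet> x))) + mixed x + Mx x \<bullet> Mx x"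
    unfolding S_def[symmetric] inner_sum_right inner_add_right inner_scaleR_right S Mj
    by (simp add: sum.distrib distrib_left mixed_def Mx_def inner_vec_def)
  have B: "U x \<bullet> ?gq x = (\<Sum>j\<in>UNIV. x $ j * (\<Sum>k\<in>UNIV. x $ k * (T j k x \<bullet> U x))) + x \<bullet> (M x *v U x) + mixed x"
    unfolding S_def[symmetric] inner_sum_right inner_add_right inner_scaleR_right S inner_axis
    by (simp add: sum.distrib distrib_left mixed_def Mx_def inner_vec_def mult.commute)
  have "x \<bullet> (M x *v U x) = mixed x"
    using symmetric_matrix_inner[OF M_transpose[OF x], of x "U x"] by (simp add: mixed_def)
  then show "x \<bullet> ?gm x - U x \<bullet> ?gq x = Mx x \<bullet> Mx x - mixed x"
    unfolding A B TT by simp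
qed

end

section \<open>Spherical derivatives of the potential\<close>

lemma has_grad_inverse_inner_self:
  "has_grad (\<lambda>x. inverse (x \<bullet> x)) (\<lambda>x. (- 2 * (inverse (x \<bullet> x))\<^sup>2) *\<^sub>R x)"
proof -
  have "has_grad (\<lambda>x. inverse (x \<bullet> x)) (\<lambda>x. (- (inverse (x \<bullet> x))\<^sup>2) *\<^sub>R (2 *\<^sub>R x))"
    by (rule has_grad_compose[OF has_grad_inner_self])
      (auto intro!: continuous_intros DERIV_inverse' derivative_eq_intros simp: power2_eq_square)
  then show ?thesis by (simp add: mult.commute)
qed

context potential_field begin

text \<open>With the metric of the unit sphere, \<open>tau\<close> is the spherical Laplacian of u
  and \<open>tan_sq\<close> is the squared spherical gradient divided by r^2, that is |Y|^2. The
  compression of r^2 M to the tangent space is the spherical Hessian plus \<open>rad\<close> times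
  the identity; solving for the Hessian gives \<open>hess_sq\<close> as its squared norm divided by
  r^2.\<close>

definition "tau x = (x \<bullet> x) * lap x - quad x - (real CARD('n) - 1) * rad x"
definition "tan_sq x = U x \<bullet> U x - (rad x)\<^sup>2 * inverse (x \<bullet> x)"
definition "hess_sq x = (x \<bullet> x) * (M x \<bullet> M x) - 2 * (Mx x \<bullet> Mx x) + (quad x)\<^sup>2 * inverse (x \<bullet> x) -
   2 * rad x * tau x * inverse (x \<bullet> x) - (real CARD('n) - 1) * (rad x)\<^sup>2 * inverse (x \<bullet> x)"
definition "rad_tan_div x = rad x * tau x * inverse (x \<bullet> x) + mixed x - rad x * quad x * inverse (x \<bullet> x) + tan_sq x"

lemma continuous_U: "continuous_on (- {0}) U"
  using has_grad_continuous[OF grad_U] continuous_on_vec_lambda[of "- {0}" "\<lambda>j x. U x $ j"] by simp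

lemma continuous_M: "continuous_on (- {0}) M"
  using has_gradD(2)[OF grad_U] continuous_on_vec_lambda[of "- {0}" "\<lambda>j x. M x $ j"] by simp

lemma continuous_Mx: "continuous_on (- {0}) Mx"
proof -
  have "continuous_on (- {0}) (\<lambda>x. \<chi> j. M x $ j \<bullet> x)"
    by (intro continuous_on_vec_lambda continuous_intros has_gradD(2)[OF grad_U])
  then show ?thesis by (simp add: Mx_def[abs_def] matrix_vector_mult_def inner_vec_def)
qed

lemma continuous_scalars:
  "continuous_on (- {0}) rad" "continuous_on (- {0}) quad" "continuous_on (- {0}) mixed"
  "continuous_on (- {0}) lap" "continuous_on (- {0}) tau" "continuous_on (- {0}) tan_sq"
  "continuous_on (- {0}) hess_sq" "continuous_on (- {0}) rad_tan_div"
proof -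
  show 1: "continuous_on (- {0}) rad" by (rule has_grad_continuous[OF grad_rad])
  show 2: "continuous_on (- {0}) quad" "continuous_on (- {0}) mixed"
    unfolding quad_def[abs_def] mixed_def[abs_def] Mx_def[symmetric]
    by (intro continuous_intros continuous_Mx continuous_U)+
  show 3: "continuous_on (- {0}) lap" by (rule has_grad_continuous[OF grad_lap])
  show 4: "continuous_on (- {0}) tau" unfolding tau_def[abs_def] by (intro continuous_intros 1 2 3)
  show 5: "continuous_on (- {0}) tan_sq" unfolding tan_sq_def[abs_def]
    by (intro continuous_intros 1 continuous_U) auto
  show "continuous_on (- {0}) hess_sq" unfolding hess_sq_def[abs_def]
    by (intro continuous_intros 1 2 3 4 continuous_M continuous_Mx) auto
  show "continuous_on (- {0}) rad_tan_div" unfolding rad_tan_div_def[abs_def]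
    by (intro continuous_intros 1 2 4 5) auto
qed

lemma inner_rules:
  "x \<bullet> U x = rad x" "U x \<bullet> x = rad x" "x \<bullet> Mx x = quad x" "Mx x \<bullet> x = quad x"
  "U x \<bullet> Mx x = mixed x" "Mx x \<bullet> U x = mixed x"
  by (simp_all add: rad_def quad_def mixed_def Mx_def inner_commute)

lemma inner_MU: "x \<noteq> 0 \<Longrightarrow> x \<bullet> (M x *v U x) = mixed x"
  using symmetric_matrix_inner[OF M_transpose, of x x "U x"] by (simp add: mixed_def)

text \<open>\<open>rad\<close> times Y is tangential, so this divergence has integral zero against
  radial weights. It absorbs the cross terms between the radial and the tangential part of
  U.\<close>

lemma div_rad_tan:
  "has_div (\<lambda>x. rad x *\<^sub>R (U x - (rad x * inverse (x \<bullet> x)) *\<^sub>R x)) rad_tan_div"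
proof (rule has_div_cong[OF has_div_scale[OF grad_rad has_div_diff[OF div_U
        has_div_scale[OF has_grad_mult[OF grad_rad has_grad_inverse_inner_self] has_div_id]]]])
  fix x :: "real^'n" assume x: "x \<noteq> 0"
  then show "(U x + Mx x) \<bullet> (U x - (rad x * inverse (x \<bullet> x)) *\<^sub>R x) +
      rad x * (lap x - ((rad x *\<^sub>R (- 2 * (inverse (x \<bullet> x))\<^sup>2) *\<^sub>R x + inverse (x \<bullet> x) *\<^sub>R (U x + Mx x)) \<bullet> x + rad x * inverse (x \<bullet> x) * real CARD('n))) =
      rad_tan_div x"
    unfolding rad_tan_div_def tan_sq_def tau_def inner_simps inner_rules
    by (simp add: field_simps power2_eq_square)
qed simp

text \<open>The tangential part of the Bochner identity on spheres. The field is a combination of null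
  Lagrangians, so no third derivatives of the potential survive in its divergence.\<close>

lemma div_bochner:
  obtains \<Phi> where "\<And>x. x \<noteq> 0 \<Longrightarrow> x \<bullet> \<Phi> x = 0"
    "has_div \<Phi> (\<lambda>x. (tau x)\<^sup>2 * inverse (x \<bullet> x) - hess_sq x - (real CARD('n) - 2) * tan_sq x)"
proof -
  obtain gq gm where gq: "has_grad quad gq" and gm: "has_grad mixed gm"
    and gqm: "\<And>x. x \<noteq> 0 \<Longrightarrow> x \<bullet> gm x - U x \<bullet> gq x = Mx x \<bullet> Mx x - mixed x"
    using grad_quad_mixed by metis
  \<comment> \<open>The bracket in \<open>?A\<close> is the null Lagrangian with divergence (tr M)^2
    - |M|^2. \<open>?B\<close> and \<open>?C\<close> complete it to a tangential field, and the
    multiple of the tangential field \<open>?D\<close> removes the remaining \<open>mixed\<close>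
    term and brings in the curvature term (N - 2) \<open>tan_sq\<close>.\<close>
  let ?A = "\<lambda>x. (x \<bullet> x) *\<^sub>R (lap x *\<^sub>R U x - M x *v U x)"
  let ?B = "\<lambda>x. rad x *\<^sub>R (lap x *\<^sub>R x - Mx x)"
  let ?C = "\<lambda>x. mixed x *\<^sub>R x - quad x *\<^sub>R U x"
  let ?D = "\<lambda>x. rad x *\<^sub>R (U x - (rad x * inverse (x \<bullet> x)) *\<^sub>R x)"
  let ?\<Phi> = "\<lambda>x. ?A x - ?B x + ?C x - (real CARD('n) - 2) *\<^sub>R ?D x"
  have A: "has_div ?A (\<lambda>x. 2 *\<^sub>R x \<bullet> (lap x *\<^sub>R U x - M x *v U x) +
      (x \<bullet> x) * (grad_lap x \<bullet> U x + lap x * lap x - (M x \<bullet> M x + grad_lap x \<bullet> U x)))"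
    by (intro has_div_scale has_div_diff has_grad_inner_self grad_lap div_U div_MU)
  have B: "has_div ?B (\<lambda>x. (U x + Mx x) \<bullet> (lap x *\<^sub>R x - Mx x) +
      rad x * (grad_lap x \<bullet> x + lap x * real CARD('n) - (lap x + grad_lap x \<bullet> x)))"
    by (intro has_div_scale has_div_diff grad_rad grad_lap has_div_id div_Mx)
  have C: "has_div ?C (\<lambda>x. gm x \<bullet> x + mixed x * real CARD('n) - (gq x \<bullet> U x + quad x * lap x))"
    by (intro has_div_scale has_div_diff gq gm has_div_id div_U)
  have D: "has_div (\<lambda>x. (real CARD('n) - 2) *\<^sub>R ?D x) (\<lambda>x. 0 \<bullet> ?D x + (real CARD('n) - 2) * rad_tan_div x)"
    by (intro has_div_scale[OF has_grad_const] div_rad_tan)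
  show thesis
  proof (rule that)
    show "has_div ?\<Phi> (\<lambda>x. (tau x)\<^sup>2 * inverse (x \<bullet> x) - hess_sq x - (real CARD('n) - 2) * tan_sq x)"
    proof (rule has_div_cong[OF has_div_diff[OF has_div_add[OF has_div_diff[OF A B] C] D]])
      fix x :: "real^'n" assume x: "x \<noteq> 0"
      define s where "s = real CARD('n) - 2"
      have dim: "real CARD('n) = s + 2" by (simp add: s_def)
      have C': "gm x \<bullet> x = gq x \<bullet> U x + (Mx x \<bullet> Mx x - mixed x)"
        using gqm[OF x] by (simp add: inner_commute)
      show "2 *\<^sub>R x \<bullet> (lap x *\<^sub>R U x - M x *v U x) +
         (x \<bullet> x) * (grad_lap x \<bullet> U x + lap x * lap x - (M x \<bullet> M x + grad_lap x \<bullet> U x)) -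
         ((U x + Mx x) \<bullet> (lap x *\<^sub>R x - Mx x) +
          rad x * (grad_lap x \<bullet> x + lap x * real CARD('n) - (lap x + grad_lap x \<bullet> x))) +
         (gm x \<bullet> x + mixed x * real CARD('n) - (gq x \<bullet> U x + quad x * lap x)) -
         (0 \<bullet> ?D x + (real CARD('n) - 2) * rad_tan_div x) =
         (tau x)\<^sup>2 * inverse (x \<bullet> x) - hess_sq x - (real CARD('n) - 2) * tan_sq x"
        using x unfolding C' rad_tan_div_def hess_sq_def tan_sq_def tau_def inner_simps inner_rules inner_MU[OF x] dim
        by (simp add: field_simps power2_eq_square)
    qed simp
    show "x \<bullet> ?\<Phi> x = 0" if "x \<noteq> 0" for x
      using that unfolding inner_simps inner_rules inner_MU[OF that]
      by (simp add: field_simps power2_eq_square)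
  qed
qed

text \<open>The trace inequality for the spherical Hessian. It follows from the one for the
  compression of M, because shifting by a multiple of the identity of the tangent space changes both
  sides equally.\<close>

lemma tau_bound: "(tau x)\<^sup>2 * inverse (x \<bullet> x) \<le> (real CARD('n) - 1) * hess_sq x" if x: "x \<noteq> 0" and dim: "CARD('n) \<ge> 2"
proof -
  define t where "t = x \<bullet> x"
  have t: "t > 0" using x by (simp add: t_def)
  have "(t * lap x - quad x)\<^sup>2 \<le> (real CARD('n) - 1) * (t\<^sup>2 * (M x \<bullet> M x) - 2 * t * (Mx x \<bullet> Mx x) + (quad x)\<^sup>2)"
    using compression_trace_bound[OF M_transpose[OF x] x dim] by (simp add: lap_def quad_def Mx_def t_def)
  also have "\<dots> = (real CARD('n) - 1) * t * hess_sq x + 2 * (real CARD('n) - 1) * rad x * tau x + (real CARD('n) - 1)\<^sup>2 * (rad x)\<^sup>2"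
    using t unfolding hess_sq_def t_def[symmetric] by (simp add: field_simps power2_eq_square)
  finally have "(tau x)\<^sup>2 \<le> (real CARD('n) - 1) * t * hess_sq x"
    unfolding tau_def t_def[symmetric] by (simp add: power2_eq_square algebra_simps)
  then show ?thesis using t by (simp add: t_def[symmetric] field_simps)
qed

lemma integral_hess_sq_ge:
  assumes dim: "CARD('n) \<ge> 3" and R: "R > 0"
  shows "cutoff_integral R p tan_sq \<le> cutoff_integral R p hess_sq"
    (is "?T \<le> ?H")
proof -
  obtain \<Phi> where \<Phi>: "\<And>x. x \<noteq> 0 \<Longrightarrow> x \<bullet> \<Phi> x = 0"
    "has_div \<Phi> (\<lambda>x. (tau x)\<^sup>2 * inverse (x \<bullet> x) - hess_sq x - (real CARD('n) - 2) * tan_sq x)"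
    using div_bochner by blast
  let ?\<tau> = "\<lambda>x. (tau x)\<^sup>2 * inverse (x \<bullet> x)"
  have int: "integrable lborel (\<lambda>x. cutoff R x * (norm x powr p * ?\<tau> x))"
    "integrable lborel (\<lambda>x. cutoff R x * (norm x powr p * hess_sq x))"
    "integrable lborel (\<lambda>x. cutoff R x * (norm x powr p * tan_sq x))"
    by (intro integrable_cutoff R continuous_intros continuous_scalars; simp)+
  have "0 = (\<integral>x. cutoff R x * (norm x powr p * (?\<tau> x - hess_sq x - (real CARD('n) - 2) * tan_sq x)) \<partial>lborel)"
    using integral_tangential_div[OF \<Phi>(2,1) has_grad_norm_powr R] by simp
  also have "\<dots> = (\<integral>x. cutoff R x * (norm x powr p * ?\<tau> x) - cutoff R x * (norm x powr p * hess_sq x) - (real CARD('n) - 2) * (cutoff R x * (norm x powr p * tan_sq x)) \<partial>lborel)"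
    by (intro Bochner_Integration.integral_cong) (auto simp: algebra_simps)
  also have "\<dots> = (\<integral>x. cutoff R x * (norm x powr p * ?\<tau> x) \<partial>lborel) - ?H - (real CARD('n) - 2) * ?T"
    using int by simp
  also have "(\<integral>x. cutoff R x * (norm x powr p * ?\<tau> x) \<partial>lborel) \<le> (\<integral>x. (real CARD('n) - 1) * (cutoff R x * (norm x powr p * hess_sq x)) \<partial>lborel)"
  proof (rule integral_mono_AE)
    show "AE x in lborel. cutoff R x * (norm x powr p * ?\<tau> x) \<le> (real CARD('n) - 1) * (cutoff R x * (norm x powr p * hess_sq x))"
    proof (rule AE_nonzero)
      fix x :: "real^'n" assume "x \<noteq> 0"
      then have "cutoff R x * norm x powr p * ?\<tau> x \<le> cutoff R x * norm x powr p * ((real CARD('n) - 1) * hess_sq x)"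
        using dim by (intro mult_left_mono tau_bound) (auto simp: cutoff_bounds)
      then show "cutoff R x * (norm x powr p * ?\<tau> x) \<le> (real CARD('n) - 1) * (cutoff R x * (norm x powr p * hess_sq x))"
        by (simp add: mult_ac)
    qed
  qed (use int in auto)
  also have "\<dots> = (real CARD('n) - 1) * ?H" by simp
  \<comment> \<open>Both the curvature term and the loss in the trace inequality carry the factor N
    - 2, which can be cancelled because N >= 3.\<close>
  finally have "0 \<le> (real CARD('n) - 2) * (?H - ?T)" by (simp add: algebra_simps)
  then show ?thesis using dim by (simp add: zero_le_mult_iff)
qed

end

section \<open>The quadratic form\<close>

context potential_field begin

lemma grad_U_sq: "has_grad (\<lambda>x. U x \<bullet> U x) (\<lambda>x. 2 *\<^sub>R (M x *v U x))"
proof -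
  have "has_grad (\<lambda>x. \<Sum>j\<in>UNIV. U x $ j * U x $ j) (\<lambda>x. \<Sum>j\<in>UNIV. U x $ j *\<^sub>R M x $ j + U x $ j *\<^sub>R M x $ j)"
    by (intro has_grad_sum has_grad_mult grad_U)
  then show ?thesis
    by (rule has_grad_cong)
      (auto simp: inner_vec_def vec_eq_iff matrix_vector_mult_def sum_distrib_left M_sym mult_ac)
qed

lemma grad_tan_sq:
  obtains g where "has_grad tan_sq g"
    "\<And>x. x \<noteq> 0 \<Longrightarrow> x \<bullet> g x = 2 * (mixed x - rad x * quad x * inverse (x \<bullet> x))"
proof (rule that)
  show "has_grad tan_sq (\<lambda>x. 2 *\<^sub>R (M x *v U x) -
      ((rad x * rad x) *\<^sub>R ((- 2 * (inverse (x \<bullet> x))\<^sup>2) *\<^sub>R x) + inverse (x \<bullet> x) *\<^sub>R (rad x *\<^sub>R (U x + Mx x) + rad x *\<^sub>R (U x + Mx x))))"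
    (is "has_grad _ ?g")
    unfolding tan_sq_def[abs_def] power2_eq_square[of "rad _"]
    by (intro has_grad_diff has_grad_mult grad_rad grad_U_sq has_grad_inverse_inner_self)
  show "x \<bullet> ?g x = 2 * (mixed x - rad x * quad x * inverse (x \<bullet> x))" if "x \<noteq> 0" for x
    using that unfolding inner_simps inner_rules inner_MU[OF that]
    by (simp add: field_simps power2_eq_square)
qed

text \<open>Z is the tangential part of D U and equals D Y. The left side is an exact expression in
  |Z - Y|^2 and -(N + 1) |Y|^2. Recentring the square at \<open>\<kappa>\<close> Y instead of Y
  produces (\<open>\<kappa>\<close> - 1)^2 |Y|^2, which pays the negative term, and a remainder
  proportional to D |Y|^2 - 2 \<open>\<kappa>\<close> |Y|^2, a total radial derivative under the
  weight.\<close>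

lemma pointwise_angular_bound:
  assumes x: "x \<noteq> 0" and \<kappa>: "(\<kappa> - 1)\<^sup>2 \<ge> real CARD('n) + 1"
  shows "(x \<bullet> x) * (M x \<bullet> M x) - Mx x \<bullet> Mx x - (real CARD('n) - 1) * (U x \<bullet> U x) \<ge>
    2 * rad_tan_div x + (hess_sq x - tan_sq x) +
    2 * (\<kappa> - 1) * (mixed x - rad x * quad x * inverse (x \<bullet> x) - \<kappa> * tan_sq x)"
proof -
  define Y where "Y = U x - (rad x * inverse (x \<bullet> x)) *\<^sub>R x"
  define Z where "Z = Mx x - (quad x * inverse (x \<bullet> x)) *\<^sub>R x"
  have YY: "Y \<bullet> Y = tan_sq x"
    using x unfolding Y_def tan_sq_def inner_simps inner_rules by (simp add: field_simps power2_eq_square)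
  have YZ: "Y \<bullet> Z = mixed x - rad x * quad x * inverse (x \<bullet> x)"
    using x unfolding Y_def Z_def inner_simps inner_rules by (simp add: field_simps power2_eq_square)
  have ZZ: "Z \<bullet> Z = Mx x \<bullet> Mx x - (quad x)\<^sup>2 * inverse (x \<bullet> x)"
    using x unfolding Z_def inner_simps inner_rules by (simp add: field_simps power2_eq_square)
  have "0 \<le> (Z - \<kappa> *\<^sub>R Y) \<bullet> (Z - \<kappa> *\<^sub>R Y)" by simp
  also have "\<dots> = Z \<bullet> Z - 2 * \<kappa> * (Y \<bullet> Z) + \<kappa>\<^sup>2 * (Y \<bullet> Y)"
    unfolding inner_simps by (simp add: inner_commute power2_eq_square algebra_simps)
  finally have 1: "0 \<le> Z \<bullet> Z - 2 * \<kappa> * (Y \<bullet> Z) + \<kappa>\<^sup>2 * (Y \<bullet> Y)" .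
  have 2: "(real CARD('n) + 1) * (Y \<bullet> Y) \<le> (\<kappa> - 1)\<^sup>2 * (Y \<bullet> Y)" by (intro mult_right_mono \<kappa>) simp
  have "(x \<bullet> x) * (M x \<bullet> M x) - Mx x \<bullet> Mx x - (real CARD('n) - 1) * (U x \<bullet> U x) =
    2 * rad_tan_div x + (hess_sq x - tan_sq x) + (Z \<bullet> Z - 2 * (Y \<bullet> Z) + Y \<bullet> Y) - (real CARD('n) + 1) * (Y \<bullet> Y)"
    unfolding YY YZ ZZ rad_tan_div_def hess_sq_def tan_sq_def by (simp add: algebra_simps)
  also have "\<dots> = 2 * rad_tan_div x + (hess_sq x - tan_sq x) + 2 * (\<kappa> - 1) * (Y \<bullet> Z - \<kappa> * (Y \<bullet> Y)) +
     (Z \<bullet> Z - 2 * \<kappa> * (Y \<bullet> Z) + \<kappa>\<^sup>2 * (Y \<bullet> Y)) + ((\<kappa> - 1)\<^sup>2 * (Y \<bullet> Y) - (real CARD('n) + 1) * (Y \<bullet> Y))"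
    by (simp add: power2_eq_square algebra_simps)
  finally show ?thesis using 1 2 unfolding YY YZ by linarith
qed

text \<open>Here c stands for \<open>\<beta>\<close> r^\<open>\<delta>\<close>, whose Euler
  derivative is \<open>\<delta>\<close> c. The term c \<open>\<delta>\<close> |U|^2 on both sides is
  what completes the right side to a total radial derivative.\<close>

lemma pointwise_radial_square:
  assumes "\<sigma>\<^sup>2 = \<kappa>\<^sup>2 + real CARD('n) - 1"
  shows "Mx x \<bullet> Mx x + (real CARD('n) - 1) * (U x \<bullet> U x) + c\<^sup>2 * (U x \<bullet> U x) - c * (2 * \<sigma> + \<delta>) * (U x \<bullet> U x) \<ge>
    2 * (\<kappa> + \<sigma> - c) * (mixed x - \<kappa> * (U x \<bullet> U x)) - c * \<delta> * (U x \<bullet> U x)"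
proof -
  have dim: "real CARD('n) - 1 = \<sigma>\<^sup>2 - \<kappa>\<^sup>2" using assms by simp
  have "0 \<le> (Mx x - (\<kappa> + \<sigma> - c) *\<^sub>R U x) \<bullet> (Mx x - (\<kappa> + \<sigma> - c) *\<^sub>R U x)" by simp
  also have "\<dots> = Mx x \<bullet> Mx x - 2 * (\<kappa> + \<sigma> - c) * mixed x + (\<kappa> + \<sigma> - c)\<^sup>2 * (U x \<bullet> U x)"
    unfolding inner_simps inner_rules by (simp add: power2_eq_square algebra_simps)
  finally show ?thesis unfolding dim by (simp add: power2_eq_square algebra_simps)
qed

end

text \<open>Taking the spherical inequality as \<open>sphere_gap\<close> separates the radial
  argument, common to all dimensions, from its two dimension-dependent proofs.\<close>

locale weighted_potential_field = potential_field u U M T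
  for u :: "real^'n \<Rightarrow> real" and U M T +
  fixes a b \<beta> \<sigma> :: real
  assumes gap: "(real CARD('n) / 2 - a)\<^sup>2 \<ge> real CARD('n) + 1"
    and \<sigma>: "\<sigma>\<^sup>2 = (1 - real CARD('n) / 2 + a)\<^sup>2 + real CARD('n) - 1"
    and lim1: "\<And>F. F \<in> {at 0, at_infinity} \<Longrightarrow> ((\<lambda>x. norm x powr (- 1 + real CARD('n) / 2 - a) *\<^sub>R U x) \<longlongrightarrow> 0) F"
    and lim2: "\<And>F. F \<in> {at 0, at_infinity} \<Longrightarrow> ((\<lambda>x. norm x powr (- b + real CARD('n) / 2) *\<^sub>R U x) \<longlongrightarrow> 0) F"
    and int_M: "integrable lborel (\<lambda>x. (M x \<bullet> M x) / norm x powr (2 * a))"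
    and int_U: "integrable lborel (\<lambda>x. (U x \<bullet> U x) / norm x powr (2 * b))"
      "integrable lborel (\<lambda>x. (U x \<bullet> U x) / norm x powr (a + b + 1))"
    and sphere_gap: "\<And>R. R > 0 \<Longrightarrow>
      cutoff_integral R (- 2 * a - 2) tan_sq \<le>
      cutoff_integral R (- 2 * a - 2) hess_sq"
begin

definition "\<kappa> = 1 - real CARD('n) / 2 + a"
definition "\<delta> = a - b + 1"

text \<open>r^(-2 \<open>\<kappa>\<close>) |U|^2 is the square of the quantity in the first limit
  condition of the space, and with the further factor r^\<open>\<delta>\<close> it is the product of
  the quantities in the two conditions. Hence this function vanishes at both ends.\<close>

definition "boundary x = (\<kappa> - 1) * (norm x powr (- 2 * \<kappa>) * tan_sq x) +
   (\<kappa> + \<sigma> - \<beta> * norm x powr \<delta>) * (norm x powr (- 2 * \<kappa>) * (U x \<bullet> U x))"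

definition "boundary_rate x =
   2 * (\<kappa> - 1) * (mixed x - rad x * quad x * inverse (x \<bullet> x) - \<kappa> * tan_sq x) +
   2 * (\<kappa> + \<sigma> - \<beta> * norm x powr \<delta>) * (mixed x - \<kappa> * (U x \<bullet> U x)) - \<beta> * norm x powr \<delta> * \<delta> * (U x \<bullet> U x)"

lemma grad_boundary:
  obtains g where "has_grad boundary g"
    "\<And>x. x \<noteq> 0 \<Longrightarrow> norm x powr (- real CARD('n)) * (x \<bullet> g x) = norm x powr (- 2 * a - 2) *
       boundary_rate x"
proof -
  obtain gt where gt: "has_grad tan_sq gt"
    and gt': "\<And>x. x \<noteq> 0 \<Longrightarrow> x \<bullet> gt x = 2 * (mixed x - rad x * quad x * inverse (x \<bullet> x))"
    using grad_tan_sq by blast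
  let ?w = "\<lambda>x::real^'n. norm x powr (- 2 * \<kappa>)" and ?w' = "\<lambda>x::real^'n. (- 2 * \<kappa> * norm x powr (- 2 * \<kappa> - 2)) *\<^sub>R x"
  let ?c = "\<lambda>x::real^'n. \<kappa> + \<sigma> - \<beta> * norm x powr \<delta>"
  let ?c' = "\<lambda>x::real^'n. 0 - (\<beta> *\<^sub>R ((\<delta> * norm x powr (\<delta> - 2)) *\<^sub>R x) + norm x powr \<delta> *\<^sub>R 0)"
  let ?g = "\<lambda>x. ((\<kappa> - 1) *\<^sub>R (?w x *\<^sub>R gt x + tan_sq x *\<^sub>R ?w' x) + (?w x * tan_sq x) *\<^sub>R 0) +
     (?c x *\<^sub>R (?w x *\<^sub>R (2 *\<^sub>R (M x *v U x)) + (U x \<bullet> U x) *\<^sub>R ?w' x) + (?w x * (U x \<bullet> U x)) *\<^sub>R ?c' x)"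
  show thesis
  proof (rule that)
    show "has_grad boundary ?g"
      unfolding boundary_def[abs_def]
      by (intro has_grad_add has_grad_mult has_grad_diff has_grad_const has_grad_norm_powr gt grad_U_sq)
    fix x :: "real^'n" assume x: "x \<noteq> 0"
    have pw: "norm x powr (q - 2) * (x \<bullet> x) = norm x powr q" for q
      by (rule norm_powr_mult_inner_self[OF x])
    have w: "norm x powr (- real CARD('n)) * ?w x = norm x powr (- 2 * a - 2)"
    proof -
      \<comment> \<open>This identity dictates the weight r^(-2 \<open>\<kappa>\<close>): times
        r^(-N) it is the weight of the gradient energy times r^(-2).\<close>
      have "- real CARD('n) + - 2 * \<kappa> = - 2 * a - 2" by (simp add: \<kappa>_def algebra_simps)
      then show ?thesis using powr_add[of "norm x" "- real CARD('n)" "- 2 * \<kappa>"] by simp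
    qed
    have xw: "x \<bullet> ?w' x = - 2 * \<kappa> * ?w x" using pw[of "- 2 * \<kappa>"] by (simp add: mult.assoc)
    have xc: "x \<bullet> ?c' x = - \<beta> * \<delta> * norm x powr \<delta>" using pw[of \<delta>] by (simp add: inner_diff_right mult.assoc)
    define W' where "W' = ?w' x"
    define C' where "C' = ?c' x"
    have "x \<bullet> ?g x = ?w x * boundary_rate x"
      unfolding W'_def[symmetric] C'_def[symmetric] inner_add_right inner_scaleR_right
        xw[folded W'_def] xc[folded C'_def] gt'[OF x] inner_MU[OF x] inner_zero_right
      by (simp add: boundary_rate_def algebra_simps)
    then show "norm x powr (- real CARD('n)) * (x \<bullet> ?g x) = norm x powr (- 2 * a - 2) *
       boundary_rate x"
      unfolding w[symmetric] by (simp only: mult.assoc)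
  qed
qed

lemma tan_sq_bounds: "x \<noteq> 0 \<Longrightarrow> 0 \<le> tan_sq x" "tan_sq x \<le> U x \<bullet> U x"
proof -
  show "tan_sq x \<le> U x \<bullet> U x" by (simp add: tan_sq_def)
  assume x: "x \<noteq> 0"
  have "(rad x)\<^sup>2 \<le> (x \<bullet> x) * (U x \<bullet> U x)" unfolding rad_def by (rule Cauchy_Schwarz_ineq)
  then show "0 \<le> tan_sq x" using x by (simp add: tan_sq_def field_simps)
qed

lemma boundary_tendsto_0:
  assumes F: "F \<in> {at 0, at_infinity}"
  shows "(boundary \<longlongrightarrow> 0) F"
proof -
  note nz = eventually_nonzero[OF F]
  let ?V = "\<lambda>x. norm x powr (- 1 + real CARD('n) / 2 - a) * norm (U x)"
  let ?W = "\<lambda>x. norm x powr (- b + real CARD('n) / 2) * norm (U x)"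
  let ?b = "\<lambda>x. \<bar>\<kappa> - 1\<bar> * (?V x)\<^sup>2 + \<bar>\<kappa> + \<sigma>\<bar> * (?V x)\<^sup>2 + \<bar>\<beta>\<bar> * (?V x * ?W x)"
  have V: "(?V \<longlongrightarrow> 0) F" using tendsto_norm[OF lim1[OF F]] by simp
  have W: "(?W \<longlongrightarrow> 0) F" using tendsto_norm[OF lim2[OF F]] by simp
  have "((\<lambda>x. ?b x) \<longlongrightarrow> \<bar>\<kappa> - 1\<bar> * 0\<^sup>2 + \<bar>\<kappa> + \<sigma>\<bar> * 0\<^sup>2 + \<bar>\<beta>\<bar> * (0 * 0)) F"
    by (intro tendsto_intros V W)
  then have lim: "((\<lambda>x. ?b x) \<longlongrightarrow> 0) F" by simp
  show ?thesis
  proof (rule Lim_null_comparison[OF _ lim], use nz in eventually_elim)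
    fix x :: "real^'n" assume x: "x \<noteq> 0"
    have V2: "(?V x)\<^sup>2 = norm x powr (- 2 * \<kappa>) * (U x \<bullet> U x)"
      using powr_add[of "norm x" "- 1 + real CARD('n) / 2 - a" "- 1 + real CARD('n) / 2 - a"]
      by (simp add: power2_eq_square \<kappa>_def power2_norm_eq_inner[symmetric] algebra_simps)
    have VW: "?V x * ?W x = norm x powr \<delta> * (norm x powr (- 2 * \<kappa>) * (U x \<bullet> U x))"
      using powr_add[of "norm x" "- 1 + real CARD('n) / 2 - a" "- b + real CARD('n) / 2"] powr_add[of "norm x" \<delta> "- 2 * \<kappa>"]
      by (simp add: power2_eq_square \<kappa>_def \<delta>_def power2_norm_eq_inner[symmetric] algebra_simps)
    have T: "norm x powr (- 2 * \<kappa>) * tan_sq x \<le> (?V x)\<^sup>2" "0 \<le> norm x powr (- 2 * \<kappa>) * tan_sq x"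
      unfolding V2 using tan_sq_bounds[of x] x by (auto intro!: mult_left_mono)
    have "boundary x = (\<kappa> - 1) * (norm x powr (- 2 * \<kappa>) * tan_sq x) + (\<kappa> + \<sigma>) * (?V x)\<^sup>2 - \<beta> * (?V x * ?W x)"
      unfolding boundary_def V2 VW by (simp add: algebra_simps)
    then have "norm (boundary x) \<le> \<bar>(\<kappa> - 1) * (norm x powr (- 2 * \<kappa>) * tan_sq x)\<bar> + \<bar>(\<kappa> + \<sigma>) * (?V x)\<^sup>2\<bar> + \<bar>\<beta> * (?V x * ?W x)\<bar>"
      unfolding real_norm_def by linarith
    also have "\<dots> \<le> ?b x"
      using T unfolding abs_mult[of "\<kappa> - 1"] abs_mult[of "\<kappa> + \<sigma>"] abs_mult[of \<beta>]
      by (intro add_mono mult_left_mono) (auto simp: abs_mult)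
    finally show "norm (boundary x) \<le> ?b x" .
  qed
qed

text \<open>Integrability is given for the combination \<open>L\<close> of the three energies, while
  \<open>hess_sq\<close>, \<open>tan_sq\<close> and the divergence terms are separated under a fixed
  cutoff. There the divergence has integral zero and \<open>sphere_gap\<close> applies; only the
  radial derivative survives, and it disappears as R grows.\<close>

theorem quadratic_form_nonneg:
  "0 \<le> (\<integral>x. (M x \<bullet> M x) / norm x powr (2 * a) \<partial>lborel)
     - \<beta> * (2 * \<sigma> + (a - b + 1)) * (\<integral>x. (U x \<bullet> U x) / norm x powr (a + b + 1) \<partial>lborel)
     + \<beta>\<^sup>2 * (\<integral>x. (U x \<bullet> U x) / norm x powr (2 * b) \<partial>lborel)"
proof -
  obtain g where g: "has_grad boundary g" and xg:
    "\<And>x. x \<noteq> 0 \<Longrightarrow> norm x powr (- real CARD('n)) * (x \<bullet> g x) = norm x powr (- 2 * a - 2) *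
       boundary_rate x"
    using grad_boundary by blast
  define L where "L x = (M x \<bullet> M x) / norm x powr (2 * a)
     - \<beta> * (2 * \<sigma> + \<delta>) * ((U x \<bullet> U x) / norm x powr (a + b + 1))
     + \<beta>\<^sup>2 * ((U x \<bullet> U x) / norm x powr (2 * b))" for x
  let ?w = "\<lambda>x::real^'n. norm x powr (- 2 * a - 2)"
  let ?g = "\<lambda>x. norm x powr (- real CARD('n)) * (x \<bullet> g x)"
  let ?S = "\<lambda>R x. cutoff R x * (?w x * (2 * rad_tan_div x)) + cutoff R x * (?w x * hess_sq x) - cutoff R x * (?w x * tan_sq x) + cutoff R x * ?g x"
  have int_L: "integrable lborel L"
    unfolding L_def
    by (intro Bochner_Integration.integrable_add Bochner_Integration.integrable_diff
        integrable_mult_right int_M int_U)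
  have pw: "L x \<ge> ?w x * (2 * rad_tan_div x) + ?w x * hess_sq x - ?w x * tan_sq x + ?g x"
    if x: "x \<noteq> 0" for x
  proof -
    \<comment> \<open>All three energies are brought to the common weight r^(-2a-2), where they form
      a quadratic polynomial in \<open>\<beta>\<close> r^\<open>\<delta>\<close>.\<close>
    have d: "c / norm x powr e = ?w x * (norm x powr (2 * a + 2 - e) * c)" for c e
    proof -
      have "1 / norm x powr e = ?w x * norm x powr (2 * a + 2 - e)"
        using powr_add[of "norm x" "- 2 * a - 2" "2 * a + 2 - e"] powr_minus_divide[of "norm x" e] by simp
      then have "c * (1 / norm x powr e) = c * (?w x * norm x powr (2 * a + 2 - e))" by (rule arg_cong)
      then show ?thesis by (simp add: mult_ac)
    qed
    have "norm x powr (2 * a + 2 - 2 * a) = x \<bullet> x" using x by (simp add: powr_numeral power2_norm_eq_inner)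
    moreover have "norm x powr (2 * a + 2 - 2 * b) = (norm x powr \<delta>)\<^sup>2"
      using powr_add[of "norm x" \<delta> \<delta>] by (simp add: power2_eq_square \<delta>_def algebra_simps)
    moreover have "norm x powr (2 * a + 2 - (a + b + 1)) = norm x powr \<delta>"
      by (rule arg_cong[where f="\<lambda>p. norm x powr p"]) (simp add: \<delta>_def)
    ultimately have L: "L x = ?w x * ((x \<bullet> x) * (M x \<bullet> M x) - (\<beta> * norm x powr \<delta>) * (2 * \<sigma> + \<delta>) * (U x \<bullet> U x) + (\<beta> * norm x powr \<delta>)\<^sup>2 * (U x \<bullet> U x))"
      unfolding L_def d by (simp only:) (simp add: algebra_simps power_mult_distrib)
    have "(\<kappa> - 1)\<^sup>2 \<ge> real CARD('n) + 1" using gap by (simp add: \<kappa>_def power2_commute)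
    from pointwise_angular_bound[OF x this]
      pointwise_radial_square[OF \<sigma>[folded \<kappa>_def], where x=x and c="\<beta> * norm x powr \<delta>" and \<delta>=\<delta>]
    have *: "2 * rad_tan_div x + (hess_sq x - tan_sq x) + boundary_rate x \<le>
      (x \<bullet> x) * (M x \<bullet> M x) - (\<beta> * norm x powr \<delta>) * (2 * \<sigma> + \<delta>) * (U x \<bullet> U x) + (\<beta> * norm x powr \<delta>)\<^sup>2 * (U x \<bullet> U x)"
      unfolding boundary_rate_def by linarith
    have "?w x * (2 * rad_tan_div x) + ?w x * hess_sq x - ?w x * tan_sq x + ?g x = ?w x * (2 * rad_tan_div x + (hess_sq x - tan_sq x) + boundary_rate x)"
      unfolding xg[OF x] by (simp only: distrib_left right_diff_distrib add_diff_eq)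
    also have "\<dots> \<le> L x" unfolding L by (intro mult_left_mono *) simp
    finally show ?thesis .
  qed
  have ineq: "cutoff_integral R (- real CARD('n)) (\<lambda>x. x \<bullet> g x) \<le> (\<integral>x. cutoff R x * L x \<partial>lborel)"
    if R: "R > 0" for R
  proof -
    have int: "integrable lborel (\<lambda>x. cutoff R x * (?w x * (2 * rad_tan_div x)))"
      "integrable lborel (\<lambda>x. cutoff R x * (?w x * hess_sq x))"
      "integrable lborel (\<lambda>x. cutoff R x * (?w x * tan_sq x))"
      "integrable lborel (\<lambda>x. cutoff R x * ?g x)"
      by (intro integrable_cutoff R continuous_intros continuous_scalars has_gradD(2)[OF g]; simp)+
    have intL: "integrable lborel (\<lambda>x. cutoff R x * L x)"
      by (rule integrable_cutoff_mult[OF int_L])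
    have zero: "(\<integral>x. cutoff R x * (?w x * (2 * rad_tan_div x)) \<partial>lborel) = 0"
    proof -
      have "(\<integral>x. cutoff R x * (?w x * rad_tan_div x) \<partial>lborel) = 0"
        by (rule integral_tangential_div[OF div_rad_tan _ has_grad_norm_powr R])
          (auto simp: inner_diff_right inner_rules)
      then have "2 * (\<integral>x. cutoff R x * (?w x * rad_tan_div x) \<partial>lborel) = 0" by simp
      then show ?thesis unfolding integral_mult_right_zero[symmetric] by (simp add: mult_ac)
    qed
    have "(\<integral>x. ?S R x \<partial>lborel)
      \<le> (\<integral>x. cutoff R x * L x \<partial>lborel)"
    proof (rule integral_mono_AE)
      show "AE x in lborel. ?S R x \<le> cutoff R x * L x"
        using mult_left_mono[OF pw cutoff_bounds(1)[of R]]
        by (intro AE_nonzero) (simp only: distrib_left right_diff_distrib)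
    qed (use int intL in auto)
    also have "(\<integral>x. ?S R x \<partial>lborel) =
       0 + cutoff_integral R (- 2 * a - 2) hess_sq - cutoff_integral R (- 2 * a - 2) tan_sq + cutoff_integral R (- real CARD('n)) (\<lambda>x. x \<bullet> g x)"
      using int zero by simp
    finally show ?thesis using sphere_gap[OF R] by linarith
  qed
  have "0 \<le> integral\<^sup>L lborel L"
  proof (rule tendsto_le[OF _ cutoff_integral_tendsto[OF int_L]])
    show "((\<lambda>R. \<integral>x. cutoff R x * ?g x \<partial>lborel) \<longlongrightarrow> 0) at_top"
      by (rule radial_derivative_tendsto_0[OF g]) (use boundary_tendsto_0 in auto)
    show "\<forall>\<^sub>F R in at_top. cutoff_integral R (- real CARD('n)) (\<lambda>x. x \<bullet> g x) \<le> (\<integral>x. cutoff R x * L x \<partial>lborel)"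
      using eventually_gt_at_top[of 0] by eventually_elim (rule ineq)
  qed simp
  also have "integral\<^sup>L lborel L = (\<integral>x. (M x \<bullet> M x) / norm x powr (2 * a) \<partial>lborel)
     - \<beta> * (2 * \<sigma> + \<delta>) * (\<integral>x. (U x \<bullet> U x) / norm x powr (a + b + 1) \<partial>lborel)
     + \<beta>\<^sup>2 * (\<integral>x. (U x \<bullet> U x) / norm x powr (2 * b) \<partial>lborel)"
    unfolding L_def using int_M int_U by (simp del: times_divide_eq_right)
  finally show ?thesis by (simp add: \<delta>_def)
qed

end

section \<open>Wirtinger's inequality and the planar case\<close>

text \<open>A Riccati argument: h^2 - g^2 differs from the square (h - g cot)^2 by the derivative of
  g^2 cot, with cot taken at x - c. This primitive tends to 0 at both ends, as g vanishes there and
  the sine has only simple zeros.\<close>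

lemma wirtinger_dirichlet:
  fixes g h :: "real \<Rightarrow> real"
  assumes der: "\<And>x. DERIV g x :> h x" and cont: "continuous_on UNIV h"
    and zero: "g c = 0" "g (c + pi) = 0"
  shows "0 \<le> integral {c..c + pi} (\<lambda>x. (h x)\<^sup>2 - (g x)\<^sup>2)"
proof -
  \<comment> \<open>Grouping g with 1/sin isolates the quotient that has a finite limit at the end
    points. The value of \<open>F\<close> there is 0 because of the other factor g.\<close>
  define F where "F x = g x * (g x / sin (x - c)) * cos (x - c)" for x
  have cg: "continuous_on S g" for S
    using der DERIV_isCont by (blast intro: continuous_at_imp_continuous_on)
  have sin_pos: "sin (x - c) > 0" if "c < x" "x < c + pi" for x
    using that by (intro sin_gt_zero) auto
  have end_cont: "isCont F d" if d: "g d = 0" "sin (d - c) = 0" for d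
  proof -
    have "cos (d - c) \<noteq> 0" using sin_cos_squared_add[of "d - c"] d by auto
    moreover have "((\<lambda>x. sin (x - c)) has_real_derivative cos (d - c)) (at d)"
      by (auto intro!: derivative_eq_intros)
    ultimately have "((\<lambda>x. ((g x - g d) / (x - d)) / ((sin (x - c) - sin (d - c)) / (x - d))) \<longlongrightarrow> h d / cos (d - c)) (at d)"
      using der[of d] unfolding has_field_derivative_iff by (intro tendsto_divide)
    then have "((\<lambda>x. g x / sin (x - c)) \<longlongrightarrow> h d / cos (d - c)) (at d)"
      by (rule Lim_transform_eventually) (auto simp: eventually_at_filter d)
    moreover have "(g \<longlongrightarrow> 0) (at d)" using DERIV_isCont[OF der, of d] d by (simp add: isCont_def)
    moreover have "((\<lambda>x. cos (x - c)) \<longlongrightarrow> cos (d - c)) (at d)" by (intro tendsto_intros)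
    ultimately have "(F \<longlongrightarrow> 0 * (h d / cos (d - c)) * cos (d - c)) (at d)"
      unfolding F_def by (intro tendsto_mult)
    then show ?thesis using d by (simp add: isCont_def F_def)
  qed
  define F' where "F' x = (h x)\<^sup>2 - (g x)\<^sup>2 - (h x - g x * cos (x - c) / sin (x - c))\<^sup>2" for x
  have derF: "(F has_real_derivative F' x) (at x)" if "c < x" "x < c + pi" for x
  proof -
    have s: "sin (x - c) \<noteq> 0" using sin_pos[OF that] by simp
    have ds: "((\<lambda>x. sin (x - c)) has_real_derivative cos (x - c)) (at x)"
      and dc: "((\<lambda>x. cos (x - c)) has_real_derivative - sin (x - c)) (at x)"
      by (auto intro!: derivative_eq_intros)
    have "(F has_real_derivative ((h x * (g x / sin (x - c)) + (h x * sin (x - c) - g x * cos (x - c)) / (sin (x - c) * sin (x - c)) * g x) * cos (x - c)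
        + - sin (x - c) * (g x * (g x / sin (x - c))))) (at x)"
      unfolding F_def by (intro DERIV_mult DERIV_divide der ds dc s)
    then show ?thesis
      by (rule DERIV_cong) (use s in \<open>simp add: F'_def power2_eq_square field_simps\<close>)
  qed
  have "continuous_on {c..c + pi} F"
  proof (rule continuous_at_imp_continuous_on, rule ballI)
    fix x assume "x \<in> {c..c + pi}"
    then consider "x = c" | "x = c + pi" | "c < x" "x < c + pi" by fastforce
    then show "isCont F x"
      using end_cont[of c] end_cont[of "c + pi"] zero derF[of x] DERIV_isCont by cases auto
  qed
  then have "(F' has_integral F (c + pi) - F c) {c..c + pi}"
    using derF by (intro fundamental_theorem_of_calculus_interior)
      (auto simp: has_real_derivative_iff_has_vector_derivative[symmetric])
  then have "(F' has_integral 0) {c..c + pi}" by (simp add: F_def zero)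
  moreover have "((\<lambda>x. (h x)\<^sup>2 - (g x)\<^sup>2) has_integral integral {c..c + pi} (\<lambda>x. (h x)\<^sup>2 - (g x)\<^sup>2)) {c..c + pi}"
    by (intro integrable_integral integrable_continuous_interval continuous_intros cg continuous_on_subset[OF cont]) auto
  ultimately show ?thesis
    by (rule has_integral_le) (auto simp: F'_def)
qed

lemma integral_periodic:
  fixes f :: "real \<Rightarrow> real"
  assumes cont: "continuous_on UNIV f" and per: "\<And>x. f (x + p) = f x" and c: "0 \<le> c" "c \<le> p"
  shows "integral {c..c + p} f = integral {0..p} f"
proof -
  have int: "f integrable_on {a..b}" for a b
    by (intro integrable_continuous_interval continuous_on_subset[OF cont]) auto
  have "integral {0..c} f = integral {p..c + p} f"
    using integral_shift_Icc_real[of 0 c f p] per by (simp add: o_def add.commute[of p])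
  moreover have "integral {0..c} f + integral {c..p} f = integral {0..p} f"
    by (rule Henstock_Kurzweil_Integration.integral_combine) (use c int in auto)
  moreover have "integral {c..p} f + integral {p..c + p} f = integral {c..c + p} f"
    by (rule Henstock_Kurzweil_Integration.integral_combine) (use c int in auto)
  ultimately show ?thesis by linarith
qed

text \<open>Splitting \<open>g\<close> into its parts of period and antiperiod \<open>\<pi>\<close> gives functions that vanish
  somewhere, hence at two points at distance \<open>\<pi>\<close>.\<close>

lemma wirtinger_periodic:
  fixes y g h :: "real \<Rightarrow> real"
  assumes y: "\<And>x. DERIV y x :> g x" and g: "\<And>x. DERIV g x :> h x" and cont: "continuous_on UNIV h"
    and yper: "\<And>x. y (x + 2 * pi) = y x"
    and per: "\<And>x. g (x + 2 * pi) = g x" "\<And>x. h (x + 2 * pi) = h x"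
  shows "0 \<le> integral {0..2 * pi} (\<lambda>x. (h x)\<^sup>2 - (g x)\<^sup>2)"
proof -
  have cg: "continuous_on S g" for S
    using g DERIV_isCont by (blast intro: continuous_at_imp_continuous_on)
  have ch: "continuous_on S h" for S using continuous_on_subset[OF cont] by blast
  have shift: "DERIV (\<lambda>x. f (x + pi)) x :> f' (x + pi)" if "\<And>x. DERIV f x :> f' x" for f f' :: "real \<Rightarrow> real" and x
    using that[of "x + pi"] by (simp add: DERIV_shift)
  have pp: "y (x + pi + pi) = y x" "g (x + pi + pi) = g x" "h (x + pi + pi) = h x" for x
    using yper[of x] per[of x] by (simp_all add: algebra_simps)
  define g1 where "g1 x = (g x + g (x + pi)) / 2" for x
  define h1 where "h1 x = (h x + h (x + pi)) / 2" for x
  define g2 where "g2 x = (g x - g (x + pi)) / 2" for x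
  define h2 where "h2 x = (h x - h (x + pi)) / 2" for x
  have d1: "DERIV g1 x :> h1 x" and d2: "DERIV g2 x :> h2 x" for x
    unfolding g1_def h1_def g2_def h2_def
    by (intro DERIV_cdivide DERIV_add DERIV_diff g shift)+
  have c1: "continuous_on S h1" and c2: "continuous_on S h2" for S
    unfolding h1_def h2_def
    by (intro continuous_intros ch continuous_on_compose2[OF cont]; simp)+
  have cg1: "continuous_on S g1" and cg2: "continuous_on S g2" for S
    using d1 d2 DERIV_isCont by (blast intro: continuous_at_imp_continuous_on)+
  have p1: "g1 (x + pi) = g1 x" "h1 (x + pi) = h1 x" and p2: "g2 (x + pi) = - g2 x" "h2 (x + pi) = - h2 x" for x
    unfolding g1_def h1_def g2_def h2_def pp by (simp_all add: field_simps)
  \<comment> \<open>The average of y and its half-period translate has period pi and derivative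
    \<open>g1\<close>. This is where the periodic primitive y enters, in place of a mean-zero
    condition.\<close>
  obtain z1 where z1: "0 \<le> z1" "z1 \<le> pi" "g1 z1 = 0"
  proof -
    have "DERIV (\<lambda>x. (y x + y (x + pi)) / 2) x :> g1 x" for x
      unfolding g1_def by (intro DERIV_cdivide DERIV_add y shift)
    from MVT2[of 0 pi, OF _ this] obtain z where "0 < z" "z < pi" "pi * g1 z = 0"
      using pp(1)[of 0] by (auto simp: add.commute)
    then show thesis using that[of z] by auto
  qed
  \<comment> \<open>An antiperiodic function takes opposite values at 0 and pi.\<close>
  obtain z2 where z2: "0 \<le> z2" "z2 \<le> pi" "g2 z2 = 0"
  proof -
    have "g2 pi = - g2 0" using p2(1)[of 0] by simp
    then consider "g2 0 \<le> 0" "0 \<le> g2 pi" | "g2 pi \<le> 0" "0 \<le> g2 0" by linarith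
    then show thesis
      using IVT'[of g2 0 0 pi] IVT2'[of g2 pi 0 0] cg2 that by cases (auto simp: pi_ge_zero)
  qed
  have w1: "0 \<le> integral {0..pi} (\<lambda>x. (h1 x)\<^sup>2 - (g1 x)\<^sup>2)"
    using wirtinger_dirichlet[OF d1 c1 z1(3)] z1 p1
      integral_periodic[of "\<lambda>x. (h1 x)\<^sup>2 - (g1 x)\<^sup>2" pi z1]
    by (simp add: continuous_intros c1 cg1)
  have w2: "0 \<le> integral {0..pi} (\<lambda>x. (h2 x)\<^sup>2 - (g2 x)\<^sup>2)"
    using wirtinger_dirichlet[OF d2 c2 z2(3)] z2 p2
      integral_periodic[of "\<lambda>x. (h2 x)\<^sup>2 - (g2 x)\<^sup>2" pi z2]
    by (simp add: continuous_intros c2 cg2)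
  let ?f = "\<lambda>x. (h x)\<^sup>2 - (g x)\<^sup>2"
  have cf: "continuous_on S ?f" for S by (intro continuous_intros ch cg)
  have cfs: "continuous_on S (\<lambda>x. ?f (x + pi))" for S
    by (rule continuous_on_compose2[OF cf[of UNIV]]) (auto intro!: continuous_intros)
  have "integral {0..2 * pi} ?f = integral {0..pi} ?f + integral {pi..2 * pi} ?f"
    by (rule Henstock_Kurzweil_Integration.integral_combine[symmetric])
      (auto intro!: integrable_continuous_interval cf simp: pi_ge_zero)
  also have "integral {pi..2 * pi} ?f = integral {0..pi} (\<lambda>x. ?f (x + pi))"
    using integral_shift_Icc_real[of 0 pi ?f pi] by (simp add: o_def add.commute)
  also have "integral {0..pi} ?f + integral {0..pi} (\<lambda>x. ?f (x + pi)) = integral {0..pi} (\<lambda>x. ?f x + ?f (x + pi))"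
    by (intro integral_add[symmetric] integrable_continuous_interval cf cfs)
  \<comment> \<open>The products of the periodic and the antiperiodic part cancel between x and x +
    pi.\<close>
  also have "\<dots> = integral {0..pi} (\<lambda>x. 2 * (((h1 x)\<^sup>2 - (g1 x)\<^sup>2) + ((h2 x)\<^sup>2 - (g2 x)\<^sup>2)))"
    by (intro integral_cong) (simp add: g1_def g2_def h1_def h2_def power2_eq_square field_simps)
  also have "\<dots> = 2 * (integral {0..pi} (\<lambda>x. (h1 x)\<^sup>2 - (g1 x)\<^sup>2) + integral {0..pi} (\<lambda>x. (h2 x)\<^sup>2 - (g2 x)\<^sup>2))"
    by (subst integral_mult_right, subst integral_add)
      (auto intro!: integrable_continuous_interval continuous_intros c1 c2 cg1 cg2)
  finally show ?thesis using w1 w2 by simp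
qed

text \<open>A two-element index type carries no canonical order; naming its elements i and j fixes
  an orientation, and with it the quarter turn \<open>perp\<close>.\<close>

locale plane =
  fixes i j :: "'n::finite"
  assumes UNIV_ij: "UNIV = {i, j}" and ij: "i \<noteq> j"
begin

definition perp :: "real^'n \<Rightarrow> real^'n" where
  "perp x = (\<chi> k. if k = i then - x $ j else x $ i)"

definition rot :: "real \<Rightarrow> real^'n \<Rightarrow> real^'n" where
  "rot \<theta> x = cos \<theta> *\<^sub>R x + sin \<theta> *\<^sub>R perp x"

lemma sum_ij: "(\<Sum>k\<in>UNIV. f k) = f i + f j"
  unfolding UNIV_ij using ij by simp

lemma perp_nth: "perp x $ i = - x $ j" "perp x $ j = x $ i"
  using ij by (auto simp: perp_def)

lemma vec_eq_ij: "x = y \<longleftrightarrow> x $ i = y $ i \<and> x $ j = (y::real^'n) $ j"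
  unfolding vec_eq_iff using UNIV_ij by (metis UNIV_I insertE singletonD)

lemma inner_ij: "x \<bullet> y = x $ i * y $ i + x $ j * (y::real^'n) $ j"
  by (simp add: inner_vec_def sum_ij)

lemma perp_rules:
  "x \<bullet> perp x = 0" "perp x \<bullet> perp y = x \<bullet> y" "perp (perp x) = - x"
  "perp (x + y) = perp x + perp y" "perp (c *\<^sub>R x) = c *\<^sub>R perp x"
  by (simp_all add: inner_ij vec_eq_ij perp_nth)

lemma rot_perp: "perp (rot \<theta> x) = rot \<theta> (perp x)" "perp (rot \<theta> x) = - sin \<theta> *\<^sub>R x + cos \<theta> *\<^sub>R perp x"
  by (simp_all add: rot_def perp_rules)

lemma rot_inner: "rot \<theta> x \<bullet> rot \<theta> x = x \<bullet> x"
proof -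
  have "rot \<theta> x \<bullet> rot \<theta> x = cos \<theta> * cos \<theta> * (x \<bullet> x) + sin \<theta> * sin \<theta> * (x \<bullet> x)"
    using perp_rules(1)[of x] by (simp add: rot_def inner_simps perp_rules inner_commute[of "perp x"])
  also have "\<dots> = (cos \<theta> * cos \<theta> + sin \<theta> * sin \<theta>) * (x \<bullet> x)" by (simp only: distrib_right)
  finally show ?thesis by (simp add: sin_cos_squared_add3)
qed

lemma rot_eq_0: "rot \<theta> x = 0 \<longleftrightarrow> x = 0"
  by (metis inner_eq_zero_iff rot_inner)

lemma rot_0 [simp]: "rot 0 x = x" by (simp add: rot_def)

lemma rot_periodic: "rot (\<theta> + 2 * pi) x = rot \<theta> x"
  by (simp add: rot_def)

lemma continuous_perp: "continuous_on S perp"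
proof -
  have "continuous_on S (\<lambda>x. \<chi> k. if k = i then - x $ j else x $ i)"
  proof (rule continuous_on_vec_lambda)
    show "continuous_on S (\<lambda>x. if k = i then - x $ j else x $ i)" for k
      by (cases "k = i") (auto intro!: continuous_intros)
  qed
  then show ?thesis by (simp add: perp_def[abs_def])
qed

lemma continuous_rot: "continuous_on S (\<lambda>(\<theta>, x). rot \<theta> x)"
  unfolding rot_def split_beta
  by (intro continuous_intros continuous_on_compose2[OF continuous_perp[of UNIV]]) auto

lemma bounded_linear_rot: "bounded_linear (rot \<theta>)"
  unfolding linear_conv_bounded_linear[symmetric]
  by (rule linearI) (simp_all add: rot_def perp_rules algebra_simps)

lemma DERIV_rot:
  assumes "has_grad f g" "x \<noteq> 0"
  shows "((\<lambda>\<theta>. f (rot \<theta> x)) has_real_derivative (perp (rot \<theta> x) \<bullet> g (rot \<theta> x))) (at \<theta>)"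
proof -
  have "(f has_derivative (\<lambda>h. h \<bullet> g (rot \<theta> x))) (at (rot \<theta> x))"
    using has_gradD(1)[OF assms(1), of "rot \<theta> x"] assms(2) by (simp add: rot_eq_0 gderiv_def)
  moreover have "((\<lambda>\<theta>. rot \<theta> x) has_derivative (\<lambda>s. s *\<^sub>R perp (rot \<theta> x))) (at \<theta>)"
    unfolding rot_def by (auto intro!: derivative_eq_intros simp: rot_perp(2)[unfolded rot_def] algebra_simps)
  ultimately have "((\<lambda>\<theta>. f (rot \<theta> x)) has_derivative (\<lambda>s. (s *\<^sub>R perp (rot \<theta> x)) \<bullet> g (rot \<theta> x))) (at \<theta>)"
    by (rule has_derivative_compose[rotated])
  then show ?thesis by (simp add: has_field_derivative_def mult.commute[of _ "perp _ \<bullet> _"])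
qed

lemma has_div_perp: "has_div perp (\<lambda>x. 0)"
  unfolding has_div_def
proof (intro exI conjI allI impI)
  show "has_grad (\<lambda>x. perp x $ k) (\<lambda>x. if k = i then 0 - axis j 1 else axis i 1)" for k
    unfolding perp_def using has_grad_diff[OF has_grad_const[of 0] has_grad_component[of j]] has_grad_component[of i]
    by auto
  show "0 = (\<Sum>k\<in>UNIV. (if k = i then 0 - axis j 1 else axis i (1::real)) $ k)"
    using ij by (simp add: sum_ij axis_def)
qed

text \<open>The adjoint of a rotation is the inverse rotation, and rotations commute with
  \<open>perp\<close>; this carries the angular derivative over to the rotated point.\<close>

lemma has_grad_rot:
  assumes "has_grad f g"
  obtains g' where "has_grad (\<lambda>x. f (rot \<theta> x)) g'" "\<And>x. x \<noteq> 0 \<Longrightarrow> g' x \<bullet> perp x = perp (rot \<theta> x) \<bullet> g (rot \<theta> x)"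
proof (rule that)
  let ?g = "\<lambda>x. rot (- \<theta>) (g (rot \<theta> x))"
  have adj: "rot \<theta> h \<bullet> z = h \<bullet> rot (- \<theta>) z" for h z
    by (simp add: rot_def inner_ij perp_nth algebra_simps)
  show "has_grad (\<lambda>x. f (rot \<theta> x)) ?g"
    unfolding has_grad_def
  proof (intro conjI allI impI)
    fix x :: "real^'n" assume x: "x \<noteq> 0"
    have "(f has_derivative (\<lambda>h. h \<bullet> g (rot \<theta> x))) (at (rot \<theta> x))"
      using has_gradD(1)[OF assms, of "rot \<theta> x"] x by (simp add: rot_eq_0 gderiv_def)
    from has_derivative_compose[OF bounded_linear_imp_has_derivative[OF bounded_linear_rot] this]
    show "GDERIV (\<lambda>x. f (rot \<theta> x)) x :> ?g x" by (simp add: gderiv_def adj)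
  next
    have c: "continuous_on S (rot \<theta>)" for S \<theta>
      by (intro linear_continuous_on bounded_linear_rot)
    show "continuous_on (- {0}) ?g"
      by (intro continuous_on_compose2[OF c[of UNIV]] continuous_on_compose2[OF has_gradD(2)[OF assms]] c)
        (auto simp: rot_eq_0)
  qed
  show "?g x \<bullet> perp x = perp (rot \<theta> x) \<bullet> g (rot \<theta> x)" for x
    using adj[of "perp x" "g (rot \<theta> x)"] by (simp add: rot_perp(1) inner_commute)
qed

text \<open>k is only controlled off the origin, but the weight vanishes near it, so the product is
  continuous across.\<close>

lemma continuous_weight_rot:
  fixes k :: "real^'n \<Rightarrow> real"
  assumes w: "continuous_on (- {0}) w" "r > 0" "\<And>x. norm x < r \<Longrightarrow> w x = 0" and k: "continuous_on (- {0}) k"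
  shows "continuous_on S (\<lambda>(\<theta>, x). w x * k (rot \<theta> x))"
proof -
  let ?h = "\<lambda>(\<theta>, x). w x * k (rot \<theta> x)"
  have "continuous_on ((UNIV \<times> - {0}) \<union> (UNIV \<times> ball 0 r)) ?h"
  proof (rule continuous_on_open_Un)
    have c: "continuous_on (UNIV \<times> - {0}) (\<lambda>p. rot (fst p) (snd p))"
      using continuous_rot[of "UNIV \<times> - {0}"] by (simp add: split_beta)
    show "continuous_on (UNIV \<times> - {0}) ?h"
      unfolding split_beta
      by (intro continuous_on_mult continuous_on_compose2[OF w(1) continuous_on_snd[OF continuous_on_id]]
          continuous_on_compose2[OF k c]) (auto simp: rot_eq_0)
    have "continuous_on (UNIV \<times> ball 0 r) (\<lambda>_::real \<times> (real^'n). 0::real)" by simp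
    then show "continuous_on (UNIV \<times> ball 0 r) ?h"
      by (rule continuous_on_cong[THEN iffD1, rotated 2]) (use w(3) in auto)
  qed (auto intro!: open_Times)
  moreover have "(UNIV \<times> - {0}) \<union> (UNIV \<times> ball (0::real^'n) r) = (UNIV :: (real \<times> (real^'n)) set)" using w(2) by auto
  ultimately have "continuous_on UNIV ?h" by simp
  then show ?thesis by (rule continuous_on_subset) simp
qed

text \<open>Rotation invariance is obtained from the divergence theorem: the angular derivative of the
  rotated integral is the integral of a divergence.\<close>

lemma integral_rotation_average:
  assumes f: "has_grad f g" and R: "R > 0"
    and pos: "\<And>x. x \<noteq> 0 \<Longrightarrow> 0 \<le> integral {0..2 * pi} (\<lambda>\<theta>. f (rot \<theta> x))"
  shows "0 \<le> cutoff_integral R p f"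
proof -
  define w where "w x = cutoff R x * norm x powr p" for x :: "real^'n"
  define r where "r = sqrt (1/R)"
  define B where "B = sqrt (2 * R)"
  have r: "r > 0" using R by (simp add: r_def)
  have w0: "w x = 0" if "norm x < r \<or> norm x > B" for x
    using cutoff_support[OF R, of x] that by (simp add: w_def r_def B_def)
  have w0': "w x = 0" if "norm x < r" for x using w0 that by blast
  have cw: "continuous_on (- {0}) w"
    unfolding w_def using has_grad_continuous[OF has_grad_cutoff] by (intro continuous_intros) auto
  have wpos: "w x \<ge> 0" for x by (simp add: w_def cutoff_bounds)
  \<comment> \<open>The integrals are moved to a box, over which differentiation in the angle and
    interchange with the angular integral are available.\<close>
  obtain l u where lu: "cball 0 B \<subseteq> cbox l (u :: real^'n)"
    using bounded_subset_cbox_symmetric[OF bounded_cball] by metis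
  have to_box: "(\<integral>x. w x * k x \<partial>lborel) = integral (cbox l u) (\<lambda>x. w x * k x)"
    if k: "continuous_on (- {0}) k" for k :: "real^'n \<Rightarrow> real"
  proof -
    have "integrable lborel (\<lambda>x. w x * k x)"
      by (rule integrable_shell[OF _ r, where B=B]) (auto intro!: continuous_intros cw k simp: w0)
    then have "(\<integral>x. w x * k x \<partial>lborel) = integral UNIV (\<lambda>x. w x * k x)" by (simp add: integral_lborel)
    also have "\<dots> = integral UNIV (\<lambda>x. if x \<in> cbox l u then w x * k x else 0)"
    proof (rule Henstock_Kurzweil_Integration.integral_cong)
      fix x show "w x * k x = (if x \<in> cbox l u then w x * k x else 0)"
        using lu w0[of x] by (cases "norm x > B") (auto simp: subset_iff)
    qed
    also have "\<dots> = integral (cbox l u) (\<lambda>x. w x * k x)"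
      by (rule Henstock_Kurzweil_Integration.integral_restrict_UNIV)
    finally show ?thesis .
  qed
  have cL: "continuous_on (- {0}) (\<lambda>x. perp x \<bullet> g x)"
    by (intro continuous_intros continuous_perp has_gradD(2)[OF f])
  have cf: "continuous_on (- {0}) f" by (rule has_grad_continuous[OF f])
  have cwf: "continuous_on S (\<lambda>(\<theta>, x). w x * f (rot \<theta> x))" for S
    by (rule continuous_weight_rot[OF cw r w0' cf])
  have cwf1: "continuous_on S (\<lambda>x. w x * f (rot \<theta> x))" for \<theta> S
  proof -
    have "continuous_on S (\<lambda>x::real^'n. (\<theta>, x))" by (intro continuous_intros)
    from continuous_on_compose2[OF cwf[of UNIV] this] show ?thesis by simp
  qed
  let ?H = "\<lambda>\<theta>. integral (cbox l u) (\<lambda>x. w x * f (rot \<theta> x))"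
  have dH: "(?H has_real_derivative 0) (at \<theta>)" for \<theta>
  proof -
    have "(?H has_real_derivative integral (cbox l u) (\<lambda>x. w x * (perp (rot \<theta> x) \<bullet> g (rot \<theta> x)))) (at \<theta> within UNIV)"
    proof (rule leibniz_rule_field_derivative)
      show "((\<lambda>\<theta>. w x * f (rot \<theta> x)) has_real_derivative w x * (perp (rot \<theta> x) \<bullet> g (rot \<theta> x))) (at \<theta> within UNIV)" for \<theta> x
      proof (cases "x = 0")
        case True then show ?thesis using w0'[of x] r by simp
      next
        case False then show ?thesis by (intro DERIV_cmult DERIV_rot f)
      qed
      show "(\<lambda>x. w x * f (rot \<theta> x)) integrable_on cbox l u" for \<theta>
        by (intro integrable_continuous cwf1)
      show "continuous_on (UNIV \<times> cbox l u) (\<lambda>(\<theta>, x). w x * (perp (rot \<theta> x) \<bullet> g (rot \<theta> x)))"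
        by (rule continuous_weight_rot[OF cw r w0' cL])
    qed auto
    moreover have "integral (cbox l u) (\<lambda>x. w x * (perp (rot \<theta> x) \<bullet> g (rot \<theta> x))) = 0"
    proof -
      obtain g' where g': "has_grad (\<lambda>x. f (rot \<theta> x)) g'"
        "\<And>x. x \<noteq> 0 \<Longrightarrow> g' x \<bullet> perp x = perp (rot \<theta> x) \<bullet> g (rot \<theta> x)"
        using has_grad_rot[OF f] by metis
      \<comment> \<open>\<open>perp\<close> is divergence free and tangential, so multiplying it by
        the rotated function leaves just the angular derivative as divergence.\<close>
      have "has_div (\<lambda>x. f (rot \<theta> x) *\<^sub>R perp x) (\<lambda>x. perp (rot \<theta> x) \<bullet> g (rot \<theta> x))"
        by (rule has_div_cong[OF has_div_scale[OF g'(1) has_div_perp]]) (auto simp: g'(2))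
      note D = integral_tangential_div[OF this _ has_grad_norm_powr R]
      have "(\<integral>x. w x * (perp (rot \<theta> x) \<bullet> g (rot \<theta> x)) \<partial>lborel) = 0"
        using D[of p] by (simp add: w_def perp_rules mult.assoc)
      moreover have "continuous_on (- {0}) (\<lambda>x. perp (rot \<theta> x) \<bullet> g (rot \<theta> x))"
        by (rule continuous_on_compose2[OF cL linear_continuous_on[OF bounded_linear_rot]]) (auto simp: rot_eq_0)
      ultimately show ?thesis using to_box by metis
    qed
    ultimately show ?thesis by simp
  qed
  have const: "?H \<theta> = ?H 0" for \<theta>
    using DERIV_const_ratio_const[of 0 \<theta> ?H 0] dH by (cases "\<theta> = 0") auto
  \<comment> \<open>The rotated integral does not depend on the angle. Averaging over all angles and
    exchanging the integrals exposes the integral along each circle.\<close>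
  have "2 * pi * ?H 0 = integral (cbox 0 (2 * pi)) (\<lambda>_. ?H 0)"
    by (simp add: pi_ge_zero)
  also have "\<dots> = integral (cbox 0 (2 * pi)) ?H"
    by (rule Henstock_Kurzweil_Integration.integral_cong) (rule const[symmetric])
  also have "\<dots> = integral (cbox l u) (\<lambda>x. integral (cbox 0 (2 * pi)) (\<lambda>\<theta>. w x * f (rot \<theta> x)))"
    by (rule integral_swap_continuous[OF cwf])
  also have "\<dots> \<ge> 0"
  proof (rule Henstock_Kurzweil_Integration.integral_nonneg)
    show "(\<lambda>x. integral (cbox 0 (2 * pi)) (\<lambda>\<theta>. w x * f (rot \<theta> x))) integrable_on cbox l u"
    proof (rule integrable_continuous, rule integral_continuous_on_param)
      have "continuous_on (cbox l u \<times> cbox 0 (2 * pi)) ((\<lambda>(\<theta>, x). w x * f (rot \<theta> x)) \<circ> prod.swap)"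
        by (intro continuous_on_compose continuous_on_swap cwf)
      then show "continuous_on (cbox l u \<times> cbox 0 (2 * pi)) (\<lambda>(x, \<theta>). w x * f (rot \<theta> x))"
        by (simp add: o_def split_beta)
    qed
    show "0 \<le> integral (cbox 0 (2 * pi)) (\<lambda>\<theta>. w x * f (rot \<theta> x))" for x
      using pos[of x] wpos[of x] w0'[of x] r by (cases "x = 0") auto
  qed
  finally have "0 \<le> ?H 0" by (simp add: zero_le_mult_iff pi_gt_zero) (use pi_gt_zero in linarith)
  also have "?H 0 = cutoff_integral R p f"
    using to_box[OF cf] by (simp add: w_def mult.assoc)
  finally show ?thesis .
qed

end

section \<open>Wirtinger's inequality for planar potentials\<close>

locale plane_potential_field = plane i j + potential_field u U M T
  for i j :: "'n::finite" and u :: "real^'n \<Rightarrow> real" and U M T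
begin

lemma card_2: "CARD('n) = 2"
  unfolding UNIV_ij using ij by simp

text \<open>The angular derivative of the potential; its own angular derivative is
  \<open>tau\<close>.\<close>

definition "ang x = perp x \<bullet> U x"

lemma ang_sq: "x \<noteq> 0 \<Longrightarrow> (ang x)\<^sup>2 * inverse (x \<bullet> x) = tan_sq x"
proof -
  assume x: "x \<noteq> 0"
  have "(ang x)\<^sup>2 = (x \<bullet> x) * (U x \<bullet> U x) - (rad x)\<^sup>2"
    unfolding ang_def rad_def inner_ij perp_nth by (simp add: power2_eq_square algebra_simps)
  then show ?thesis using x by (simp add: tan_sq_def field_simps)
qed

text \<open>Tangent spaces of a circle are one-dimensional, so the Hessian is its trace and the
  trace inequality becomes an equality.\<close>

lemma tau_sq: "x \<noteq> 0 \<Longrightarrow> (tau x)\<^sup>2 * inverse (x \<bullet> x) = hess_sq x"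
proof -
  assume x: "x \<noteq> 0"
  define t where "t = x \<bullet> x"
  have t: "t \<noteq> 0" using x by (simp add: t_def)
  have MM: "M x \<bullet> M x = (M x $ i $ i)\<^sup>2 + 2 * (M x $ i $ j)\<^sup>2 + (M x $ j $ j)\<^sup>2"
    using M_sym[OF x, of i j] by (simp add: inner_vec_def sum_ij power2_eq_square)
  have Mx': "Mx x $ k = M x $ k $ i * x $ i + M x $ k $ j * x $ j" for k
    by (simp add: Mx_def matrix_vector_mult_def sum_ij)
  have lap': "lap x = M x $ i $ i + M x $ j $ j" by (simp add: lap_def trace_def sum_ij)
  have z: "(t * lap x - quad x)\<^sup>2 = t\<^sup>2 * (M x \<bullet> M x) - 2 * t * (Mx x \<bullet> Mx x) + (quad x)\<^sup>2"
    unfolding quad_def Mx_def[symmetric] t_def inner_ij Mx' lap' MM M_sym[OF x, of j i]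
    by (simp add: power2_eq_square algebra_simps)
  have tau: "tau x = (t * lap x - quad x) - rad x" by (simp add: tau_def t_def card_2)
  have "t * hess_sq x = (t * lap x - quad x)\<^sup>2 - 2 * rad x * tau x - (rad x)\<^sup>2"
    unfolding z hess_sq_def t_def[symmetric] using t by (simp add: card_2 field_simps power2_eq_square)
  also have "\<dots> = (tau x)\<^sup>2" unfolding tau by (simp add: power2_eq_square algebra_simps)
  finally show ?thesis using t unfolding t_def[symmetric] by (simp add: field_simps)
qed

lemma grad_ang:
  obtains g where "has_grad ang g" "\<And>x. x \<noteq> 0 \<Longrightarrow> perp x \<bullet> g x = tau x"
proof (rule that)
  let ?g = "\<lambda>x. (x $ i *\<^sub>R M x $ j + U x $ j *\<^sub>R axis i 1) - (x $ j *\<^sub>R M x $ i + U x $ i *\<^sub>R axis j 1)"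
  have "has_grad (\<lambda>x. x $ i * U x $ j - x $ j * U x $ i) ?g"
    by (intro has_grad_diff has_grad_mult has_grad_component grad_U)
  then show "has_grad ang ?g"
    by (rule has_grad_cong) (auto simp: ang_def inner_ij perp_nth)
  fix x :: "real^'n" assume x: "x \<noteq> 0"
  show "perp x \<bullet> ?g x = tau x"
    unfolding tau_def lap_def trace_def sum_ij quad_def rad_def inner_ij matrix_vector_mult_def
    using ij M_sym[OF x, of i j]
    by (simp add: card_2 perp_nth sum_ij axis_def power2_eq_square algebra_simps)
qed

lemma grad_tau: obtains g where "has_grad tau g"
proof -
  obtain gq gm where gq: "has_grad quad gq" and "has_grad mixed gm"
    using grad_quad_mixed by metis
  have "\<exists>g. has_grad tau g" unfolding tau_def[abs_def]
    by (rule exI, rule has_grad_diff[OF has_grad_diff[OF has_grad_mult[OF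
          has_grad_inner_self grad_lap] gq] has_grad_mult[OF has_grad_const grad_rad]])
  then show thesis using that by metis
qed

text \<open>The potential itself is the periodic primitive of \<open>ang\<close> that Wirtinger's
  inequality asks for. The exponent p - 2 compensates the factor 1/r^2 in \<open>hess_sq\<close> and
  \<open>tan_sq\<close>.\<close>

lemma integral_hess_sq_ge_plane:
  assumes R: "R > 0"
  shows "cutoff_integral R p tan_sq \<le> cutoff_integral R p hess_sq"
proof -
  obtain ga where ga: "has_grad ang ga" "\<And>x. x \<noteq> 0 \<Longrightarrow> perp x \<bullet> ga x = tau x" using grad_ang by blast
  obtain gt where gt: "has_grad tau gt" using grad_tau by blast
  let ?Q = "\<lambda>x. tau x * tau x - ang x * ang x"
  have gQ: "has_grad ?Q (\<lambda>x. (tau x *\<^sub>R gt x + tau x *\<^sub>R gt x) - (ang x *\<^sub>R ga x + ang x *\<^sub>R ga x))"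
    by (intro has_grad_diff has_grad_mult gt ga)
  have "0 \<le> (\<integral>x. cutoff R x * (norm x powr (p - 2) * ?Q x) \<partial>lborel)"
  proof (rule integral_rotation_average[OF gQ R])
    fix x :: "real^'n" assume x: "x \<noteq> 0"
    have "0 \<le> integral {0..2 * pi} (\<lambda>\<theta>. (tau (rot \<theta> x))\<^sup>2 - (ang (rot \<theta> x))\<^sup>2)"
    proof (rule wirtinger_periodic)
      show "((\<lambda>\<theta>. u (rot \<theta> x)) has_real_derivative ang (rot \<theta> x)) (at \<theta>)" for \<theta>
        using DERIV_rot[OF grad_u x] by (simp add: ang_def)
      show "((\<lambda>\<theta>. ang (rot \<theta> x)) has_real_derivative tau (rot \<theta> x)) (at \<theta>)" for \<theta>
        using DERIV_rot[OF ga(1) x, of \<theta>] ga(2)[of "rot \<theta> x"] x by (simp add: rot_eq_0)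
      have "((\<lambda>\<theta>. tau (rot \<theta> x)) has_real_derivative perp (rot \<theta> x) \<bullet> gt (rot \<theta> x)) (at \<theta>)" for \<theta>
        by (rule DERIV_rot[OF gt x])
      then show "continuous_on UNIV (\<lambda>\<theta>. tau (rot \<theta> x))"
        using DERIV_isCont by (blast intro: continuous_at_imp_continuous_on)
    qed (simp_all only: rot_periodic)
    then show "0 \<le> integral {0..2 * pi} (\<lambda>\<theta>. ?Q (rot \<theta> x))" by (simp add: power2_eq_square)
  qed
  also have "\<dots> = (\<integral>x. cutoff R x * (norm x powr p * hess_sq x) - cutoff R x * (norm x powr p * tan_sq x) \<partial>lborel)"
  proof (rule Bochner_Integration.integral_cong[OF refl])
    fix x :: "real^'n"
    show "cutoff R x * (norm x powr (p - 2) * ?Q x) = cutoff R x * (norm x powr p * hess_sq x) - cutoff R x * (norm x powr p * tan_sq x)"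
    proof (cases "x = 0")
      case False
      have "norm x powr (p - 2) = norm x powr p * inverse (x \<bullet> x)"
        using False by (simp add: powr_diff powr_numeral power2_norm_eq_inner divide_inverse)
      then have "norm x powr (p - 2) * ?Q x = norm x powr p * hess_sq x - norm x powr p * tan_sq x"
        unfolding tau_sq[OF False, symmetric] ang_sq[OF False, symmetric] by (simp add: power2_eq_square algebra_simps)
      then show ?thesis by (simp add: right_diff_distrib)
    qed simp
  qed
  also have "\<dots> = cutoff_integral R p hess_sq - cutoff_integral R p tan_sq"
    by (rule Bochner_Integration.integral_diff)
      (intro integrable_cutoff R continuous_intros continuous_scalars; simp)+
  finally show ?thesis by simp
qed

end

context potential_field begin

lemma integral_hess_sq_ge_tan_sq:
  assumes "CARD('n) \<ge> 2" "R > 0"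
  shows "cutoff_integral R p tan_sq \<le> cutoff_integral R p hess_sq"
proof (cases "CARD('n) = 2")
  case True
  then obtain i j :: 'n where "UNIV = {i, j}" "i \<noteq> j"
    unfolding card_2_iff by blast
  then interpret plane_potential_field i j u U M T
    by unfold_locales
  show ?thesis by (rule integral_hess_sq_ge_plane[OF assms(2)])
next
  case False
  then show ?thesis using assms by (intro integral_hess_sq_ge) auto
qed

end

section \<open>Complex curl-free fields\<close>

lemma frechet_derivative_cong_open:
  assumes "open S" "x \<in> S" "\<And>y. y \<in> S \<Longrightarrow> f y = g y"
  shows "frechet_derivative f (at x) = frechet_derivative g (at x)"
proof -
  have "(f has_derivative F) (at x) \<longleftrightarrow> (g has_derivative F) (at x)" for F
    using has_derivative_transform_within_open[OF _ assms(1,2)] assms(3) by metis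
  then show ?thesis unfolding frechet_derivative_def by simp
qed

lemma differentiable_cong_open:
  assumes "open S" "x \<in> S" "\<And>y. y \<in> S \<Longrightarrow> f y = g y"
  shows "f differentiable (at x) \<longleftrightarrow> g differentiable (at x)"
  unfolding differentiable_def
  using has_derivative_transform_within_open[OF _ assms(1,2)] assms(3) by metis

lemma Ck_on_cong:
  assumes "open S" "\<And>y. y \<in> S \<Longrightarrow> f y = g y"
  shows "Ck_on n f S \<longleftrightarrow> Ck_on n g S"
  using assms(2)
proof (induction n arbitrary: f g)
  case 0
  then show ?case by (auto cong: continuous_on_cong)
next
  case (Suc n)
  have "Ck_on n (\<lambda>x. frechet_derivative f (at x) v) S \<longleftrightarrow> Ck_on n (\<lambda>x. frechet_derivative g (at x) v) S" for v
    by (rule Suc.IH) (use frechet_derivative_cong_open[OF assms(1) _ Suc.prems] in auto)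
  then show ?case
    using differentiable_cong_open[OF assms(1) _ Suc.prems] by auto
qed

lemma smooth_on_partial: "smooth_on f S \<Longrightarrow> smooth_on (partial k f) S"
  unfolding smooth_on_def partial_def[abs_def] using Ck_on.simps(2) by blast

lemma smooth_on_derivative:
  fixes f :: "real^'n \<Rightarrow> 'b::real_normed_vector"
  assumes "smooth_on f S" "x \<in> S"
  shows "(f has_derivative (\<lambda>h. \<Sum>k\<in>UNIV. h $ k *\<^sub>R partial k f x)) (at x)"
proof -
  have "Ck_on (Suc 0) f S" using assms(1) by (simp add: smooth_on_def)
  then have "f differentiable (at x)" using assms(2) by simp
  then have d: "(f has_derivative frechet_derivative f (at x)) (at x)"
    by (simp add: frechet_derivative_works)
  then interpret bounded_linear "frechet_derivative f (at x)" by (rule has_derivative_bounded_linear)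
  have "frechet_derivative f (at x) h = (\<Sum>k\<in>UNIV. h $ k *\<^sub>R partial k f x)" for h
    by (subst basis_expansion[of h, symmetric]) (simp add: sum scaleR partial_def scalar_mult_eq_scaleR)
  then have "frechet_derivative f (at x) = (\<lambda>h. \<Sum>k\<in>UNIV. h $ k *\<^sub>R partial k f x)" by (rule ext)
  with d show ?thesis by metis
qed

lemma smooth_on_continuous: "smooth_on f S \<Longrightarrow> continuous_on S f"
  using Ck_on.simps(1) unfolding smooth_on_def by blast

lemma smooth_on_has_grad:
  fixes f :: "real^'n \<Rightarrow> complex"
  assumes f: "smooth_on f (- {0})" and c: "bounded_linear c"
  shows "has_grad (\<lambda>x. c (f x)) (\<lambda>x. \<chi> k. c (partial k f x))"
  unfolding has_grad_def
proof (intro conjI allI impI)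
  interpret bounded_linear c by (rule c)
  fix x :: "real^'n" assume "x \<noteq> 0"
  then have "(f has_derivative (\<lambda>h. \<Sum>k\<in>UNIV. h $ k *\<^sub>R partial k f x)) (at x)"
    by (intro smooth_on_derivative[OF f]) simp
  from has_derivative[OF this] show "GDERIV (\<lambda>x. c (f x)) x :> (\<chi> k. c (partial k f x))"
    by (simp add: gderiv_def inner_vec_def sum scaleR)
next
  show "continuous_on (- {0}) (\<lambda>x. \<chi> k. c (partial k f x))"
    by (intro continuous_on_vec_lambda continuous_on_compose2[OF linear_continuous_on[OF c, of UNIV]]
        smooth_on_continuous smooth_on_partial f) auto
qed

lemma smooth_potential_field:
  fixes w :: "real^'n \<Rightarrow> complex"
  assumes w: "smooth_on w (- {0})" and c: "bounded_linear c"
  shows "potential_field (\<lambda>x. c (w x)) (\<lambda>x. \<chi> k. c (partial k w x))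
    (\<lambda>x. \<chi> j. \<chi> k. c (partial k (partial j w) x)) (\<lambda>j k x. \<chi> l. c (partial l (partial k (partial j w)) x))"
  by unfold_locales (simp_all add: smooth_on_has_grad[OF _ c] smooth_on_partial w)

lemma quadratic_nonneg_discriminant:
  fixes A B C :: real
  assumes "\<And>\<beta>. 0 \<le> A - \<beta> * B + \<beta>\<^sup>2 * C" and "C \<ge> 0"
  shows "B\<^sup>2 \<le> 4 * A * C"
proof (cases "C = 0")
  case True
  have "B = 0"
  proof (rule ccontr)
    assume "B \<noteq> 0"
    \<comment> \<open>At this \<open>\<beta>\<close> a form without quadratic term takes the value A
      - |A| - 1 < 0.\<close>
    then show False using assms(1)[of "(\<bar>A\<bar> + 1) / B"] True by simp
  qed
  then show ?thesis using True by simp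
next
  case False
  \<comment> \<open>The minimiser of the form.\<close>
  have "0 \<le> A - B / (2 * C) * B + (B / (2 * C))\<^sup>2 * C" by (rule assms)
  also have "\<dots> = (4 * A * C - B\<^sup>2) / (4 * C)" using False by (simp add: field_simps power2_eq_square)
  finally show ?thesis using False \<open>C \<ge> 0\<close> by (simp add: zero_le_divide_iff)
qed

text \<open>All three energies are sums over the real and the imaginary part of the potential, and
  so is the form. \<open>\<sigma>\<close> may be either root, which covers both signs of a - b +
  1.\<close>

theorem curl_free_inequality:
  fixes U :: "real^'n \<Rightarrow> complex^'n" and a b \<sigma> :: real
  assumes dim: "CARD('n) \<ge> 2" and gap: "(real CARD('n) / 2 - a)\<^sup>2 \<ge> real CARD('n) + 1"
    and \<sigma>: "\<sigma>\<^sup>2 = (1 - real CARD('n) / 2 + a)\<^sup>2 + real CARD('n) - 1"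
    and UX: "U \<in> X_space a b" and "curl_free U"
  shows "(\<sigma> + (a - b + 1) / 2)\<^sup>2 * (field_energy (a + b + 1) U)\<^sup>2 \<le> grad_energy a U * field_energy (2 * b) U"
proof -
  obtain w where w: "smooth_on w (- {0})" and Uw: "\<And>x. x \<noteq> 0 \<Longrightarrow> U x = (\<chi> k. partial k w x)"
    using \<open>curl_free U\<close> unfolding curl_free_def by blast
  have intE: "integrable lborel (grad_integrand a U)"
    and intF: "integrable lborel (field_integrand (2 * b) U)"
    and intG: "integrable lborel (field_integrand (a + b + 1) U)"
    using UX by (auto simp: X_space_def)
  define V where "V c x = (\<chi> k. c (partial k w x))" for c :: "complex \<Rightarrow> real" and x
  define M where "M c x = (\<chi> j. \<chi> k. c (partial k (partial j w) x))" for c :: "complex \<Rightarrow> real" and x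
  have pot: "potential_field (\<lambda>x. c (w x)) (V c) (M c) (\<lambda>j k x. \<chi> l. c (partial l (partial k (partial j w)) x))"
    if "bounded_linear c" for c
    using smooth_potential_field[OF w that] unfolding V_def M_def by simp
  have normU: "(norm (U x))\<^sup>2 = V Re x \<bullet> V Re x + V Im x \<bullet> V Im x" if "x \<noteq> 0" for x
    by (simp add: power2_norm_eq_inner Uw[OF that] V_def inner_vec_def inner_complex_def sum.distrib)
  have gradU: "grad_norm_sq U x = M Re x \<bullet> M Re x + M Im x \<bullet> M Im x" if "x \<noteq> 0" for x
  proof -
    have "partial j (\<lambda>y. U y $ k) x = partial j (partial k w) x" for j k
      unfolding partial_def[of j]
      by (subst frechet_derivative_cong_open[of "- {0}" x "\<lambda>y. U y $ k" "partial k w"])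
        (use that Uw in auto)
    then have "grad_norm_sq U x = (\<Sum>j\<in>UNIV. \<Sum>k\<in>UNIV. (cmod (partial j (partial k w) x))\<^sup>2)"
      by (simp add: grad_norm_sq_def)
    also have "\<dots> = (\<Sum>k\<in>UNIV. \<Sum>j\<in>UNIV. (cmod (partial j (partial k w) x))\<^sup>2)"
      by (rule sum.swap)
    finally have "grad_norm_sq U x = (\<Sum>k\<in>UNIV. \<Sum>j\<in>UNIV. (cmod (partial j (partial k w) x))\<^sup>2)" .
    from this[unfolded cmod_power2] show ?thesis
      by (simp add: M_def inner_vec_def sum.distrib power2_eq_square)
  qed
  have bl: "c = Re \<or> c = Im \<Longrightarrow> bounded_linear c" for c
    using bounded_linear_Re bounded_linear_Im by blast
  have intM: "integrable lborel (\<lambda>x. (M c x \<bullet> M c x) / norm x powr (2 * a))" if c: "c = Re \<or> c = Im" for c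
  proof (rule Bochner_Integration.integrable_bound[OF intE])
    interpret potential_field "\<lambda>x. c (w x)" "V c" "M c" "\<lambda>j k x. \<chi> l. c (partial l (partial k (partial j w)) x)"
      by (rule pot[OF bl[OF c]])
    show "(\<lambda>x. (M c x \<bullet> M c x) / norm x powr (2 * a)) \<in> borel_measurable lborel"
      unfolding measurable_lborel2
      by (intro borel_measurable_punctured continuous_intros continuous_M) auto
    show "AE x in lborel. norm ((M c x \<bullet> M c x) / norm x powr (2 * a)) \<le> norm (grad_integrand a U x)"
      by (rule AE_nonzero) (use c in \<open>auto simp: grad_integrand_def gradU intro!: divide_right_mono\<close>)
  qed
  have intV: "integrable lborel (\<lambda>x. (V c x \<bullet> V c x) / norm x powr e)"
    if c: "c = Re \<or> c = Im" and e: "integrable lborel (field_integrand e U)" for c e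
  proof (rule Bochner_Integration.integrable_bound[OF e])
    interpret potential_field "\<lambda>x. c (w x)" "V c" "M c" "\<lambda>j k x. \<chi> l. c (partial l (partial k (partial j w)) x)"
      by (rule pot[OF bl[OF c]])
    show "(\<lambda>x. (V c x \<bullet> V c x) / norm x powr e) \<in> borel_measurable lborel"
      unfolding measurable_lborel2
      by (intro borel_measurable_punctured continuous_intros continuous_U) auto
    show "AE x in lborel. norm ((V c x \<bullet> V c x) / norm x powr e) \<le> norm (field_integrand e U x)"
      by (rule AE_nonzero) (use c in \<open>auto simp: field_integrand_def normU intro!: divide_right_mono\<close>)
  qed
  have lim: "((\<lambda>x. norm x powr e *\<^sub>R V c x) \<longlongrightarrow> 0) F"
    if c: "c = Re \<or> c = Im" and F: "F \<in> {at 0, at_infinity}"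
      and l: "((\<lambda>x. norm x powr e *\<^sub>R U x) \<longlongrightarrow> 0) F" for c e F
  proof (rule Lim_null_comparison)
    show "\<forall>\<^sub>F x in F. norm (norm x powr e *\<^sub>R V c x) \<le> norm (norm x powr e *\<^sub>R U x)"
      using eventually_nonzero[OF F]
    proof eventually_elim
      case (elim x)
      have "(norm (V c x))\<^sup>2 \<le> (norm (U x))\<^sup>2"
        unfolding normU[OF elim] using c by (auto simp: power2_norm_eq_inner)
      then have "norm (V c x) \<le> norm (U x)" using power2_le_imp_le norm_ge_zero by blast
      then show ?case by (simp add: mult_left_mono)
    qed
  qed (use tendsto_norm_zero[OF l] in simp)
  have lims: "((\<lambda>x. norm x powr (- 1 + real CARD('n) / 2 - a) *\<^sub>R U x) \<longlongrightarrow> 0) F"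
    "((\<lambda>x. norm x powr (- b + real CARD('n) / 2) *\<^sub>R U x) \<longlongrightarrow> 0) F"
    if "F \<in> {at 0, at_infinity}" for F
    using UX that by (auto simp: X_space_def)
  let ?E = "\<lambda>c. \<integral>x. (M c x \<bullet> M c x) / norm x powr (2 * a) \<partial>lborel"
  let ?V = "\<lambda>c e. \<integral>x. (V c x \<bullet> V c x) / norm x powr e \<partial>lborel"
  have form: "0 \<le> ?E c - \<beta> * (2 * \<sigma> + (a - b + 1)) * ?V c (a + b + 1) + \<beta>\<^sup>2 * ?V c (2 * b)"
    if c: "c = Re \<or> c = Im" for c \<beta>
  proof -
    interpret P: potential_field "\<lambda>x. c (w x)" "V c" "M c" "\<lambda>j k x. \<chi> l. c (partial l (partial k (partial j w)) x)"
      by (rule pot[OF bl[OF c]])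
    interpret weighted_potential_field "\<lambda>x. c (w x)" "V c" "M c" "\<lambda>j k x. \<chi> l. c (partial l (partial k (partial j w)) x)" a b \<beta> \<sigma>
      by unfold_locales
        (use dim gap \<sigma> lim[OF c] lims intM[OF c] intV[OF c] intF intG P.integral_hess_sq_ge_tan_sq in auto)
    show ?thesis by (rule quadratic_form_nonneg)
  qed
  have E: "grad_energy a U = ?E Re + ?E Im"
  proof -
    have "grad_energy a U = (\<integral>x. (M Re x \<bullet> M Re x) / norm x powr (2 * a) + (M Im x \<bullet> M Im x) / norm x powr (2 * a) \<partial>lborel)"
      unfolding grad_energy_def
      by (rule integral_cong_AE)
        (use intE intM in \<open>auto intro!: AE_nonzero borel_measurable_integrable borel_measurable_add simp: grad_integrand_def gradU add_divide_distrib\<close>)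
    then show ?thesis using intM by simp
  qed
  have V: "field_energy e U = ?V Re e + ?V Im e" if e: "integrable lborel (field_integrand e U)" for e
  proof -
    have "field_energy e U = (\<integral>x. (V Re x \<bullet> V Re x) / norm x powr e + (V Im x \<bullet> V Im x) / norm x powr e \<partial>lborel)"
      unfolding field_energy_def
      by (rule integral_cong_AE)
        (use e intV[OF _ e] in \<open>auto intro!: AE_nonzero borel_measurable_integrable borel_measurable_add simp: field_integrand_def normU add_divide_distrib\<close>)
    then show ?thesis using intV[OF _ e] by simp
  qed
  have "((2 * \<sigma> + (a - b + 1)) * field_energy (a + b + 1) U)\<^sup>2 \<le> 4 * grad_energy a U * field_energy (2 * b) U"
  proof (rule quadratic_nonneg_discriminant)
    fix \<beta>
    show "0 \<le> grad_energy a U - \<beta> * ((2 * \<sigma> + (a - b + 1)) * field_energy (a + b + 1) U) + \<beta>\<^sup>2 * field_energy (2 * b) U"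
      using form[of Re \<beta>] form[of Im \<beta>] unfolding E V[OF intF] V[OF intG] by (simp add: algebra_simps)
    show "0 \<le> field_energy (2 * b) U" by (simp add: field_energy_def field_integrand_def)
  qed
  moreover have "(2 * \<sigma> + (a - b + 1))\<^sup>2 = 4 * (\<sigma> + (a - b + 1) / 2)\<^sup>2"
    by (simp add: power2_eq_square field_simps)
  ultimately show ?thesis by (simp add: power_mult_distrib)
qed

section \<open>Extremal fields\<close>

text \<open>This class is closed under directional derivatives, which makes its members smooth.\<close>

inductive power_exp_class :: "real \<Rightarrow> real \<Rightarrow> (real^'n \<Rightarrow> 'b::real_normed_vector) \<Rightarrow> bool"
  for c \<delta> :: real where
  base: "power_exp_class c \<delta> (\<lambda>x. (norm x powr p * exp (- c * norm x powr \<delta>)) *\<^sub>R v)"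
| inner: "power_exp_class c \<delta> f \<Longrightarrow> power_exp_class c \<delta> (\<lambda>x. (x \<bullet> y) *\<^sub>R f x)"
| scale: "power_exp_class c \<delta> f \<Longrightarrow> power_exp_class c \<delta> (\<lambda>x. k *\<^sub>R f x)"
| add: "power_exp_class c \<delta> f \<Longrightarrow> power_exp_class c \<delta> g \<Longrightarrow> power_exp_class c \<delta> (\<lambda>x. f x + g x)"

lemma power_exp_class_sum:
  assumes "\<And>i. i \<in> I \<Longrightarrow> power_exp_class c \<delta> (f i)"
  shows "power_exp_class c \<delta> (\<lambda>x. \<Sum>i\<in>I. f i x)"
proof -
  have "power_exp_class c \<delta> (\<lambda>x. 0)"
    using power_exp_class.base[of c \<delta> 0 0] by simp
  then show ?thesis
    using assms by (induction I rule: infinite_finite_induct) (auto intro: power_exp_class.add)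
qed

lemma has_grad_power_exp:
  "has_grad (\<lambda>x. norm x powr p * exp (- c * norm x powr \<delta>))
    (\<lambda>x. ((p - c * \<delta> * norm x powr \<delta>) * (norm x powr (p - 2) * exp (- c * norm x powr \<delta>))) *\<^sub>R x)"
proof -
  have "has_grad (\<lambda>x. (\<lambda>z. exp (- c * z)) (norm x powr \<delta>))
      (\<lambda>x::real^'n. (- c * exp (- c * norm x powr \<delta>)) *\<^sub>R ((\<delta> * norm x powr (\<delta> - 2)) *\<^sub>R x))"
    by (rule has_grad_compose[OF has_grad_norm_powr])
      (auto intro!: derivative_eq_intros continuous_intros)
  from has_grad_mult[OF has_grad_norm_powr[of p] this]
  show ?thesis
  proof (rule has_grad_cong)
    fix x :: "real^'n" assume "x \<noteq> 0"
    have "norm x powr p * norm x powr (\<delta> - 2) = norm x powr \<delta> * norm x powr (p - 2)"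
      unfolding powr_add[symmetric] by (simp add: algebra_simps)
    then show "norm x powr p *\<^sub>R (- c * exp (- c * norm x powr \<delta>)) *\<^sub>R (\<delta> * norm x powr (\<delta> - 2)) *\<^sub>R x +
        exp (- c * norm x powr \<delta>) *\<^sub>R (p * norm x powr (p - 2)) *\<^sub>R x =
        ((p - c * \<delta> * norm x powr \<delta>) * (norm x powr (p - 2) * exp (- c * norm x powr \<delta>))) *\<^sub>R x"
      unfolding scaleR_scaleR scaleR_add_left[symmetric]
      by (intro arg_cong2[where f=scaleR] refl) (simp add: algebra_simps)
  qed simp
qed

text \<open>Differentiating the radial factor lowers its power by 2 or shifts it by
  \<open>\<delta>\<close> - 2, at the price of a linear factor in x, which the class admits.\<close>

lemma power_exp_class_derivative:
  fixes f :: "real^'n \<Rightarrow> 'b::real_normed_vector"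
  assumes "power_exp_class c \<delta> f"
  shows "\<exists>f'. (\<forall>x. x \<noteq> 0 \<longrightarrow> (f has_derivative f' x) (at x)) \<and> (\<forall>h. power_exp_class c \<delta> (\<lambda>x. f' x h))"
  using assms
proof induction
  case (base p v)
  let ?e = "\<lambda>x::real^'n. exp (- c * norm x powr \<delta>)"
  let ?f' = "\<lambda>(x::real^'n) h. ((h \<bullet> x) * ((p - c * \<delta> * norm x powr \<delta>) * (norm x powr (p - 2) * ?e x))) *\<^sub>R v"
  let ?d = "\<lambda>h x. (x \<bullet> h) *\<^sub>R (p *\<^sub>R ((norm x powr (p - 2) * ?e x) *\<^sub>R v) + (- c * \<delta>) *\<^sub>R ((norm x powr (p - 2 + \<delta>) * ?e x) *\<^sub>R v))"
  show ?case
  proof (intro exI[of _ ?f'] conjI allI impI)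
    fix x :: "real^'n" assume x: "x \<noteq> 0"
    have "((\<lambda>x. norm x powr p * ?e x) has_derivative (\<lambda>h. h \<bullet> (((p - c * \<delta> * norm x powr \<delta>) * (norm x powr (p - 2) * ?e x)) *\<^sub>R x))) (at x)"
      using has_gradD(1)[OF has_grad_power_exp x] unfolding gderiv_def by simp
    from has_derivative_scaleR_left[OF this, of v]
    show "((\<lambda>x. (norm x powr p * ?e x) *\<^sub>R v) has_derivative ?f' x) (at x)" by (simp add: mult.commute)
  next
    fix h :: "real^'n"
    have "power_exp_class c \<delta> (\<lambda>x. ?d h x)"
      by (intro power_exp_class.intros)
    also have "(\<lambda>x. ?d h x) = (\<lambda>x. ?f' x h)"
    proof
      fix x show "?d h x = ?f' x h"
        unfolding scaleR_scaleR scaleR_add_left[symmetric] powr_add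
        by (intro arg_cong2[where f=scaleR] refl) (simp add: algebra_simps inner_commute)
    qed
    finally show "power_exp_class c \<delta> (\<lambda>x. ?f' x h)" .
  qed
next
  case (inner f y)
  then obtain f' where f': "\<And>x. x \<noteq> 0 \<Longrightarrow> (f has_derivative f' x) (at x)" "\<And>h. power_exp_class c \<delta> (\<lambda>x. f' x h)" by blast
  show ?case
  proof (intro exI[of _ "\<lambda>x h. (x \<bullet> y) *\<^sub>R f' x h + (h \<bullet> y) *\<^sub>R f x"] conjI allI impI)
    fix x :: "real^'n" assume "x \<noteq> 0"
    then show "((\<lambda>x. (x \<bullet> y) *\<^sub>R f x) has_derivative (\<lambda>h. (x \<bullet> y) *\<^sub>R f' x h + (h \<bullet> y) *\<^sub>R f x)) (at x)"
      by (intro has_derivative_scaleR f' has_derivative_inner_left has_derivative_ident)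
  next
    show "power_exp_class c \<delta> (\<lambda>x. (x \<bullet> y) *\<^sub>R f' x h + (h \<bullet> y) *\<^sub>R f x)" for h
      by (intro power_exp_class.intros f' inner.hyps)
  qed
next
  case (scale f k)
  then obtain f' where f': "\<And>x. x \<noteq> 0 \<Longrightarrow> (f has_derivative f' x) (at x)" "\<And>h. power_exp_class c \<delta> (\<lambda>x. f' x h)" by blast
  then show ?case
    by (intro exI[of _ "\<lambda>x h. k *\<^sub>R f' x h"]) (auto intro!: has_derivative_scaleR_right power_exp_class.intros)
next
  case (add f g)
  then obtain f' g' where "\<And>x. x \<noteq> 0 \<Longrightarrow> (f has_derivative f' x) (at x)" "\<And>h. power_exp_class c \<delta> (\<lambda>x. f' x h)"
    "\<And>x. x \<noteq> 0 \<Longrightarrow> (g has_derivative g' x) (at x)" "\<And>h. power_exp_class c \<delta> (\<lambda>x. g' x h)" by blast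
  then show ?case
    by (intro exI[of _ "\<lambda>x h. f' x h + g' x h"]) (auto intro!: has_derivative_add power_exp_class.intros)
qed

lemma power_exp_class_Ck_on:
  fixes f :: "real^'n \<Rightarrow> 'b::real_normed_vector"
  assumes "power_exp_class c \<delta> f"
  shows "Ck_on n f (- {0})"
  using assms
proof (induction n arbitrary: f)
  case (0 f)
  obtain f' where "\<And>x. x \<noteq> 0 \<Longrightarrow> (f has_derivative f' x) (at x)"
    using power_exp_class_derivative[OF 0] by blast
  then have "isCont f x" if "x \<noteq> 0" for x using has_derivative_continuous that by blast
  then show ?case by (auto intro!: continuous_at_imp_continuous_on)
next
  case (Suc n f)
  obtain f' where f': "\<And>x. x \<noteq> 0 \<Longrightarrow> (f has_derivative f' x) (at x)" "\<And>h. power_exp_class c \<delta> (\<lambda>x. f' x h)"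
    using power_exp_class_derivative[OF Suc.prems] by blast
  have "Ck_on n (\<lambda>x. frechet_derivative f (at x) h) (- {0})" for h
    using Suc.IH[OF f'(2)] frechet_derivative_at[OF f'(1)]
    by (subst Ck_on_cong[of _ _ "\<lambda>x. f' x h"]) auto
  then show ?case using f'(1) by (auto simp: differentiable_def)
qed

text \<open>The function 2 \<open>\<alpha>\<close> ln y - c y has its maximum at y = 2
  \<open>\<alpha>\<close> / c. The inequality ln z <= z - 1 at z = c y / (2 \<open>\<alpha>\<close>)
  is exactly this bound.\<close>

lemma bounded_power_exp:
  fixes \<alpha> c :: real
  assumes "\<alpha> > 0" "c > 0"
  obtains K where "\<And>y. y > 0 \<Longrightarrow> (1 + y powr \<alpha>)\<^sup>2 * exp (- c * y) \<le> K"
proof (rule that)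
  fix y :: real assume y: "y > 0"
  let ?L = "2 * \<alpha> * (ln (2 * \<alpha> / c) - 1)"
  have "ln (c * y / (2 * \<alpha>)) \<le> c * y / (2 * \<alpha>) - 1"
    using assms y by (intro ln_le_minus_one) simp
  moreover have "ln (c * y / (2 * \<alpha>)) = ln y - ln (2 * \<alpha> / c)"
    using assms y by (simp add: ln_div ln_mult)
  ultimately have "2 * \<alpha> * ln y \<le> 2 * \<alpha> * (c * y / (2 * \<alpha>) - 1 + ln (2 * \<alpha> / c))"
    using assms(1) by (intro mult_left_mono) auto
  also have "\<dots> = c * y + ?L" using assms(1) by (simp add: field_simps)
  finally have "2 * \<alpha> * ln y - c * y \<le> ?L" by simp
  then have "exp (2 * \<alpha> * ln y - c * y) \<le> exp ?L" by simp
  moreover have "exp (2 * \<alpha> * ln y - c * y) = (y powr \<alpha>)\<^sup>2 * exp (- c * y)"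
    using y by (simp add: powr_def exp_add[symmetric] power2_eq_square exp_diff exp_minus field_simps)
  ultimately have *: "(y powr \<alpha>)\<^sup>2 * exp (- c * y) \<le> exp ?L" by simp
  have "(1 + y powr \<alpha>)\<^sup>2 \<le> 2 + 2 * (y powr \<alpha>)\<^sup>2"
    using zero_le_power2[of "1 - y powr \<alpha>"] by (simp add: power2_eq_square algebra_simps)
  then have "(1 + y powr \<alpha>)\<^sup>2 * exp (- c * y) \<le> (2 + 2 * (y powr \<alpha>)\<^sup>2) * exp (- c * y)"
    by (intro mult_right_mono) auto
  also have "\<dots> = 2 * exp (- c * y) + 2 * ((y powr \<alpha>)\<^sup>2 * exp (- c * y))" by (simp add: algebra_simps)
  also have "\<dots> \<le> 2 * 1 + 2 * exp ?L" using * assms y by (intro add_mono mult_left_mono) auto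
  finally show "(1 + y powr \<alpha>)\<^sup>2 * exp (- c * y) \<le> 2 * 1 + 2 * exp ?L" .
qed

text \<open>In the variable y = r^\<open>\<delta>\<close> the power r^q has a positive exponent, so
  the exponential beats (1 + r^q)^2. The comparison profile vanishes at both ends and has an
  explicit primitive, so it serves for limits and for integrability alike.\<close>

lemma power_exp_bound:
  fixes q \<delta> c :: real
  assumes "q * \<delta> > 0" "c > 0"
  obtains K where "K \<ge> 0" "\<And>r. r > 0 \<Longrightarrow> r powr q * exp (- c * r powr \<delta>) \<le> K * (r powr q / (1 + r powr q)\<^sup>2)"
proof -
  have nz: "\<delta> \<noteq> 0" using assms by auto
  have "q / \<delta> > 0" using assms(1) by (simp add: zero_less_mult_iff zero_less_divide_iff)
  then obtain K where K: "\<And>y. y > 0 \<Longrightarrow> (1 + y powr (q / \<delta>))\<^sup>2 * exp (- c * y) \<le> K"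
    using bounded_power_exp[OF _ assms(2)] by metis
  show thesis
  proof (rule that[of K])
    show "K \<ge> 0" using order_trans[OF _ K[of 1]] by simp
    fix r :: real assume r: "r > 0"
    have p: "(1 + r powr q)\<^sup>2 > 0" using powr_ge_zero[of r q] by (intro zero_less_power) linarith
    have "(1 + r powr q)\<^sup>2 * exp (- c * r powr \<delta>) \<le> K"
      using K[of "r powr \<delta>"] r nz by (simp add: powr_powr)
    then have "exp (- c * r powr \<delta>) \<le> K / (1 + r powr q)\<^sup>2" using p by (simp add: field_simps)
    then show "r powr q * exp (- c * r powr \<delta>) \<le> K * (r powr q / (1 + r powr q)\<^sup>2)"
      using mult_left_mono[of "exp (- c * r powr \<delta>)" "K / (1 + r powr q)\<^sup>2" "r powr q"] by (simp add: mult.commute)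
  qed
qed

text \<open>The profile lies below r^q and below r^(-q), and at either end one of these tends to
  0.\<close>

lemma power_profile_tendsto_0:
  assumes q: "q \<noteq> 0" and F: "F \<in> {at 0, at_infinity}"
  shows "((\<lambda>x::'a::real_normed_vector. norm x powr q / (1 + norm x powr q)\<^sup>2) \<longlongrightarrow> 0) F"
proof -
  let ?g = "\<lambda>q x::'a. norm x powr q / (1 + norm x powr q)\<^sup>2"
  note nz = eventually_nonzero[OF F]
  have bound: "?g q x \<le> norm x powr q" "?g q x \<le> norm x powr (- q)" if "x \<noteq> 0" for x
  proof -
    define y where "y = norm x powr q"
    have y: "y > 0" using that by (simp add: y_def)
    have "1 \<le> (1 + y)\<^sup>2" "y\<^sup>2 \<le> (1 + y)\<^sup>2" using y by (auto simp: power2_eq_square algebra_simps)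
    then have "y / (1 + y)\<^sup>2 \<le> y / 1" "y / (1 + y)\<^sup>2 \<le> y / y\<^sup>2"
      using y by (intro divide_left_mono; simp)+
    then show "?g q x \<le> norm x powr q" "?g q x \<le> norm x powr (- q)"
      using y by (auto simp: y_def powr_minus power2_eq_square field_simps)
  qed
  have pos0: "((\<lambda>x::'a. norm x powr e) \<longlongrightarrow> 0) (at 0)" if "e > 0" for e
    using that by (auto intro!: tendsto_eq_intros)
  have neg: "((\<lambda>x::'a. norm x powr e) \<longlongrightarrow> 0) at_infinity" if "e < 0" for e
    by (rule tendsto_neg_powr[OF that]) (rule filterlim_norm_at_top)
  obtain e where e: "e = q \<or> e = - q" "((\<lambda>x::'a. norm x powr e) \<longlongrightarrow> 0) F"
    using F q pos0[of q] pos0[of "- q"] neg[of q] neg[of "- q"] by (cases "q > 0") fastforce+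
  show ?thesis
  proof (rule Lim_null_comparison[OF _ e(2)], use nz in eventually_elim)
    case (elim x)
    then show ?case using bound[OF elim] e(1) by auto
  qed
qed

text \<open>Fatou's lemma along the cutoffs with R = n + 1.\<close>

lemma integrable_of_cutoff_bound:
  fixes h :: "real^'n \<Rightarrow> real"
  assumes meas: "h \<in> borel_measurable borel" and nn: "\<And>x. 0 \<le> h x"
    and int: "\<And>R. R > 0 \<Longrightarrow> integrable lborel (\<lambda>x. cutoff R x * h x)"
    and bd: "\<And>R. R > 0 \<Longrightarrow> (\<integral>x. cutoff R x * h x \<partial>lborel) \<le> K"
  shows "integrable lborel h"
proof (rule integrableI_nonneg)
  let ?f = "\<lambda>n x. ennreal (cutoff (real (Suc n)) x * h x)"
  have "(\<integral>\<^sup>+x. ennreal (h x) \<partial>lborel) = (\<integral>\<^sup>+x. liminf (\<lambda>n. ?f n x) \<partial>lborel)"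
  proof (rule nn_integral_cong_AE, rule AE_nonzero)
    fix x :: "real^'n" assume x: "x \<noteq> 0"
    have "filterlim (\<lambda>n. real (Suc n)) at_top sequentially"
      using filterlim_real_sequentially filterlim_Suc by (rule filterlim_compose)
    from filterlim_compose[OF cutoff_tendsto[OF x] this]
    have "(\<lambda>n. cutoff (real (Suc n)) x * h x) \<longlonglongrightarrow> 1 * h x" by (intro tendsto_intros)
    then have "(\<lambda>n. ?f n x) \<longlonglongrightarrow> ennreal (h x)" by (simp add: tendsto_ennrealI)
    then show "ennreal (h x) = liminf (\<lambda>n. ?f n x)"
      using lim_imp_Liminf[OF sequentially_bot] by metis
  qed
  also have "\<dots> \<le> liminf (\<lambda>n. \<integral>\<^sup>+x. ?f n x \<partial>lborel)"
    by (rule nn_integral_liminf) (use meas in measurable)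
  also have "\<dots> \<le> liminf (\<lambda>n. ennreal K)"
  proof (intro Liminf_mono always_eventually allI)
    fix n
    have "(\<integral>\<^sup>+x. ?f n x \<partial>lborel) = ennreal (\<integral>x. cutoff (real (Suc n)) x * h x \<partial>lborel)"
      by (rule nn_integral_eq_integral[OF int]) (auto simp: cutoff_bounds nn)
    also have "\<dots> \<le> ennreal K" by (intro ennreal_leI bd) simp
    finally show "(\<integral>\<^sup>+x. ?f n x \<partial>lborel) \<le> ennreal K" .
  qed
  also have "\<dots> = ennreal K" by (simp add: Liminf_const)
  finally show "(\<integral>\<^sup>+x. ennreal (h x) \<partial>lborel) < \<infinity>" by (simp add: le_less_trans)
qed (use meas nn in auto)

text \<open>The profile is the Euler derivative of the bounded function -1 / (q (1 + r^q)). Its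
  cutoff integrals are thus boundary terms, bounded uniformly in R.\<close>

lemma integrable_power_profile:
  assumes q: "q \<noteq> 0"
  shows "integrable lborel (\<lambda>x::real^'n. norm x powr (- real CARD('n)) * (norm x powr q / (1 + norm x powr q)\<^sup>2))"
    (is "integrable lborel ?h")
proof -
  define K where "K = 16 * (unit_ball_vol (real CARD('n)) * 2 powr (real CARD('n) / 2))"
  have pos: "1 + norm x powr q > 0" for x :: "real^'n" using powr_ge_zero[of "norm x" q] by linarith
  let ?f = "\<lambda>x::real^'n. (\<lambda>y. - (1 / q) / (1 + y)) (norm x powr q)"
  have grad: "has_grad ?f (\<lambda>x. ((1 / q) / (1 + norm x powr q)\<^sup>2) *\<^sub>R ((q * norm x powr (q - 2)) *\<^sub>R x))"
  proof (rule has_grad_compose[OF has_grad_norm_powr])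
    show "((\<lambda>y. - (1 / q) / (1 + y)) has_real_derivative 1 / q / (1 + norm x powr q)\<^sup>2) (at (norm x powr q))" for x :: "real^'n"
      using pos[of x] q by (auto intro!: derivative_eq_intros simp: power2_eq_square)
    show "continuous_on (- {0}) (\<lambda>x::real^'n. 1 / q / (1 + norm x powr q)\<^sup>2)"
      using pos by (intro continuous_intros) (auto simp: less_imp_neq[symmetric])
  qed
  let ?g = "\<lambda>x::real^'n. ((1 / q) / (1 + norm x powr q)\<^sup>2) *\<^sub>R ((q * norm x powr (q - 2)) *\<^sub>R x)"
  have xg: "x \<bullet> ?g x = norm x powr q / (1 + norm x powr q)\<^sup>2" for x
  proof (cases "x = 0")
    case False
    have "norm x powr (q - 2) * (x \<bullet> x) = norm x powr q"
      by (rule norm_powr_mult_inner_self[OF False])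
    then show ?thesis using q by simp
  qed simp
  have hc: "continuous_on (- {0}) ?h"
    using pos by (intro continuous_intros) (auto simp: less_imp_neq[symmetric])
  show ?thesis
  proof (rule integrable_of_cutoff_bound[where K="K * \<bar>1 / q\<bar>"])
    show "?h \<in> borel_measurable borel" by (rule borel_measurable_punctured[OF hc])
    fix R :: real assume R: "R > 0"
    show "integrable lborel (\<lambda>x. cutoff R x * ?h x)" by (rule integrable_cutoff[OF hc R])
    have "\<bar>?f x\<bar> \<le> \<bar>1 / q\<bar>" for x
    proof -
      have "\<bar>?f x\<bar> = \<bar>1 / q\<bar> / (1 + norm x powr q)"
        unfolding abs_divide[of "- (1 / q)"] abs_of_pos[OF pos] by simp
      also have "\<dots> \<le> \<bar>1 / q\<bar> / 1" using pos[of x] by (intro divide_left_mono) auto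
      finally show ?thesis by simp
    qed
    then have "\<bar>\<integral>x. cutoff' R x * (x \<bullet> x) * (norm x powr (- real CARD('n)) * ?f x) \<partial>lborel\<bar> \<le> K * \<bar>1 / q\<bar>"
      unfolding K_def by (intro cutoff_boundary_bound has_grad_continuous[OF grad] R)
    moreover have "(\<integral>x. cutoff R x * ?h x \<partial>lborel) = - (\<integral>x. cutoff' R x * (x \<bullet> x) * (norm x powr (- real CARD('n)) * ?f x) \<partial>lborel)"
      using integral_radial_derivative[OF grad R] unfolding xg .
    ultimately show "(\<integral>x. cutoff R x * ?h x \<partial>lborel) \<le> K * \<bar>1 / q\<bar>" by linarith
  qed simp
qed

lemma integral_radial_derivative_eq_0:
  fixes f :: "real^'n \<Rightarrow> real"
  assumes f: "has_grad f g" and lim: "(f \<longlongrightarrow> 0) (at 0)" "(f \<longlongrightarrow> 0) at_infinity"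
    and int: "integrable lborel (\<lambda>x. norm x powr (- real CARD('n)) * (x \<bullet> g x))"
  shows "(\<integral>x. norm x powr (- real CARD('n)) * (x \<bullet> g x) \<partial>lborel) = 0"
  using tendsto_unique[OF _ cutoff_integral_tendsto[OF int] radial_derivative_tendsto_0[OF f lim]]
  by simp

lemma integral_pos_of_pos:
  fixes h :: "'a::euclidean_space \<Rightarrow> real"
  assumes int: "integrable lborel h" and pos: "\<And>x. x \<noteq> 0 \<Longrightarrow> h x > 0"
  shows "integral\<^sup>L lborel h > 0"
proof -
  have nn: "AE x in lborel. 0 \<le> h x" by (rule AE_nonzero) (use pos less_imp_le in blast)
  have "integral\<^sup>L lborel h \<noteq> 0"
  proof
    assume "integral\<^sup>L lborel h = 0"
    then have "AE x in lborel. h x = 0"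
      using integral_nonneg_eq_0_iff_AE[OF int nn] by simp
    moreover have "AE x::'a in lborel. h x \<noteq> 0" by (rule AE_nonzero) (use pos less_imp_neq in metis)
    ultimately have "AE x::'a in lborel. False" by eventually_elim simp
    then have "emeasure lborel (UNIV :: 'a set) = 0"
      by (simp add: AE_iff_measurable[of UNIV])
    then show False by simp
  qed
  with integral_nonneg_AE[OF nn] show ?thesis by simp
qed

text \<open>\<open>\<beta>\<close> and \<open>\<sigma>\<close> both have the sign of a - b + 1,
  which treats the extremal fields of the two cases at once. The type argument only carries the
  dimension.\<close>

locale extremal =
  fixes a b \<sigma> \<gamma> \<beta> :: real and dummy :: "'n::finite itself"
  assumes \<beta>\<delta>: "\<beta> / (a - b + 1) > 0" and \<sigma>\<delta>: "\<sigma> * (a - b + 1) > 0"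
    and \<sigma>: "\<sigma>\<^sup>2 = (1 - real CARD('n) / 2 + a)\<^sup>2 + real CARD('n) - 1"
begin

definition "\<delta> = a - b + 1"
definition "c = \<beta> / \<delta>"
definition "p = - real CARD('n) / 2 + a + \<sigma>"
definition "\<kappa> = 1 - real CARD('n) / 2 + a"

definition \<psi> :: "real^'n \<Rightarrow> real" where
  "\<psi> x = \<gamma> * (norm x powr p * exp (- c * norm x powr \<delta>))"

definition V :: "real^'n \<Rightarrow> complex^'n" where
  "V x = (\<chi> k. complex_of_real (\<psi> x * x $ k))"

lemma nz: "\<delta> \<noteq> 0" "c > 0" "c * \<delta> = \<beta>" "\<sigma> \<noteq> 0"
  using \<beta>\<delta> \<sigma>\<delta> by (auto simp: c_def \<delta>_def)

lemma radial_field_eq: "radial_field a b p \<gamma> \<beta> = V"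
  by (auto simp: radial_field_def V_def \<psi>_def c_def \<delta>_def fun_eq_iff vec_eq_iff mult.assoc)

lemma grad_\<psi>: "has_grad \<psi> (\<lambda>x. ((p - \<beta> * norm x powr \<delta>) * \<psi> x * inverse (x \<bullet> x)) *\<^sub>R x)"
proof -
  have "has_grad \<psi> (\<lambda>x. \<gamma> *\<^sub>R (((p - c * \<delta> * norm x powr \<delta>) * (norm x powr (p - 2) * exp (- c * norm x powr \<delta>))) *\<^sub>R x) +
      (norm x powr p * exp (- c * norm x powr \<delta>)) *\<^sub>R 0)"
    unfolding \<psi>_def[abs_def] by (intro has_grad_mult has_grad_const has_grad_power_exp)
  then show ?thesis
  proof (rule has_grad_cong)
    fix x :: "real^'n" assume x: "x \<noteq> 0"
    have "norm x powr (p - 2) = norm x powr p * inverse (x \<bullet> x)"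
      using x by (simp add: powr_diff powr_numeral power2_norm_eq_inner divide_inverse)
    then show "\<gamma> *\<^sub>R (((p - c * \<delta> * norm x powr \<delta>) * (norm x powr (p - 2) * exp (- c * norm x powr \<delta>))) *\<^sub>R x) +
      (norm x powr p * exp (- c * norm x powr \<delta>)) *\<^sub>R 0 = ((p - \<beta> * norm x powr \<delta>) * \<psi> x * inverse (x \<bullet> x)) *\<^sub>R x"
      unfolding nz(3) by (simp add: \<psi>_def mult_ac)
  qed simp
qed

lemma smooth_V: "smooth_on V (- {0})"
proof -
  let ?f = "\<lambda>k x::real^'n. (x \<bullet> axis k 1) *\<^sub>R ((norm x powr p * exp (- c * norm x powr \<delta>)) *\<^sub>R axis k (complex_of_real \<gamma>))"
  have "power_exp_class c \<delta> (\<lambda>x::real^'n. \<Sum>k\<in>UNIV. ?f k x)"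
    by (intro power_exp_class_sum power_exp_class.intros)
  also have "(\<lambda>x::real^'n. \<Sum>k\<in>UNIV. ?f k x) = V"
    unfolding fun_eq_iff vec_eq_iff
  proof (intro allI)
    fix x :: "real^'n" and i :: 'n
    have "(\<Sum>k\<in>UNIV. ?f k x) $ i
       = (\<Sum>k\<in>UNIV. if k = i then (x $ k * (norm x powr p * exp (- c * norm x powr \<delta>))) *\<^sub>R complex_of_real \<gamma> else 0)"
    proof -
      have "axis k z $ i = (if k = i then z else 0)" for k and z :: complex by (simp add: axis_def)
      then show ?thesis unfolding sum_component by (intro sum.cong) (simp_all add: inner_axis)
    qed
    also have "\<dots> = V x $ i"
      by (simp add: V_def \<psi>_def scaleR_conv_of_real[where 'a=complex] mult_ac)
    finally show "(\<Sum>k\<in>UNIV. ?f k x) $ i = V x $ i" .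
  qed
  finally show ?thesis unfolding smooth_on_def by (blast intro: power_exp_class_Ck_on)
qed

text \<open>A radial potential suffices: a primitive of the radial profile on the positive
  half-line, taken abstractly since it has no elementary form. It need not lie in
  \<open>power_exp_class\<close>, but its first derivatives do.\<close>

lemma curl_free_V: "curl_free V"
proof -
  obtain \<Psi> where \<Psi>: "\<And>r. r > 0 \<Longrightarrow> (\<Psi> has_real_derivative \<gamma> * (r powr (p + 1) * exp (- c * r powr \<delta>))) (at r)"
  proof -
    have "\<exists>F. \<forall>x::real. ereal 0 < ereal x \<longrightarrow> ereal x < \<infinity> \<longrightarrow>
        (F has_vector_derivative \<gamma> * (x powr (p + 1) * exp (- c * x powr \<delta>))) (at x)"
      by (rule einterval_antiderivative) (auto intro!: continuous_intros)
    then show thesis using that by (auto simp: has_real_derivative_iff_has_vector_derivative)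
  qed
  define u where "u x = complex_of_real (\<Psi> (norm x))" for x :: "real^'n"
  define u' where "u' x h = (x \<bullet> h) *\<^sub>R ((norm x powr p * exp (- c * norm x powr \<delta>)) *\<^sub>R complex_of_real \<gamma>)" for x h :: "real^'n"
  have u': "(u has_derivative u' x) (at x)" if x: "x \<noteq> 0" for x
  proof -
    let ?v = "(\<gamma> * (norm x powr (p + 1) * exp (- c * norm x powr \<delta>))) *\<^sub>R sgn x"
    have "GDERIV (\<lambda>x. \<Psi> (norm x)) x :> ?v"
      using x by (intro GDERIV_DERIV_compose[of norm] GDERIV_norm \<Psi>) auto
    then have "((\<lambda>x. \<Psi> (norm x)) has_derivative (\<lambda>h. h \<bullet> ?v)) (at x)"
      by (simp add: gderiv_def)
    from has_derivative_of_real[OF this]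
    have "(u has_derivative (\<lambda>h. complex_of_real (h \<bullet> ?v))) (at x)"
      by (simp add: u_def[abs_def])
    also have "(\<lambda>h. complex_of_real (h \<bullet> ?v)) = u' x"
      using x by (auto simp: fun_eq_iff u'_def sgn_div_norm powr_add scaleR_conv_of_real[where 'a=complex] inner_commute)
    finally show ?thesis .
  qed
  have cls: "power_exp_class c \<delta> (\<lambda>x. u' x h)" for h
    unfolding u'_def by (intro power_exp_class.intros)
  have fd: "frechet_derivative u (at x) = u' x" if "x \<noteq> 0" for x
    using frechet_derivative_at[OF u'[OF that]] by simp
  have "Ck_on n u (- {0})" for n
  proof (cases n)
    case 0
    then show ?thesis
      using u' by (auto intro!: continuous_at_imp_continuous_on has_derivative_continuous)
  next
    case (Suc m)
    have "Ck_on m (\<lambda>x. frechet_derivative u (at x) h) (- {0})" for h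
      by (subst Ck_on_cong[of _ _ "\<lambda>x. u' x h"]) (auto simp: fd power_exp_class_Ck_on[OF cls])
    then show ?thesis using u' Suc by (auto simp: differentiable_def)
  qed
  moreover have "V x = (\<chi> k. partial k u x)" if "x \<noteq> 0" for x
    by (auto simp: vec_eq_iff V_def partial_def fd[OF that] u'_def \<psi>_def inner_axis scaleR_conv_of_real[where 'a=complex] mult_ac)
  ultimately show ?thesis unfolding curl_free_def smooth_on_def by blast
qed

lemma norm_V: "(norm (V x))\<^sup>2 = (\<psi> x)\<^sup>2 * (x \<bullet> x)"
  unfolding power2_norm_eq_inner
  by (simp add: V_def inner_vec_def sum_distrib_left inner_complex_def power2_eq_square mult_ac)

lemma norm_V': "norm (V x) = \<bar>\<psi> x\<bar> * norm x"
  by (rule power2_eq_imp_eq) (simp_all add: norm_V power_mult_distrib flip: power2_norm_eq_inner)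

lemma partial_V: "x \<noteq> 0 \<Longrightarrow> partial j (\<lambda>y. V y $ k) x =
   complex_of_real (\<psi> x * axis k 1 $ j + (p - \<beta> * norm x powr \<delta>) * \<psi> x * inverse (x \<bullet> x) * (x $ j * x $ k))"
proof -
  assume x: "x \<noteq> 0"
  let ?m = "(p - \<beta> * norm x powr \<delta>) * \<psi> x * inverse (x \<bullet> x)"
  have "GDERIV (\<lambda>y. \<psi> y * y $ k) x :> \<psi> x *\<^sub>R axis k 1 + x $ k *\<^sub>R (?m *\<^sub>R x)"
    by (rule has_gradD(1)[OF has_grad_mult[OF grad_\<psi> has_grad_component] x])
  then have "((\<lambda>y. \<psi> y * y $ k) has_derivative (\<lambda>h. h \<bullet> (\<psi> x *\<^sub>R axis k 1 + x $ k *\<^sub>R (?m *\<^sub>R x)))) (at x)"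
    by (simp add: gderiv_def)
  from has_derivative_of_real[OF this]
  have "((\<lambda>y. V y $ k) has_derivative (\<lambda>h. complex_of_real (h \<bullet> (\<psi> x *\<^sub>R axis k 1 + x $ k *\<^sub>R (?m *\<^sub>R x))))) (at x)"
    by (simp add: V_def)
  from frechet_derivative_at[OF this, symmetric]
  show ?thesis by (simp add: partial_def inner_axis' mult_ac)
qed

text \<open>The Jacobian is \<open>\<psi>\<close> times the identity plus m times the projection
  onto x: one radial eigenvalue 1 + m and N - 1 tangential eigenvalues 1.\<close>

lemma grad_norm_sq_V: "x \<noteq> 0 \<Longrightarrow> grad_norm_sq V x =
    (\<psi> x)\<^sup>2 * ((\<kappa> + \<sigma> - \<beta> * norm x powr \<delta>)\<^sup>2 + real CARD('n) - 1)"
proof -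
  assume x: "x \<noteq> 0"
  define m where "m = p - \<beta> * norm x powr \<delta>"
  let ?A = "\<psi> x *\<^sub>R mat 1 + (m * \<psi> x * inverse (x \<bullet> x)) *\<^sub>R outer x x :: real^'n^'n"
  have "grad_norm_sq V x = (\<Sum>j\<in>UNIV. \<Sum>k\<in>UNIV. (?A $ j $ k)\<^sup>2)"
    unfolding grad_norm_sq_def
    unfolding partial_V[OF x] norm_of_real power2_abs
    by (intro sum.cong refl) (simp add: m_def outer_def mat_def axis_def mult_ac eq_commute)
  also have "\<dots> = ?A \<bullet> ?A" by (simp add: inner_vec_def power2_eq_square)
  also have "\<dots> = (\<psi> x)\<^sup>2 * real CARD('n) + 2 * (\<psi> x * (m * \<psi> x * inverse (x \<bullet> x)) * (x \<bullet> x)) + (m * \<psi> x * inverse (x \<bullet> x))\<^sup>2 * (x \<bullet> x)\<^sup>2"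
    by (simp add: inner_simps outer_inner outer_mult_vec mat_inner trace_outer trace_I
        inner_commute[of "outer _ _" "mat 1"] power2_eq_square algebra_simps)
  also have "\<dots> = (\<psi> x)\<^sup>2 * ((1 + m)\<^sup>2 + real CARD('n) - 1)"
    using x by (simp add: power2_eq_square field_simps)
  also have "1 + m = \<kappa> + \<sigma> - \<beta> * norm x powr \<delta>" by (simp add: m_def p_def \<kappa>_def)
  finally show ?thesis .
qed

text \<open>Normalised to the scale-invariant measure |x|^(-N) dx, against which Euler derivatives
  integrate to zero; all three energies become combinations of the moments at e = 0,
  \<open>\<delta>\<close> and 2 \<open>\<delta>\<close>.\<close>

definition \<phi> :: "real \<Rightarrow> real^'n \<Rightarrow> real" where
  "\<phi> e x = \<gamma>\<^sup>2 * (norm x powr (2 * \<sigma> + e) * exp (- (2 * c) * norm x powr \<delta>))"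

abbreviation I :: "real \<Rightarrow> real^'n \<Rightarrow> real" where
  "I e x \<equiv> norm x powr (- real CARD('n)) * \<phi> e x"

lemma \<psi>_sq: "(\<psi> x)\<^sup>2 * norm x powr e = norm x powr (- real CARD('n)) * \<phi> (e + 2 * a) x"
proof -
  have "(norm x powr p)\<^sup>2 * norm x powr e = norm x powr (- real CARD('n)) * norm x powr (2 * \<sigma> + (e + 2 * a))"
    unfolding power2_eq_square powr_add[symmetric] by (simp add: p_def algebra_simps)
  moreover have "(exp (- c * norm x powr \<delta>))\<^sup>2 = exp (- (2 * c) * norm x powr \<delta>)"
    by (simp add: power2_eq_square exp_add[symmetric])
  ultimately have "(norm x powr p)\<^sup>2 * norm x powr e * (exp (- c * norm x powr \<delta>))\<^sup>2 =
     norm x powr (- real CARD('n)) * norm x powr (2 * \<sigma> + (e + 2 * a)) * exp (- (2 * c) * norm x powr \<delta>)" by simp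
  then show ?thesis by (simp add: \<psi>_def \<phi>_def power_mult_distrib mult_ac)
qed

lemma \<phi>_shift: "norm x powr e * \<phi> e' x = \<phi> (e' + e) x"
  by (simp add: \<phi>_def powr_add mult_ac)

lemma sign_facts: "2 * \<sigma> * \<delta> > 0" "(2 * \<sigma> + \<delta>) * \<delta> > 0" "(2 * \<sigma> + 2 * \<delta>) * \<delta> > 0" "\<sigma> * \<delta> > 0" "(\<sigma> + \<delta>) * \<delta> > 0"
proof -
  have "\<sigma> * \<delta> > 0" "\<delta> * \<delta> > 0" using \<sigma>\<delta> nz(1) by (auto simp: \<delta>_def zero_less_mult_iff)
  then show "2 * \<sigma> * \<delta> > 0" "(2 * \<sigma> + \<delta>) * \<delta> > 0" "(2 * \<sigma> + 2 * \<delta>) * \<delta> > 0" "\<sigma> * \<delta> > 0" "(\<sigma> + \<delta>) * \<delta> > 0"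
    by (simp_all add: distrib_right)
qed

text \<open>For positive \<open>\<delta>\<close> the power controls the origin and the exponential
  infinity; for negative \<open>\<delta>\<close> the roles are exchanged.\<close>

lemma power_exp_tendsto_0:
  assumes "q * \<delta> > 0" "d > 0" "F \<in> {at 0, at_infinity}"
  shows "((\<lambda>x::real^'n. norm x powr q * exp (- d * norm x powr \<delta>)) \<longlongrightarrow> 0) F"
proof -
  obtain K where K: "\<And>r. r > 0 \<Longrightarrow> r powr q * exp (- d * r powr \<delta>) \<le> K * (r powr q / (1 + r powr q)\<^sup>2)"
    using power_exp_bound[OF assms(1,2)] by metis
  have q: "q \<noteq> 0" using assms(1) by auto
  have "((\<lambda>x::real^'n. K * (norm x powr q / (1 + norm x powr q)\<^sup>2)) \<longlongrightarrow> K * 0) F"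
    by (intro tendsto_intros power_profile_tendsto_0 q assms)
  then have lim: "((\<lambda>x::real^'n. K * (norm x powr q / (1 + norm x powr q)\<^sup>2)) \<longlongrightarrow> 0) F" by simp
  from eventually_nonzero[OF assms(3)] have "\<forall>\<^sub>F x in F. norm (norm x powr q * exp (- d * norm x powr \<delta>)) \<le> K * (norm x powr q / (1 + norm x powr q)\<^sup>2)"
    by eventually_elim (use K in simp)
  then show ?thesis by (rule Lim_null_comparison[OF _ lim])
qed

lemma integrable_I:
  assumes "(2 * \<sigma> + e) * \<delta> > 0"
  shows "integrable lborel (I e)"
proof -
  define q where "q = 2 * \<sigma> + e"
  have q: "q \<noteq> 0" using assms by (auto simp: q_def)
  obtain K where K: "K \<ge> 0" "\<And>r. r > 0 \<Longrightarrow> r powr q * exp (- (2 * c) * r powr \<delta>) \<le> K * (r powr q / (1 + r powr q)\<^sup>2)"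
    using power_exp_bound[of q \<delta> "2 * c"] assms nz by (auto simp: q_def)
  show ?thesis
  proof (rule Bochner_Integration.integrable_bound)
    show "integrable lborel (\<lambda>x::real^'n. \<gamma>\<^sup>2 * K * (norm x powr (- real CARD('n)) * (norm x powr q / (1 + norm x powr q)\<^sup>2)))"
      by (intro integrable_mult_right integrable_power_profile q)
    show "I e \<in> borel_measurable lborel" unfolding \<phi>_def[abs_def] by measurable
    show "AE x in lborel. norm (I e x) \<le> norm (\<gamma>\<^sup>2 * K * (norm x powr (- real CARD('n)) * (norm x powr q / (1 + norm x powr q)\<^sup>2)))"
    proof (rule AE_nonzero)
      fix x :: "real^'n" assume x: "x \<noteq> 0"
      have "norm x powr (- real CARD('n)) * (\<gamma>\<^sup>2 * (norm x powr q * exp (- (2 * c) * norm x powr \<delta>))) \<le>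
          norm x powr (- real CARD('n)) * (\<gamma>\<^sup>2 * (K * (norm x powr q / (1 + norm x powr q)\<^sup>2)))"
        using K(2)[of "norm x"] x by (intro mult_left_mono) auto
      then show "norm (I e x) \<le> norm (\<gamma>\<^sup>2 * K * (norm x powr (- real CARD('n)) * (norm x powr q / (1 + norm x powr q)\<^sup>2)))"
        using K(1) by (simp add: \<phi>_def q_def abs_mult mult_ac)
    qed
  qed
qed

text \<open>The Euler derivative of \<open>\<phi> e\<close> integrates to zero against |x|^(-N). In
  the variable r^\<open>\<delta>\<close> this is the functional equation of the Gamma
  function.\<close>

lemma integral_I_recurrence:
  assumes e: "(2 * \<sigma> + e) * \<delta> > 0"
  shows "(2 * \<sigma> + e) * integral\<^sup>L lborel (I e) = 2 * \<beta> * integral\<^sup>L lborel (I (e + \<delta>))"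
proof -
  have e': "(2 * \<sigma> + (e + \<delta>)) * \<delta> > 0"
  proof -
    have "(2 * \<sigma> + (e + \<delta>)) * \<delta> = (2 * \<sigma> + e) * \<delta> + \<delta> * \<delta>" by (simp add: algebra_simps)
    moreover have "\<delta> * \<delta> \<ge> 0" by simp
    ultimately show ?thesis using e by linarith
  qed
  let ?g = "\<lambda>x::real^'n. \<gamma>\<^sup>2 *\<^sub>R (((2 * \<sigma> + e - 2 * c * \<delta> * norm x powr \<delta>) * (norm x powr (2 * \<sigma> + e - 2) * exp (- (2 * c) * norm x powr \<delta>))) *\<^sub>R x) + (norm x powr (2 * \<sigma> + e) * exp (- (2 * c) * norm x powr \<delta>)) *\<^sub>R 0"
  have g: "has_grad (\<phi> e) ?g"
    unfolding \<phi>_def[abs_def] by (intro has_grad_mult has_grad_const has_grad_power_exp)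
  have xg: "norm x powr (- real CARD('n)) * (x \<bullet> ?g x) = (2 * \<sigma> + e) * I e x - 2 * \<beta> * I (e + \<delta>) x" for x
  proof (cases "x = 0")
    case False
    have "norm x powr (2 * \<sigma> + e - 2) * (x \<bullet> x) = norm x powr (2 * \<sigma> + e)"
      by (rule norm_powr_mult_inner_self[OF False])
    then have xg: "x \<bullet> ?g x = \<gamma>\<^sup>2 * ((2 * \<sigma> + e - 2 * c * \<delta> * norm x powr \<delta>) * (norm x powr (2 * \<sigma> + e) * exp (- (2 * c) * norm x powr \<delta>)))"
      by (simp add: mult.assoc mult.left_commute)
    have c2: "2 * c * \<delta> = 2 * \<beta>" using nz(3) by simp
    show ?thesis unfolding xg unfolding c2 \<phi>_shift[of x \<delta> e, symmetric] by (simp add: \<phi>_def algebra_simps)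
  qed simp
  have int: "integrable lborel (\<lambda>x. (2 * \<sigma> + e) * I e x - 2 * \<beta> * I (e + \<delta>) x)"
    by (intro Bochner_Integration.integrable_diff integrable_mult_right integrable_I e e')
  have lim: "(\<phi> e \<longlongrightarrow> 0) F" if "F \<in> {at 0, at_infinity}" for F
    using tendsto_mult[OF tendsto_const power_exp_tendsto_0[OF e _ that, of "2 * c"], of "\<gamma>\<^sup>2"] nz(2)
    by (simp add: \<phi>_def[abs_def])
  have "(\<integral>x. (2 * \<sigma> + e) * I e x - 2 * \<beta> * I (e + \<delta>) x \<partial>lborel) = 0"
    using integral_radial_derivative_eq_0[OF g lim lim] int unfolding xg by simp
  then show ?thesis using integrable_I[OF e] integrable_I[OF e'] by simp
qed

lemma field_integrand_V: "x \<noteq> 0 \<Longrightarrow> field_integrand e V x = I (2 * a + 2 - e) x"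
proof -
  assume x: "x \<noteq> 0"
  have "field_integrand e V x = (\<psi> x)\<^sup>2 * norm x powr (2 - e)"
    using x by (simp add: field_integrand_def norm_V powr_diff powr_numeral flip: power2_norm_eq_inner)
  then show ?thesis using \<psi>_sq[of x "2 - e"] by (simp add: algebra_simps)
qed

lemma grad_integrand_V: "x \<noteq> 0 \<Longrightarrow> grad_integrand a V x =
    2 * \<sigma> * (\<kappa> + \<sigma>) * I 0 x - 2 * (\<kappa> + \<sigma>) * \<beta> * I \<delta> x + \<beta>\<^sup>2 * I (2 * \<delta>) x"
proof -
  assume x: "x \<noteq> 0"
  have "grad_integrand a V x = (\<psi> x)\<^sup>2 * norm x powr (- 2 * a) * ((\<kappa> + \<sigma> - \<beta> * norm x powr \<delta>)\<^sup>2 + real CARD('n) - 1)"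
    using x by (simp add: grad_integrand_def grad_norm_sq_V powr_minus divide_inverse mult_ac)
  also have "(\<psi> x)\<^sup>2 * norm x powr (- 2 * a) = I 0 x" using \<psi>_sq[of x "- 2 * a"] by simp
  \<comment> \<open>The value of \<open>\<sigma>\<close>^2 turns the constant term
    (\<open>\<kappa>\<close> + \<open>\<sigma>\<close>)^2 + N - 1 into a multiple of
    \<open>\<sigma>\<close>.\<close>
  also have "(\<kappa> + \<sigma> - \<beta> * norm x powr \<delta>)\<^sup>2 + real CARD('n) - 1 =
      2 * \<sigma> * (\<kappa> + \<sigma>) - 2 * (\<kappa> + \<sigma>) * \<beta> * norm x powr \<delta> + \<beta>\<^sup>2 * (norm x powr \<delta>)\<^sup>2"
    using \<sigma>[folded \<kappa>_def] by (simp add: power2_eq_square algebra_simps)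
  also have "(norm x powr \<delta>)\<^sup>2 = norm x powr (2 * \<delta>)"
    using powr_add[of "norm x" \<delta> \<delta>] by (simp add: power2_eq_square)
  finally show ?thesis
    using \<phi>_shift[of x \<delta> 0] \<phi>_shift[of x "2 * \<delta>" 0] by (simp add: algebra_simps)
qed

lemma measurable_integrands:
  "grad_integrand a V \<in> borel_measurable lborel" "field_integrand e V \<in> borel_measurable lborel"
proof -
  have c: "continuous_on (- {0}) (I e)" for e
    unfolding \<phi>_def by (intro continuous_intros) auto
  have "continuous_on (- {0}) (grad_integrand a V)"
    using continuous_on_cong[of "- {0}" "- {0}" "grad_integrand a V"] grad_integrand_V
    by (auto intro!: continuous_intros c)
  then show "grad_integrand a V \<in> borel_measurable lborel"
    unfolding measurable_lborel2 by (rule borel_measurable_punctured)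
  have "continuous_on (- {0}) (field_integrand e V)"
    using continuous_on_cong[of "- {0}" "- {0}" "field_integrand e V"] field_integrand_V
    by (auto intro!: c)
  then show "field_integrand e V \<in> borel_measurable lborel"
    unfolding measurable_lborel2 by (rule borel_measurable_punctured)
qed

lemma integrable_I': "integrable lborel (I 0)" "integrable lborel (I \<delta>)" "integrable lborel (I (2 * \<delta>))"
  using sign_facts by (auto intro!: integrable_I)

lemma exponents: "2 * a + 2 - 2 * b = 2 * \<delta>" "2 * a + 2 - (a + b + 1) = \<delta>"
  by (auto simp: \<delta>_def)

lemma has_integral_integrands:
  "has_bochner_integral lborel (field_integrand (2 * b) V) (integral\<^sup>L lborel (I (2 * \<delta>)))"
  "has_bochner_integral lborel (field_integrand (a + b + 1) V) (integral\<^sup>L lborel (I \<delta>))"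
  "has_bochner_integral lborel (grad_integrand a V) (\<beta>\<^sup>2 * integral\<^sup>L lborel (I (2 * \<delta>)))"
proof -
  have I: "has_bochner_integral lborel (I e) (integral\<^sup>L lborel (I e))" if "integrable lborel (I e)" for e
    using that by (simp add: has_bochner_integral_iff)
  show "has_bochner_integral lborel (field_integrand (2 * b) V) (integral\<^sup>L lborel (I (2 * \<delta>)))"
    by (rule has_bochner_integralI_AE[OF I[OF integrable_I'(3)] measurable_integrands(2) AE_nonzero])
      (simp add: field_integrand_V exponents)
  show "has_bochner_integral lborel (field_integrand (a + b + 1) V) (integral\<^sup>L lborel (I \<delta>))"
    by (rule has_bochner_integralI_AE[OF I[OF integrable_I'(2)] measurable_integrands(2) AE_nonzero])
      (simp add: field_integrand_V exponents)
  have "has_bochner_integral lborel (grad_integrand a V)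
      (2 * \<sigma> * (\<kappa> + \<sigma>) * integral\<^sup>L lborel (I 0) - 2 * (\<kappa> + \<sigma>) * \<beta> * integral\<^sup>L lborel (I \<delta>) + \<beta>\<^sup>2 * integral\<^sup>L lborel (I (2 * \<delta>)))"
    by (rule has_bochner_integralI_AE[OF has_bochner_integral_add[OF has_bochner_integral_diff[OF
          has_bochner_integral_mult_right[OF I[OF integrable_I'(1)]] has_bochner_integral_mult_right[OF I[OF integrable_I'(2)]]]
          has_bochner_integral_mult_right[OF I[OF integrable_I'(3)]]] measurable_integrands(1) AE_nonzero])
      (simp add: grad_integrand_V)
  \<comment> \<open>The recurrence at e = 0 cancels the two lower moments, leaving the gradient
    energy as \<open>\<beta>\<close>^2 times the energy with weight 2b.\<close>
  moreover have "2 * \<sigma> * integral\<^sup>L lborel (I 0) = 2 * \<beta> * integral\<^sup>L lborel (I \<delta>)"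
    using integral_I_recurrence[of 0] sign_facts by simp
  then have "(\<kappa> + \<sigma>) * (2 * \<sigma> * integral\<^sup>L lborel (I 0)) = (\<kappa> + \<sigma>) * (2 * \<beta> * integral\<^sup>L lborel (I \<delta>))"
    by (rule arg_cong)
  then have "2 * \<sigma> * (\<kappa> + \<sigma>) * integral\<^sup>L lborel (I 0) - 2 * (\<kappa> + \<sigma>) * \<beta> * integral\<^sup>L lborel (I \<delta>) = 0"
    by (simp only: mult_ac diff_self)
  ultimately show "has_bochner_integral lborel (grad_integrand a V) (\<beta>\<^sup>2 * integral\<^sup>L lborel (I (2 * \<delta>)))"
    by simp
qed

lemma energies:
  "field_energy (2 * b) V = integral\<^sup>L lborel (I (2 * \<delta>))"
  "field_energy (a + b + 1) V = integral\<^sup>L lborel (I \<delta>)"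
  "grad_energy a V = \<beta>\<^sup>2 * integral\<^sup>L lborel (I (2 * \<delta>))"
  using has_integral_integrands has_bochner_integral_integral_eq
  unfolding field_energy_def grad_energy_def by blast+

lemma V_in_X_space: "V \<in> X_space a b"
proof -
  have lim: "((\<lambda>x. norm x powr e *\<^sub>R V x) \<longlongrightarrow> 0) F"
    if e: "(e + p + 1) * \<delta> > 0" and F: "F \<in> {at 0, at_infinity}" for e F
  proof (rule tendsto_norm_zero_cancel)
    have "((\<lambda>x::real^'n. \<bar>\<gamma>\<bar> * (norm x powr (e + p + 1) * exp (- c * norm x powr \<delta>))) \<longlongrightarrow> \<bar>\<gamma>\<bar> * 0) F"
      by (intro tendsto_intros power_exp_tendsto_0 e F nz)
    moreover have "norm (norm x powr e *\<^sub>R V x) = \<bar>\<gamma>\<bar> * (norm x powr (e + p + 1) * exp (- c * norm x powr \<delta>))" for x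
      by (cases "x = 0") (simp_all add: norm_V' \<psi>_def abs_mult powr_add mult_ac)
    ultimately show "((\<lambda>x. norm (norm x powr e *\<^sub>R V x)) \<longlongrightarrow> 0) F" by simp
  qed
  \<comment> \<open>The two limit conditions thus concern the exponents \<open>\<sigma>\<close> and
    \<open>\<sigma> + \<delta>\<close>, both of the sign of \<open>\<delta>\<close>.\<close>
  have "- 1 + real CARD('n) / 2 - a + p + 1 = \<sigma>" "- b + real CARD('n) / 2 + p + 1 = \<sigma> + \<delta>"
    by (auto simp: p_def \<delta>_def)
  then show ?thesis
    using smooth_V has_integral_integrands lim sign_facts
    unfolding X_space_def by (auto simp: has_bochner_integral_iff)
qed

text \<open>The recurrence at e = \<open>\<delta>\<close> links the two remaining moments, and its
  factor \<open>\<sigma>\<close> + \<open>\<delta>\<close> / 2 is the constant itself.\<close>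

lemma V_equality:
  "grad_energy a V * field_energy (2 * b) V = (\<sigma> + (a - b + 1) / 2)\<^sup>2 * (field_energy (a + b + 1) V)\<^sup>2"
proof -
  have "(2 * \<sigma> + \<delta>) * integral\<^sup>L lborel (I \<delta>) = 2 * \<beta> * integral\<^sup>L lborel (I (2 * \<delta>))"
    using integral_I_recurrence[of \<delta>] sign_facts by simp
  then have "\<beta> * integral\<^sup>L lborel (I (2 * \<delta>)) = (\<sigma> + \<delta> / 2) * integral\<^sup>L lborel (I \<delta>)"
    by (simp add: field_simps)
  then have "(\<beta> * integral\<^sup>L lborel (I (2 * \<delta>)))\<^sup>2 = ((\<sigma> + \<delta> / 2) * integral\<^sup>L lborel (I \<delta>))\<^sup>2" by simp
  then show ?thesis unfolding energies \<delta>_def[symmetric] by (simp add: power2_eq_square mult_ac)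
qed

lemma field_energy_pos: "\<gamma> \<noteq> 0 \<Longrightarrow> field_energy (a + b + 1) V > 0"
  unfolding energies by (rule integral_pos_of_pos[OF integrable_I'(2)]) (simp add: \<phi>_def)

end

text \<open>Both cases of the theorem in one, distinguished by the root chosen for
  \<open>\<sigma>\<close>: it must have the sign of a - b + 1.\<close>

lemma sharp_curl_free_inequality:
  fixes a b \<sigma> :: real
  assumes dim: "CARD('n::finite) \<ge> 2" and gap: "(real CARD('n) / 2 - a)\<^sup>2 \<ge> real CARD('n) + 1"
    and \<sigma>: "\<sigma>\<^sup>2 = (1 - real CARD('n) / 2 + a)\<^sup>2 + real CARD('n) - 1"
    and pos: "\<sigma> * (a - b + 1) > 0"
  defines "C \<equiv> \<sigma> + (a - b + 1) / 2"
  shows "\<And>U :: real^'n \<Rightarrow> complex^'n. U \<in> X_space a b \<Longrightarrow> curl_free U \<Longrightarrow>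
      C\<^sup>2 * (field_energy (a + b + 1) U)\<^sup>2 \<le> grad_energy a U * field_energy (2 * b) U"
    and "\<And>K. (\<And>U :: real^'n \<Rightarrow> complex^'n. U \<in> X_space a b \<Longrightarrow> curl_free U \<Longrightarrow>
      K * (field_energy (a + b + 1) U)\<^sup>2 \<le> grad_energy a U * field_energy (2 * b) U) \<Longrightarrow> K \<le> C\<^sup>2"
    and "\<And>\<gamma> \<beta>. \<beta> * (a - b + 1) > 0 \<Longrightarrow>
      (let U = (radial_field a b (- real CARD('n) / 2 + a + \<sigma>) \<gamma> \<beta> :: real^'n \<Rightarrow> complex^'n) in
       U \<in> X_space a b \<and> curl_free U \<and>
       grad_energy a U * field_energy (2 * b) U = C\<^sup>2 * (field_energy (a + b + 1) U)\<^sup>2)"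
proof -
  show "C\<^sup>2 * (field_energy (a + b + 1) U)\<^sup>2 \<le> grad_energy a U * field_energy (2 * b) U"
    if "U \<in> X_space a b" "curl_free U" for U :: "real^'n \<Rightarrow> complex^'n"
    unfolding C_def by (rule curl_free_inequality[OF dim gap \<sigma> that])
  have ext: "extremal TYPE('n) a b \<sigma> \<beta>" if "\<beta> * (a - b + 1) > 0" for \<beta>
    using that pos \<sigma> by unfold_locales (auto simp: zero_less_mult_iff zero_less_divide_iff)
  show "let U = (radial_field a b (- real CARD('n) / 2 + a + \<sigma>) \<gamma> \<beta> :: real^'n \<Rightarrow> complex^'n) in
       U \<in> X_space a b \<and> curl_free U \<and>
       grad_energy a U * field_energy (2 * b) U = C\<^sup>2 * (field_energy (a + b + 1) U)\<^sup>2"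
    if "\<beta> * (a - b + 1) > 0" for \<gamma> \<beta>
  proof -
    interpret extremal a b \<sigma> \<gamma> \<beta> "TYPE('n)" by (rule ext[OF that])
    show ?thesis
      using V_in_X_space curl_free_V V_equality
      unfolding radial_field_eq[unfolded p_def] C_def by (simp add: Let_def)
  qed
  show "K \<le> C\<^sup>2" if K: "\<And>U :: real^'n \<Rightarrow> complex^'n. U \<in> X_space a b \<Longrightarrow> curl_free U \<Longrightarrow>
      K * (field_energy (a + b + 1) U)\<^sup>2 \<le> grad_energy a U * field_energy (2 * b) U" for K
  proof -
    have "(a - b + 1) * (a - b + 1) > 0" using pos by (auto simp: zero_less_mult_iff)
    \<comment> \<open>One nonzero extremal field is enough for sharpness; a - b + 1 is a choice of
      \<open>\<beta>\<close> with an admissible sign, and its middle energy is positive and can be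
      cancelled.\<close>
    then interpret extremal a b \<sigma> 1 "a - b + 1" "TYPE('n)" by (rule ext)
    have "K * (field_energy (a + b + 1) V)\<^sup>2 \<le> C\<^sup>2 * (field_energy (a + b + 1) V)\<^sup>2"
      using K[OF V_in_X_space curl_free_V] V_equality by (simp add: C_def)
    then show ?thesis using field_energy_pos by simp
  qed
qed

theorem theorem2p1:
  fixes a b N s :: real
  defines "N \<equiv> real CARD('n::finite)"
  defines "s \<equiv> sqrt ((1 - N / 2 + a)\<^sup>2 + N - 1)"
  assumes "CARD('n) \<ge> 2"
    and "(N / 2 - a)\<^sup>2 \<ge> N + 1"
  shows
    "(a - b + 1 > 0 \<longrightarrow>
        (let C = s + (a - b + 1) / 2 in
          (\<forall>U :: real^'n \<Rightarrow> complex^'n. U \<in> X_space a b \<and> curl_free U \<longrightarrow>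
               grad_energy a U * field_energy (2 * b) U \<ge> C\<^sup>2 * (field_energy (a + b + 1) U)\<^sup>2) \<and>
          (\<forall>K. (\<forall>U :: real^'n \<Rightarrow> complex^'n. U \<in> X_space a b \<and> curl_free U \<longrightarrow>
               grad_energy a U * field_energy (2 * b) U \<ge> K * (field_energy (a + b + 1) U)\<^sup>2)
                 \<longrightarrow> K \<le> C\<^sup>2) \<and>
          (\<forall>\<gamma> \<beta>. \<beta> > 0 \<longrightarrow>
             (let U = (radial_field a b (- N / 2 + a + s) \<gamma> \<beta> :: real^'n \<Rightarrow> complex^'n) in
               U \<in> X_space a b \<and> curl_free U \<and>
               grad_energy a U * field_energy (2 * b) U = C\<^sup>2 * (field_energy (a + b + 1) U)\<^sup>2)))) \<and>
     (a - b + 1 < 0 \<longrightarrow>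
        (let C = s - (a - b + 1) / 2 in
          (\<forall>U :: real^'n \<Rightarrow> complex^'n. U \<in> X_space a b \<and> curl_free U \<longrightarrow>
               grad_energy a U * field_energy (2 * b) U \<ge> C\<^sup>2 * (field_energy (a + b + 1) U)\<^sup>2) \<and>
          (\<forall>K. (\<forall>U :: real^'n \<Rightarrow> complex^'n. U \<in> X_space a b \<and> curl_free U \<longrightarrow>
               grad_energy a U * field_energy (2 * b) U \<ge> K * (field_energy (a + b + 1) U)\<^sup>2)
                 \<longrightarrow> K \<le> C\<^sup>2) \<and>
          (\<forall>\<gamma> \<beta>. \<beta> < 0 \<longrightarrow>
             (let U = (radial_field a b (- N / 2 + a - s) \<gamma> \<beta> :: real^'n \<Rightarrow> complex^'n) in
               U \<in> X_space a b \<and> curl_free U \<and>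
               grad_energy a U * field_energy (2 * b) U = C\<^sup>2 * (field_energy (a + b + 1) U)\<^sup>2))))"
proof -
  have "(1 - N / 2 + a)\<^sup>2 + N - 1 > 0"
    using assms(3) zero_le_power2[of "1 - N / 2 + a"] unfolding N_def by linarith
  then have s: "s > 0" "s\<^sup>2 = (1 - N / 2 + a)\<^sup>2 + N - 1" by (simp_all add: s_def)
  note sharp = sharp_curl_free_inequality[where 'n='n and a=a and b=b, folded N_def, OF assms(3,4)]
  have pos: ?thesis if \<delta>: "a - b + 1 > 0"
  proof -
    have "s * (a - b + 1) > 0" using s \<delta> by simp
    note S = sharp[OF s(2) this]
    show ?thesis
      unfolding Let_def using \<delta> S(1,2) S(3)[unfolded Let_def] by (intro conjI impI allI) auto
  qed
  have neg: ?thesis if \<delta>: "a - b + 1 < 0"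
  proof -
    \<comment> \<open>The negative root is admissible here. It only changes the sign of the
      constant, which enters squared.\<close>
    have 1: "- s * (a - b + 1) > 0" using mult_pos_neg[OF s(1) \<delta>] by simp
    have 2: "(- s)\<^sup>2 = (1 - N / 2 + a)\<^sup>2 + N - 1" using s(2) by simp
    note S = sharp[OF 2 1]
    have C: "(- s + (a - b + 1) / 2)\<^sup>2 = (s - (a - b + 1) / 2)\<^sup>2"
      by (simp add: power2_eq_square algebra_simps)
    have p: "- N / 2 + a + - s = - N / 2 + a - s" by simp
    note S' = S[unfolded C p]
    show ?thesis
      unfolding Let_def using \<delta> S'(1,2) S'(3)[unfolded Let_def, OF mult_neg_neg[OF _ \<delta>]]
      by (intro conjI impI allI) auto
  qed
  show ?thesis using pos neg by (cases "a - b + 1" "0 :: real" rule: linorder_cases) auto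
qed

end
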